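(* Let $J\subsetneq\{0,\ldots,r\}$, $c\in C^J$ and $\mathfrak{t}\in T_J$. The formulas $$\sigma_{c,\mathfrak{t}}(s_j)(x^y):=\frac{k_j^{\chi_{\mathbb{Z}}(\alpha_j(y))}(x^{\alpha_j^\vee}-1)}{k_jx^{\alpha_j^\vee}-k_j^{-1}}\,s_{j,\mathfrak{t}}x^y+\frac{k_j-k_j^{-1}}{k_jx^{\alpha_j^\vee}-k_j^{-1}}\,x^{y-\lfloor D\alpha_j(y)\rfloor\alpha_j^\vee},\qquad\sigma_{c,\mathfrak{t}}(f)(x^y):=fx^y$$ for $0\le j\le r$, $y\in\mathcal{O}_c$ and $f\in\mathcal{Q}$ turn $\mathcal{Q}^{(c)}$ into a $W\ltimes\mathcal{Q}$-module.
   Context: Root data. Let $E$ be a Euclidean space with scalar product $\langle\cdot,\cdot\rangle$; its dual $E^*$ carries the transported scalar product and norm. $\Phi_0\subset E^*$ is a reduced irreducible root system (in its real span), normalised so that long roots have squared norm $2/m^2$ for some $m\in\mathbb{Z}_{>0}$ (if all roots have equal length they are called long). For $\alpha\in\Phi_0$, $\alpha^\vee\in E$ is determined by $\langle y,\alpha^\vee\rangle=2\alpha(y)/\|\alpha\|^2$, and $s_\alpha(y)=y-\alpha(y)\alpha^\vee$. $W_0$ is the Weyl group generated by the $s_\alpha$, $Q^\vee$ the lattice spanned by the $\alpha^\vee$, $\alpha_1,\ldots,\alpha_r$ fixed simple roots, $\Phi_0^\pm$ the positive/negative roots, $\varphi$ the highest root, $s_i=s_{\alpha_i}$. The affine Weyl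 group $W=W_0\ltimes Q^\vee$ acts on $E$, with $\tau(\mu)y=y+\mu$. $\Phi=\Phi_0\times\mathbb{Z}$, where $a=(\alpha,\ell)$ is the affine function $a(y)=\alpha(y)+\ell$ with gradient $Da=\alpha$. Put $\alpha_0=(-\varphi,1)$, $s_0=\tau(\varphi^\vee)s_\varphi$; $(W,\{s_0,\ldots,s_r\})$ is a Coxeter system. $\overline{C}_+=\{y\in E:\ 0\le\alpha(y)\le 1\ \forall\alpha\in\Phi_0^+\}$, and $C^J=\{c\in\overline{C}_+:\ \alpha_j(c)=0\Leftrightarrow j\in J\}$. $\mathcal{O}_c=Wc$, and for $y\in\mathcal{O}_c$, $w_y\in W$ is the element of shortest length with $w_yc=y$. Parameters. $\mathbf{F}$ is a field of characteristic zero, $q\in\mathbf{F}^\times$ not a root of unity, $q_\alpha=q^{2/\|\alpha\|^2}$. $T=\mathrm{Hom}(Q^\vee,\mathbf{F}^\times)$, $\mathfrak{t}^\mu$ is the value of $\mathfrak{t}\in T$ at $\mu$, $\mathfrak{t}^{\alpha_0^\vee}:=q_\varphi\mathfrak{t}^{-\varphi^\vee}$. $W$ acts on $T$ by $(v\mathfrak{t})^\mu=\mathfrak{t}^{v^{-1}\mu}$ ($v\in W_0$), $(\tau(\nu)\mathfrak{t})^\mu=q^{\langle\nu,\mu\rangle}\mathfrak{t}^\mu$. $T_J=\{\mathfrak{t}\in T:\mathfrak{t}^{\alpha_j^\vee}=1\ \forall j\in J\}$, $\mathfrak{t}_y=w_y\mathfrak{t}$. The $k_\alpha\in\mathbf{F}^\times$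 ($\alpha\in\Phi_0$) depend only on $\|\alpha\|$; $k_i=k_{\alpha_i}$ ($i\ge1$), $k_0=k_\varphi$. Quasi-rational functions. $W$ acts on $\mathcal{P}=\bigoplus_{\mu\in Q^\vee}\mathbf{F}x^\mu$ (group algebra of $Q^\vee$) by algebra automorphisms $v(x^\mu)=x^{v\mu}$ ($v\in W_0$), $\tau(\nu)(x^\mu)=q^{-\langle\nu,\mu\rangle}x^\mu$ ($\nu\in Q^\vee$), and by field automorphisms on its quotient field $\mathcal{Q}$; $x^{\alpha_0^\vee}:=q_\varphi x^{-\varphi^\vee}$. $W\ltimes\mathcal{Q}$ is the smashed product algebra over $\mathbf{F}$ (so $wf=w(f)w$ for $w\in W$, $f\in\mathcal{Q}$). $\mathbf{F}[E]=\bigoplus_{y\in E}\mathbf{F}x^y$ is the group algebra of $E$, $\mathcal{P}^{(c)}=\bigoplus_{y\in\mathcal{O}_c}\mathbf{F}x^y$, and $\mathcal{Q}^{(c)}$ is the $\mathcal{Q}$-submodule of $\mathcal{Q}\otimes_{\mathcal{P}}\mathbf{F}[E]$ generated by $\mathcal{P}^{(c)}$. $\chi_{\mathbb{Z}}$ is the characteristic function of $\mathbb{Z}\subset\mathbb{R}$, $s_{i,\mathfrak{t}}x^y=x^{s_iy}$ ($1\le i\le r$), $s_{0,\mathfrak{t}}x^y=\mathfrak{t}_y^{\varphi^\vee}x^{s_\varphi y}$. *)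

theory Defs
  imports
    "HOL-Analysis.Analysis"
    "HOL-Library.Poly_Mapping"
    "HOL-Computational_Algebra.Fraction_Field"
    "HOL-Algebra.Module"
begin

section \<open>Root data\<close>

text \<open>
  The dual of the Euclidean space is identified with the space itself through the scalar
  product (this is how the dual gets its scalar product and norm).  A root \<open>a\<close> is thus a
  vector, and its value at \<open>y\<close> is \<open>a \<bullet> y\<close>.  The roots need not span the space.
\<close>

definition coroot :: "'a::euclidean_space \<Rightarrow> 'a" where
  "coroot a = (2 / (norm a)\<^sup>2) *\<^sub>R a"

definition reflection :: "'a::euclidean_space \<Rightarrow> 'a \<Rightarrow> 'a" where
  "reflection a y = y - (a \<bullet> y) *\<^sub>R coroot a"

definition translation :: "'a::euclidean_space \<Rightarrow> 'a \<Rightarrow> 'a" where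
  "translation \<mu> y = y + \<mu>"

locale reduced_irreducible_root_system =
  fixes \<Phi> :: "'a::euclidean_space set"
  assumes finite_roots: "finite \<Phi>"
    and nonempty: "\<Phi> \<noteq> {}"
    and zero_not_root: "0 \<notin> \<Phi>"
    and reflection_closed: "\<And>a b. a \<in> \<Phi> \<Longrightarrow> b \<in> \<Phi> \<Longrightarrow> reflection a b \<in> \<Phi>"
    and integral: "\<And>a b. a \<in> \<Phi> \<Longrightarrow> b \<in> \<Phi> \<Longrightarrow> b \<bullet> coroot a \<in> \<int>"
    and reduced: "\<And>a c. a \<in> \<Phi> \<Longrightarrow> c *\<^sub>R a \<in> \<Phi> \<Longrightarrow> c = 1 \<or> c = -1"
    and irreducible: "\<And>A B. \<Phi> = A \<union> B \<Longrightarrow> (\<And>a b. a \<in> A \<Longrightarrow> b \<in> B \<Longrightarrow> a \<bullet> b = 0)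
        \<Longrightarrow> A = {} \<or> B = {}"

definition simple_cone :: "nat \<Rightarrow> (nat \<Rightarrow> 'a::euclidean_space) \<Rightarrow> 'a set" where
  "simple_cone r \<alpha> = {(\<Sum>i = 1..r. of_nat (n i) *\<^sub>R \<alpha> i) | n :: nat \<Rightarrow> nat. True}"

text \<open>
  The simple roots are \<open>\<alpha> 1, \<dots>, \<alpha> r\<close>; the value of \<open>\<alpha>\<close> elsewhere is irrelevant (in particular
  \<open>\<alpha> 0\<close> is not the affine simple root, for which see \<open>affine_root\<close> below).
\<close>

locale root_data = reduced_irreducible_root_system \<Phi>
  for \<Phi> :: "'a::euclidean_space set" +
  fixes r :: nat and \<alpha> :: "nat \<Rightarrow> 'a" and \<phi> :: 'a
  assumes normalised: "\<exists>m::nat. m > 0 \<and>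
        (\<forall>a\<in>\<Phi>. (\<forall>b\<in>\<Phi>. norm b \<le> norm a) \<longrightarrow> (norm a)\<^sup>2 = 2 / (real m)\<^sup>2)"
    and simple_roots: "\<alpha> ` {1..r} \<subseteq> \<Phi>"
    and simple_inj: "inj_on \<alpha> {1..r}"
    and simple_independent: "independent (\<alpha> ` {1..r})"
    and simple_base: "\<And>b. b \<in> \<Phi> \<Longrightarrow> b \<in> simple_cone r \<alpha> \<or> - b \<in> simple_cone r \<alpha>"
    and highest_root: "\<phi> \<in> \<Phi>"
    and highest: "\<And>b. b \<in> \<Phi> \<Longrightarrow> \<phi> - b \<in> simple_cone r \<alpha>"

definition positive_roots :: "'a::euclidean_space set \<Rightarrow> nat \<Rightarrow> (nat \<Rightarrow> 'a) \<Rightarrow> 'a set" where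
  "positive_roots \<Phi> r \<alpha> = \<Phi> \<inter> simple_cone r \<alpha>"

definition coroot_lattice :: "'a::euclidean_space set \<Rightarrow> 'a set" where
  "coroot_lattice \<Phi> = {(\<Sum>a\<in>\<Phi>. of_int (n a) *\<^sub>R coroot a) | n :: 'a \<Rightarrow> int. True}"

section \<open>The affine Weyl group\<close>

text \<open>Reflections are involutions, so the generated monoid is the generated group.\<close>

inductive_set finite_weyl :: "'a::euclidean_space set \<Rightarrow> ('a \<Rightarrow> 'a) set"
  for \<Phi> :: "'a set" where
  "id \<in> finite_weyl \<Phi>"
| "a \<in> \<Phi> \<Longrightarrow> v \<in> finite_weyl \<Phi> \<Longrightarrow> reflection a \<circ> v \<in> finite_weyl \<Phi>"

text \<open>
  The semidirect product acts faithfully by affine transformations, and is taken as the group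
  of these transformations.  The element \<open>\<tau>(\<nu>) v\<close> is the map \<open>w\<close> with \<open>\<nu> = w 0\<close> and
  \<open>v = linear_part w\<close>.
\<close>

definition affine_weyl :: "'a::euclidean_space set \<Rightarrow> ('a \<Rightarrow> 'a) set" where
  "affine_weyl \<Phi> = {translation \<nu> \<circ> v | \<nu> v. \<nu> \<in> coroot_lattice \<Phi> \<and> v \<in> finite_weyl \<Phi>}"

definition linear_part :: "('a::euclidean_space \<Rightarrow> 'a) \<Rightarrow> 'a \<Rightarrow> 'a" where
  "linear_part w y = w y - w 0"

text \<open>The affine simple roots \<open>\<alpha>\<^sub>0 = (-\<phi>, 1)\<close>, \<open>\<alpha>\<^sub>j = (\<alpha> j, 0)\<close>: gradient and values.\<close>

definition gradient :: "(nat \<Rightarrow> 'a::euclidean_space) \<Rightarrow> 'a \<Rightarrow> nat \<Rightarrow> 'a" where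
  "gradient \<alpha> \<phi> j = (if j = 0 then - \<phi> else \<alpha> j)"

definition affine_root :: "(nat \<Rightarrow> 'a::euclidean_space) \<Rightarrow> 'a \<Rightarrow> nat \<Rightarrow> 'a \<Rightarrow> real" where
  "affine_root \<alpha> \<phi> j y = gradient \<alpha> \<phi> j \<bullet> y + (if j = 0 then 1 else 0)"

definition simple_reflection :: "(nat \<Rightarrow> 'a::euclidean_space) \<Rightarrow> 'a \<Rightarrow> nat \<Rightarrow> 'a \<Rightarrow> 'a" where
  "simple_reflection \<alpha> \<phi> j =
     (if j = 0 then translation (coroot \<phi>) \<circ> reflection \<phi> else reflection (\<alpha> j))"

definition weyl_length ::
  "nat \<Rightarrow> (nat \<Rightarrow> 'a::euclidean_space) \<Rightarrow> 'a \<Rightarrow> ('a \<Rightarrow> 'a) \<Rightarrow> nat" where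
  "weyl_length r \<alpha> \<phi> w = (LEAST n. \<exists>js. length js = n \<and> set js \<subseteq> {0..r} \<and>
     w = foldr (\<lambda>j u. simple_reflection \<alpha> \<phi> j \<circ> u) js id)"

definition closed_alcove :: "'a::euclidean_space set \<Rightarrow> nat \<Rightarrow> (nat \<Rightarrow> 'a) \<Rightarrow> 'a set" where
  "closed_alcove \<Phi> r \<alpha> = {y. \<forall>a\<in>positive_roots \<Phi> r \<alpha>. 0 \<le> a \<bullet> y \<and> a \<bullet> y \<le> 1}"

definition alcove_face ::
  "'a::euclidean_space set \<Rightarrow> nat \<Rightarrow> (nat \<Rightarrow> 'a) \<Rightarrow> 'a \<Rightarrow> nat set \<Rightarrow> 'a set" where
  "alcove_face \<Phi> r \<alpha> \<phi> J =
     {c \<in> closed_alcove \<Phi> r \<alpha>. \<forall>j\<in>{0..r}. affine_root \<alpha> \<phi> j c = 0 \<longleftrightarrow> j \<in> J}"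

definition weyl_orbit :: "'a::euclidean_space set \<Rightarrow> 'a \<Rightarrow> 'a set" where
  "weyl_orbit \<Phi> c = (\<lambda>w. w c) ` affine_weyl \<Phi>"

definition shortest_to ::
  "'a::euclidean_space set \<Rightarrow> nat \<Rightarrow> (nat \<Rightarrow> 'a) \<Rightarrow> 'a \<Rightarrow> 'a \<Rightarrow> 'a \<Rightarrow> 'a \<Rightarrow> 'a" where
  "shortest_to \<Phi> r \<alpha> \<phi> c y =
     (ARG_MIN (weyl_length r \<alpha> \<phi>) w. w \<in> affine_weyl \<Phi> \<and> w c = y)"

section \<open>The torus\<close>

text \<open>
  The exponents \<open>2/\<parallel>a\<parallel>\<^sup>2\<close> for a root \<open>a\<close>, and \<open>\<nu> \<bullet> \<mu>\<close> for \<open>\<nu>, \<mu>\<close> in the coroot lattice, are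
  integers by the normalisation of the roots; the floor below only converts the type.
\<close>

definition q_root :: "'f::field \<Rightarrow> 'a::euclidean_space \<Rightarrow> 'f" where
  "q_root q a = q powi \<lfloor>2 / (norm a)\<^sup>2\<rfloor>"

text \<open>Only the values of a torus element on the coroot lattice are relevant.\<close>

definition torus :: "'a::euclidean_space set \<Rightarrow> ('a \<Rightarrow> 'f::field) set" where
  "torus \<Phi> = {t. (\<forall>\<mu>\<in>coroot_lattice \<Phi>. t \<mu> \<noteq> 0) \<and>
     (\<forall>\<mu>\<in>coroot_lattice \<Phi>. \<forall>\<nu>\<in>coroot_lattice \<Phi>. t (\<mu> + \<nu>) = t \<mu> * t \<nu>)}"

text \<open>The action of \<open>w = \<tau>(w 0) v\<close>, where \<open>v = linear_part w\<close>.\<close>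

definition torus_action ::
  "'f::field \<Rightarrow> ('a::euclidean_space \<Rightarrow> 'a) \<Rightarrow> ('a \<Rightarrow> 'f) \<Rightarrow> 'a \<Rightarrow> 'f" where
  "torus_action q w t \<mu> = q powi \<lfloor>w 0 \<bullet> \<mu>\<rfloor> * t (inv_into UNIV (linear_part w) \<mu>)"

definition torus_value ::
  "'f::field \<Rightarrow> (nat \<Rightarrow> 'a::euclidean_space) \<Rightarrow> 'a \<Rightarrow> ('a \<Rightarrow> 'f) \<Rightarrow> nat \<Rightarrow> 'f" where
  "torus_value q \<alpha> \<phi> t j =
     (if j = 0 then q_root q \<phi> * t (- coroot \<phi>) else t (coroot (\<alpha> j)))"

definition torus_face ::
  "'f::field \<Rightarrow> 'a::euclidean_space set \<Rightarrow> (nat \<Rightarrow> 'a) \<Rightarrow> 'a \<Rightarrow> nat set \<Rightarrow> ('a \<Rightarrow> 'f) set" where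
  "torus_face q \<Phi> \<alpha> \<phi> J = {t \<in> torus \<Phi>. \<forall>j\<in>J. torus_value q \<alpha> \<phi> t j = 1}"

definition torus_point ::
  "'f::field \<Rightarrow> 'a::euclidean_space set \<Rightarrow> nat \<Rightarrow> (nat \<Rightarrow> 'a) \<Rightarrow> 'a \<Rightarrow> 'a \<Rightarrow> ('a \<Rightarrow> 'f)
     \<Rightarrow> 'a \<Rightarrow> ('a \<Rightarrow> 'f)" where
  "torus_point q \<Phi> r \<alpha> \<phi> c t y = torus_action q (shortest_to \<Phi> r \<alpha> \<phi> c y) t"

section \<open>The group algebra of a Euclidean space\<close>

text \<open>
  This is a copy of the convolution algebra \<open>'a \<Rightarrow>\<^sub>0 'f\<close>.  A copy is needed because the library
  makes the latter an integral domain only for linearly ordered exponents.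
\<close>

typedef (overloaded) ('a, 'f) group_algebra =
  "UNIV :: ('a::euclidean_space \<Rightarrow>\<^sub>0 'f::field) set"
  morphisms coeff_map of_coeff_map ..

setup_lifting type_definition_group_algebra

lemma ex_separating_inner:
  fixes S :: "'a::euclidean_space set"
  assumes "finite S"
  shows "\<exists>v. inj_on (\<lambda>x. v \<bullet> x) S"
proof -
  define D where "D = (\<lambda>(x, y). x - y) ` (S \<times> S) - {0}"
  have "finite D" using assms by (simp add: D_def)
  moreover have "negligible {v. d \<bullet> v = 0}" if "d \<in> D" for d
    using that by (intro negligible_hyperplane) (auto simp: D_def)
  ultimately have "negligible (\<Union>d\<in>D. {v. d \<bullet> v = 0})"
    by (intro negligible_Union) auto
  then obtain v where "\<And>d. d \<in> D \<Longrightarrow> d \<bullet> v \<noteq> 0"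
    using non_negligible_UNIV by (metis (mono_tags, lifting) UNIV_I UNIV_eq_I UN_iff mem_Collect_eq)
  then have v: "d \<bullet> v \<noteq> 0" if "d \<in> D" for d using that by blast
  have "inj_on (\<lambda>x. v \<bullet> x) S"
  proof (rule inj_onI, rule ccontr)
    fix x y assume "x \<in> S" "y \<in> S" "v \<bullet> x = v \<bullet> y" "x \<noteq> y"
    then have "x - y \<in> D" "(x - y) \<bullet> v = 0"
      by (auto simp: D_def inner_diff_right inner_commute[of _ v])
    with v show False by blast
  qed
  then show ?thesis ..
qed

lemma group_algebra_no_zero_divisors:
  fixes f g :: "'a::euclidean_space \<Rightarrow>\<^sub>0 'f::field"
  assumes "f \<noteq> 0" "g \<noteq> 0"
  shows "f * g \<noteq> 0"
proof -
  obtain v where inj: "inj_on (\<lambda>x. v \<bullet> x) (Poly_Mapping.keys f \<union> Poly_Mapping.keys g)"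
    using ex_separating_inner[of "Poly_Mapping.keys f \<union> Poly_Mapping.keys g"] by auto
  have top: "\<exists>a\<in>K. \<forall>x\<in>K. v \<bullet> x \<le> v \<bullet> a" if "finite K" "K \<noteq> {}" for K
  proof -
    have "Max ((\<lambda>x. v \<bullet> x) ` K) \<in> (\<lambda>x. v \<bullet> x) ` K" using that by simp
    then obtain a where a: "a \<in> K" "v \<bullet> a = Max ((\<lambda>x. v \<bullet> x) ` K)" by auto
    then show ?thesis using that by (intro bexI[of _ a]) auto
  qed
  obtain a where a: "a \<in> Poly_Mapping.keys f" "\<And>x. x \<in> Poly_Mapping.keys f \<Longrightarrow> v \<bullet> x \<le> v \<bullet> a"
    using top[of "Poly_Mapping.keys f"] assms by auto
  obtain b where b: "b \<in> Poly_Mapping.keys g" "\<And>x. x \<in> Poly_Mapping.keys g \<Longrightarrow> v \<bullet> x \<le> v \<bullet> b"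
    using top[of "Poly_Mapping.keys g"] assms by auto
  have "Poly_Mapping.lookup (f * g) (a + b) =
      (\<Sum>(x, y). Poly_Mapping.lookup f x * Poly_Mapping.lookup g y when a + b = x + y)"
    by (simp add: times_poly_mapping.rep_eq prod_fun_unfold_prod)
  also have "\<dots> = (\<Sum>xy. Poly_Mapping.lookup f a * Poly_Mapping.lookup g b when (a, b) = xy)"
  proof (rule Sum_any.cong, clarify)
    fix x y
    show "(Poly_Mapping.lookup f x * Poly_Mapping.lookup g y when a + b = x + y) =
        (Poly_Mapping.lookup f a * Poly_Mapping.lookup g b when (a, b) = (x, y))"
    proof (cases "x \<in> Poly_Mapping.keys f \<and> y \<in> Poly_Mapping.keys g \<and> a + b = x + y")
      case True
      then have "v \<bullet> a + v \<bullet> b = v \<bullet> x + v \<bullet> y" by (metis inner_add_right)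
      with a(2)[of x] b(2)[of y] True have "v \<bullet> x = v \<bullet> a" "v \<bullet> y = v \<bullet> b" by auto
      with inj True a(1) b(1) have "x = a" "y = b" by (auto dest: inj_onD)
      then show ?thesis by simp
    next
      case False
      with a(1) b(1) show ?thesis by (auto simp: when_def in_keys_iff)
    qed
  qed
  also have "\<dots> = Poly_Mapping.lookup f a * Poly_Mapping.lookup g b" by simp
  also have "\<dots> \<noteq> 0" using a b by (simp add: in_keys_iff)
  finally show ?thesis by auto
qed

instantiation group_algebra :: (euclidean_space, field) idom
begin

lift_definition zero_group_algebra :: "('a, 'b) group_algebra" is 0 .
lift_definition one_group_algebra :: "('a, 'b) group_algebra" is 1 .
lift_definition plus_group_algebra ::
  "('a, 'b) group_algebra \<Rightarrow> ('a, 'b) group_algebra \<Rightarrow> ('a, 'b) group_algebra" is "(+)" .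
lift_definition minus_group_algebra ::
  "('a, 'b) group_algebra \<Rightarrow> ('a, 'b) group_algebra \<Rightarrow> ('a, 'b) group_algebra" is "(-)" .
lift_definition uminus_group_algebra ::
  "('a, 'b) group_algebra \<Rightarrow> ('a, 'b) group_algebra" is uminus .
lift_definition times_group_algebra ::
  "('a, 'b) group_algebra \<Rightarrow> ('a, 'b) group_algebra \<Rightarrow> ('a, 'b) group_algebra" is "(*)" .

instance
  by (intro_classes; transfer;
      simp add: algebra_simps group_algebra_no_zero_divisors)

end

section \<open>Quasi-rational functions\<close>

text \<open>
  \<open>('a, 'f) fun_field\<close> is the quotient field of the group algebra \<open>\<^bold>F[E]\<close>.  It serves as the
  ambient space: \<open>\<P>\<close> is the subring of \<open>\<^bold>F[E]\<close> of elements supported on the coroot lattice,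
  \<open>\<Q>\<close> the subfield of quotients of elements of \<open>\<P>\<close>, and the multiplication map embeds
  \<open>\<Q> \<otimes>\<^bsub>\<P>\<^esub> \<^bold>F[E]\<close>, which is the localisation of the domain \<open>\<^bold>F[E]\<close> at \<open>\<P> - {0}\<close>, into
  the ambient field.  So \<open>\<Q>\<^sup>(\<^sup>c\<^sup>)\<close> is the \<open>\<Q>\<close>-span of its monomials there.
\<close>

type_synonym ('a, 'f) fun_field = "('a, 'f) group_algebra fract"

definition monomial :: "'a::euclidean_space \<Rightarrow> ('a, 'f::field) fun_field" where
  "monomial y = Fract (of_coeff_map (Poly_Mapping.single y 1)) 1"

definition scalar :: "'f::field \<Rightarrow> ('a::euclidean_space, 'f) fun_field" where
  "scalar z = Fract (of_coeff_map (Poly_Mapping.single 0 z)) 1"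

definition lattice_algebra ::
  "'a::euclidean_space set \<Rightarrow> ('a, 'f::field) group_algebra set" where
  "lattice_algebra \<Phi> = {p. Poly_Mapping.keys (coeff_map p) \<subseteq> coroot_lattice \<Phi>}"

definition rational_functions ::
  "'a::euclidean_space set \<Rightarrow> ('a, 'f::field) fun_field set" where
  "rational_functions \<Phi> =
     {Fract a b | a b. a \<in> lattice_algebra \<Phi> \<and> b \<in> lattice_algebra \<Phi> \<and> b \<noteq> 0}"

text \<open>On monomials: \<open>\<tau>(\<nu>) v\<close> maps \<open>x\<^sup>\<mu>\<close> to \<open>q\<close> to the power \<open>-(\<nu> \<bullet> v \<mu>)\<close> times \<open>x\<close> to the power
  \<open>v \<mu>\<close>.\<close>

definition lattice_algebra_action ::
  "'f::field \<Rightarrow> ('a::euclidean_space \<Rightarrow> 'a)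
     \<Rightarrow> ('a, 'f) group_algebra \<Rightarrow> ('a, 'f) group_algebra" where
  "lattice_algebra_action q w p = of_coeff_map (\<Sum>\<mu>\<in>Poly_Mapping.keys (coeff_map p).
     Poly_Mapping.single (linear_part w \<mu>)
       (Poly_Mapping.lookup (coeff_map p) \<mu> * q powi (- \<lfloor>w 0 \<bullet> linear_part w \<mu>\<rfloor>)))"

definition rational_action ::
  "'f::field \<Rightarrow> 'a::euclidean_space set \<Rightarrow> ('a \<Rightarrow> 'a)
     \<Rightarrow> ('a, 'f) fun_field \<Rightarrow> ('a, 'f) fun_field" where
  "rational_action q \<Phi> w f = (THE h. \<exists>a\<in>lattice_algebra \<Phi>. \<exists>b\<in>lattice_algebra \<Phi>.
     b \<noteq> 0 \<and> f = Fract a b \<and>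
     h = Fract (lattice_algebra_action q w a) (lattice_algebra_action q w b))"

definition quasi_rational ::
  "'a::euclidean_space set \<Rightarrow> 'a \<Rightarrow> ('a, 'f::field) fun_field set" where
  "quasi_rational \<Phi> c = {(\<Sum>y\<in>S. f y * monomial y) | S f.
     finite S \<and> S \<subseteq> weyl_orbit \<Phi> c \<and> (\<forall>y\<in>S. f y \<in> rational_functions \<Phi>)}"

section \<open>The smashed product and its modules\<close>

text \<open>
  An element \<open>\<Sum> f\<^sub>w w\<close> of \<open>W \<ltimes> \<Q>\<close> is the finitely supported map \<open>w \<mapsto> f\<^sub>w\<close>, so that
  \<open>(f u) (g v) = (f u(g)) (u v)\<close>.
\<close>

definition smash_mult ::
  "'f::field \<Rightarrow> 'a::euclidean_space set \<Rightarrow> (('a \<Rightarrow> 'a) \<Rightarrow>\<^sub>0 ('a, 'f) fun_field)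
     \<Rightarrow> (('a \<Rightarrow> 'a) \<Rightarrow>\<^sub>0 ('a, 'f) fun_field) \<Rightarrow> (('a \<Rightarrow> 'a) \<Rightarrow>\<^sub>0 ('a, 'f) fun_field)" where
  "smash_mult q \<Phi> A B = (\<Sum>u\<in>Poly_Mapping.keys A. \<Sum>v\<in>Poly_Mapping.keys B.
     Poly_Mapping.single (u \<circ> v)
       (Poly_Mapping.lookup A u * rational_action q \<Phi> u (Poly_Mapping.lookup B v)))"

definition smash_product ::
  "'f::field \<Rightarrow> 'a::euclidean_space set \<Rightarrow> (('a \<Rightarrow> 'a) \<Rightarrow>\<^sub>0 ('a, 'f) fun_field) ring" where
  "smash_product q \<Phi> =
     \<lparr>carrier = {A. Poly_Mapping.keys A \<subseteq> affine_weyl \<Phi> \<and>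
        (\<forall>w. Poly_Mapping.lookup A w \<in> rational_functions \<Phi>)},
      mult = smash_mult q \<Phi>, one = Poly_Mapping.single id 1, zero = 0, add = (+)\<rparr>"

definition smash_weyl ::
  "('a::euclidean_space \<Rightarrow> 'a) \<Rightarrow> ('a \<Rightarrow> 'a) \<Rightarrow>\<^sub>0 ('a, 'f::field) fun_field" where
  "smash_weyl w = Poly_Mapping.single w 1"

definition smash_fun ::
  "('a::euclidean_space, 'f::field) fun_field \<Rightarrow> ('a \<Rightarrow> 'a) \<Rightarrow>\<^sub>0 ('a, 'f) fun_field" where
  "smash_fun f = Poly_Mapping.single id f"

text \<open>The library locale \<open>module\<close> with the commutativity of the ring dropped.\<close>

locale left_module = R?: ring R + M?: abelian_group M
  for R :: "('b, 'c) ring_scheme" (structure)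
    and M :: "('b, 'd, 'e) module_scheme" (structure) +
  assumes smult_closed:
      "\<lbrakk>a \<in> carrier R; x \<in> carrier M\<rbrakk> \<Longrightarrow> a \<odot>\<^bsub>M\<^esub> x \<in> carrier M"
    and smult_l_distr: "\<lbrakk>a \<in> carrier R; b \<in> carrier R; x \<in> carrier M\<rbrakk> \<Longrightarrow>
      (a \<oplus> b) \<odot>\<^bsub>M\<^esub> x = a \<odot>\<^bsub>M\<^esub> x \<oplus>\<^bsub>M\<^esub> b \<odot>\<^bsub>M\<^esub> x"
    and smult_r_distr: "\<lbrakk>a \<in> carrier R; x \<in> carrier M; y \<in> carrier M\<rbrakk> \<Longrightarrow>
      a \<odot>\<^bsub>M\<^esub> (x \<oplus>\<^bsub>M\<^esub> y) = a \<odot>\<^bsub>M\<^esub> x \<oplus>\<^bsub>M\<^esub> a \<odot>\<^bsub>M\<^esub> y"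
    and smult_assoc1: "\<lbrakk>a \<in> carrier R; b \<in> carrier R; x \<in> carrier M\<rbrakk> \<Longrightarrow>
      (a \<otimes> b) \<odot>\<^bsub>M\<^esub> x = a \<odot>\<^bsub>M\<^esub> (b \<odot>\<^bsub>M\<^esub> x)"
    and smult_one: "x \<in> carrier M \<Longrightarrow> \<one> \<odot>\<^bsub>M\<^esub> x = x"

text \<open>
  The set \<open>\<Q>\<^sup>(\<^sup>c\<^sup>)\<close> with its own addition and the candidate scalar multiplication \<open>\<sigma>\<close>.  The
  fields \<open>mult\<close> and \<open>one\<close> of the record play no role for modules.
\<close>

definition quasi_rational_module ::
  "'a::euclidean_space set \<Rightarrow> 'a
     \<Rightarrow> ((('a \<Rightarrow> 'a) \<Rightarrow>\<^sub>0 ('a, 'f::field) fun_field) \<Rightarrow> ('a, 'f) fun_field \<Rightarrow> ('a, 'f) fun_field)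
     \<Rightarrow> (('a \<Rightarrow> 'a) \<Rightarrow>\<^sub>0 ('a, 'f) fun_field, ('a, 'f) fun_field) module" where
  "quasi_rational_module \<Phi> c \<sigma> =
     \<lparr>carrier = quasi_rational \<Phi> c, mult = undefined, one = undefined,
      zero = 0, add = (+), smult = \<sigma>\<rparr>"

section \<open>The formulas\<close>

text \<open>The element \<open>x\<close> to the power \<open>\<alpha>\<^sub>j\<^sup>\<or>\<close>.\<close>

definition coroot_monomial ::
  "'f::field \<Rightarrow> (nat \<Rightarrow> 'a::euclidean_space) \<Rightarrow> 'a \<Rightarrow> nat \<Rightarrow> ('a, 'f) fun_field" where
  "coroot_monomial q \<alpha> \<phi> j =
     (if j = 0 then scalar (q_root q \<phi>) * monomial (- coroot \<phi>) else monomial (coroot (\<alpha> j)))"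

text \<open>
  The element \<open>x\<close> to the power \<open>y - n \<alpha>\<^sub>j\<^sup>\<or>\<close>, which for \<open>j = 0\<close> is given a meaning by the
  convention for \<open>x\<close> to the power \<open>\<alpha>\<^sub>0\<^sup>\<or>\<close>.
\<close>

definition shifted_monomial ::
  "'f::field \<Rightarrow> (nat \<Rightarrow> 'a::euclidean_space) \<Rightarrow> 'a \<Rightarrow> nat \<Rightarrow> int \<Rightarrow> 'a \<Rightarrow> ('a, 'f) fun_field" where
  "shifted_monomial q \<alpha> \<phi> j n y = monomial y * coroot_monomial q \<alpha> \<phi> j powi (- n)"

text \<open>The element \<open>s\<^sub>j\<^sub>,\<^sub>t x\<^sup>y\<close>.\<close>

definition twisted_reflection ::
  "'f::field \<Rightarrow> 'a::euclidean_space set \<Rightarrow> nat \<Rightarrow> (nat \<Rightarrow> 'a) \<Rightarrow> 'a \<Rightarrow> 'a \<Rightarrow> ('a \<Rightarrow> 'f)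
     \<Rightarrow> nat \<Rightarrow> 'a \<Rightarrow> ('a, 'f) fun_field" where
  "twisted_reflection q \<Phi> r \<alpha> \<phi> c t j y =
     (if j = 0
      then scalar (torus_point q \<Phi> r \<alpha> \<phi> c t y (coroot \<phi>)) * monomial (reflection \<phi> y)
      else monomial (reflection (\<alpha> j) y))"

definition simple_parameter ::
  "('a \<Rightarrow> 'f) \<Rightarrow> (nat \<Rightarrow> 'a::euclidean_space) \<Rightarrow> 'a \<Rightarrow> nat \<Rightarrow> 'f::field" where
  "simple_parameter k \<alpha> \<phi> j = (if j = 0 then k \<phi> else k (\<alpha> j))"

definition sigma_formulas ::
  "'f::field \<Rightarrow> ('a \<Rightarrow> 'f) \<Rightarrow> 'a::euclidean_space set \<Rightarrow> nat \<Rightarrow> (nat \<Rightarrow> 'a) \<Rightarrow> 'a \<Rightarrow> 'a \<Rightarrow> ('a \<Rightarrow> 'f)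
     \<Rightarrow> ((('a \<Rightarrow> 'a) \<Rightarrow>\<^sub>0 ('a, 'f) fun_field) \<Rightarrow> ('a, 'f) fun_field \<Rightarrow> ('a, 'f) fun_field) \<Rightarrow> bool" where
  "sigma_formulas q k \<Phi> r \<alpha> \<phi> c t \<sigma> \<longleftrightarrow>
     (\<forall>j\<in>{0..r}. \<forall>y\<in>weyl_orbit \<Phi> c.
        let kj = simple_parameter k \<alpha> \<phi> j; X = coroot_monomial q \<alpha> \<phi> j in
        \<sigma> (smash_weyl (simple_reflection \<alpha> \<phi> j)) (monomial y) =
          scalar (kj ^ of_bool (affine_root \<alpha> \<phi> j y \<in> \<int>)) * (X - 1)
              / (scalar kj * X - scalar (inverse kj))
            * twisted_reflection q \<Phi> r \<alpha> \<phi> c t j y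
          + scalar (kj - inverse kj) / (scalar kj * X - scalar (inverse kj))
            * shifted_monomial q \<alpha> \<phi> j \<lfloor>gradient \<alpha> \<phi> j \<bullet> y\<rfloor> y) \<and>
     (\<forall>f\<in>rational_functions \<Phi>. \<forall>y\<in>weyl_orbit \<Phi> c.
        \<sigma> (smash_fun f) (monomial y) = f * monomial y)"

end

theory Submission
  imports Defs
begin

text \<open>
  The algebra \<open>W \<ltimes> \<Q>\<close> is generated by \<open>\<Q>\<close> and the simple reflections, with the relations
  \<open>s\<^sub>j f = s\<^sub>j(f) s\<^sub>j\<close>, \<open>s\<^sub>j s\<^sub>j = 1\<close> and the braid relations.  An action given by the formulas is
  therefore unique, and it exists as soon as each formula defines an operator \<open>S j\<close> on \<open>\<Q>\<^sup>(\<^sup>c\<^sup>)\<close>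
  that is semilinear for \<open>s\<^sub>j\<close> and these operators satisfy the other two kinds of relations.

  \<^bold>\<open>Semilinearity.\<close>  The monomials \<open>x\<^sup>y\<close> are not independent over \<open>\<Q>\<close>, as \<open>x\<^sup>\<mu>\<^sup>+\<^sup>y = x\<^sup>\<mu> x\<^sup>y\<close> for \<open>\<mu>\<close>
  in the coroot lattice.  The formulas respect these identities because \<open>t\<^bsub>w y\<^esub> = w t\<^sub>y\<close> for all
  \<open>w \<in> W\<close> (\<open>torus_point_action\<close>).  This is where \<open>t \<in> T\<^sub>J\<close> enters: the stabiliser of \<open>c\<close> is
  generated by the \<open>s\<^sub>j\<close> with \<open>j \<in> J\<close> (\<open>stabiliser_word\<close>), so it fixes \<open>t\<close>.

  \<^bold>\<open>The quadratic relation.\<close>  Another consequence of \<open>t \<in> T\<^sub>J\<close> is that \<open>t\<^sub>y\<close> has value 1 at the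
  coroot of every affine root vanishing at \<open>y\<close> (\<open>torus_point_vanishing\<close>).  Hence the two terms of the
  formula are multiples of the same monomial when \<open>\<alpha>\<^sub>j(y)\<close> is an integer, and their sum is that
  monomial (\<open>simple_image_integral\<close>).  With this, \<open>S j (S j m) = m\<close> is a computation
  (\<open>S_involution\<close>).

  \<^bold>\<open>The braid relations.\<close>  Put \<open>X\<^sub>j = x\<close> to the power \<open>\<alpha>\<^sub>j\<^sup>\<or>\<close>, \<open>h\<^sub>j = k\<^sub>j - 1/k\<^sub>j\<close> and write
  \<open>S\<^sub>j = A\<^sub>j (L\<^sub>j + P\<^sub>j)\<close> with \<open>A\<^sub>j = (X\<^sub>j - 1) / (k\<^sub>j X\<^sub>j - 1/k\<^sub>j)\<close> and \<open>P\<^sub>j = h\<^sub>j / (X\<^sub>j - 1)\<close>.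
  The quadratic relation for \<open>S\<^sub>j\<close> turns into the one of a Hecke algebra, \<open>L\<^sub>j\<^sup>2 = 1 + h\<^sub>j L\<^sub>j\<close>.
  In a product of several \<open>S\<^sub>j\<close>, collecting the scalars from \<open>\<Q>\<close> on the left moves the parameters
  \<open>P\<close> by the Weyl group action, and the products of the resulting factors \<open>L + P\<close> in both orders agree
  by the Yang--Baxter equation for Hecke algebras of rank two.  So on any vector where \<open>L\<^sub>i\<close> and
  \<open>L\<^sub>j\<close> satisfy the braid relation, \<open>S\<^sub>i\<close> and \<open>S\<^sub>j\<close> satisfy it too (\<open>braid_on_vector\<close>).

  On \<open>x\<^sup>y\<close> with \<open>0 \<le> D\<alpha>\<^sub>j(y) \<le> 1\<close> the operator \<open>L\<^sub>j\<close> is the twisted reflection up to a power of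
  \<open>k\<^sub>j\<close> (\<open>hecke_operator_monomial\<close>).  All elements \<open>y\<close> of \<open>W\<^sub>0 c\<close> satisfy \<open>\<bar>\<alpha>(y)\<bar> \<le> 1\<close> for all roots, so if
  \<open>y \<in> W\<^sub>0 c\<close> is dominant for \<open>i\<close> and \<open>j\<close>, both sides of the braid relation for the \<open>L\<close> are the same
  multiple of one monomial (\<open>braid_dominant\<close>).  Finally, the vectors where the
  braid relation for the \<open>S\<close> holds form a \<open>\<Q>\<close>-space stable under \<open>S\<^sub>i\<close> and \<open>S\<^sub>j\<close>; since the monomial
  of a reflected exponent can be read off from the image of a monomial, this space contains \<open>x\<^sup>y\<close>
  for all \<open>y \<in> W\<^sub>0 c\<close> (\<open>braid_finite_orbit\<close>), and these span \<open>\<Q>\<^sup>(\<^sup>c\<^sup>)\<close>.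

  \<^bold>\<open>From relations to an action.\<close>  That the affine Weyl group is presented by these relations is
  Matsumoto's theorem (\<open>reduced_words_same_operator\<close>).  It rests on the exchange condition, which is read
  off from the signs of affine roots at a base point where all simple affine roots take the same
  positive value.
\<close>

section \<open>Evaluation of group algebra elements\<close>

lemma coeff_map_simps [simp]:
  "coeff_map (of_coeff_map p) = p" "of_coeff_map (coeff_map a) = a"
  by (simp_all add: of_coeff_map_inverse coeff_map_inverse)

lemma coeff_map_hom [simp]:
  "coeff_map 0 = 0" "coeff_map 1 = 1" "coeff_map (a + b) = coeff_map a + coeff_map b"
  "coeff_map (- a) = - coeff_map a"
  "coeff_map (a * b) = coeff_map a * coeff_map b"
  by (transfer; simp)+

lemma coeff_map_eq_iff: "a = b \<longleftrightarrow> coeff_map a = coeff_map b"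
  by (simp add: coeff_map_inject)

lemma coeff_map_eq_0_iff [simp]: "coeff_map a = 0 \<longleftrightarrow> a = 0"
  by (simp add: coeff_map_eq_iff)

lemma coeff_map_sum: "coeff_map (sum f A) = (\<Sum>x\<in>A. coeff_map (f x))"
  by (induction A rule: infinite_finite_induct) auto

lemma keys_zero_iff: "Poly_Mapping.keys (coeff_map a) = {} \<longleftrightarrow> a = 0"
  by simp

definition group_monom :: "'a::euclidean_space \<Rightarrow> 'f::field \<Rightarrow> ('a, 'f) group_algebra" where
  "group_monom x z = of_coeff_map (Poly_Mapping.single x z)"

lemma group_monom_mult: "group_monom x z * group_monom y w = group_monom (x + y) (z * w)"
  by (simp add: group_monom_def coeff_map_eq_iff mult_single)

lemma group_monom_add: "group_monom x (z + w) = group_monom x z + group_monom x w"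
  by (simp add: group_monom_def coeff_map_eq_iff single_add)

lemma group_monom_0 [simp]: "group_monom x 0 = 0"
  by (simp add: group_monom_def coeff_map_eq_iff)

lemma group_monom_one: "group_monom 0 1 = 1"
  by (simp add: group_monom_def coeff_map_eq_iff)

lemma group_algebra_decompose:
  "a = (\<Sum>x\<in>Poly_Mapping.keys (coeff_map a). group_monom x (Poly_Mapping.lookup (coeff_map a) x))"
proof -
  have "coeff_map a = (\<Sum>x\<in>Poly_Mapping.keys (coeff_map a). Poly_Mapping.single x (Poly_Mapping.lookup (coeff_map a) x))"
    by (rule poly_mapping_eqI) (auto simp: lookup_sum lookup_single when_def in_keys_iff)
  then show ?thesis
    by (simp add: coeff_map_eq_iff coeff_map_sum group_monom_def)
qed

lemma scalar_def': "scalar z = Fract (group_monom 0 z) 1"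
  by (simp add: scalar_def group_monom_def)

lemma monomial_def': "monomial x = Fract (group_monom x 1) 1"
  by (simp add: monomial_def group_monom_def)

lemma scalar_mult: "scalar (z * w) = scalar z * scalar w"
  by (simp add: scalar_def' group_monom_mult)

lemma scalar_add: "scalar (z + w) = scalar z + scalar w"
  by (simp add: scalar_def' group_monom_add)

lemma scalar_0 [simp]: "scalar 0 = 0"
  by (simp add: scalar_def' fract_collapse)

lemma scalar_1 [simp]: "scalar 1 = 1"
  by (simp add: scalar_def' group_monom_one fract_collapse)

lemma scalar_minus: "scalar (- z) = - scalar z"
proof -
  have "scalar (- z) + scalar z = scalar (- z + z)" by (simp only: scalar_add)
  then show ?thesis by (simp add: eq_neg_iff_add_eq_0)
qed

lemma scalar_diff: "scalar (z - w) = scalar z - scalar w"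
  using scalar_add[of z "- w"] by (simp add: scalar_minus)

lemma scalar_power: "scalar (z ^ n) = scalar z ^ n"
  by (induction n) (simp_all add: scalar_mult)

lemma scalar_inverse: "scalar (inverse z) = inverse (scalar z)"
proof (cases "z = 0")
  case False
  then have "scalar z * scalar (inverse z) = 1" by (simp flip: scalar_mult)
  then show ?thesis by (metis inverse_unique)
qed simp

lemma scalar_eq_0_iff [simp]: "scalar z = 0 \<longleftrightarrow> z = 0"
  by (metis scalar_0 scalar_1 scalar_inverse scalar_mult right_inverse mult_zero_left zero_neq_one)

lemma scalar_powi: "scalar (z powi n) = scalar z powi n"
  by (cases n rule: int_cases)
     (simp_all add: power_int_def scalar_power scalar_inverse)

lemma monomial_add: "monomial (x + y) = monomial x * monomial y"
  by (simp add: monomial_def' group_monom_mult)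

lemma monomial_0 [simp]: "monomial 0 = 1"
  by (simp add: monomial_def' group_monom_one fract_collapse)

lemma monomial_nonzero [simp]: "monomial x \<noteq> 0"
  by (metis monomial_add monomial_0 add.right_inverse mult_zero_left zero_neq_one)

lemma monomial_minus: "monomial (- x) = inverse (monomial x)"
  by (metis monomial_add monomial_0 add.right_inverse inverse_unique)

lemma monomial_powi:
  "monomial (of_int n *\<^sub>R x) = monomial x powi n"
proof -
  have nat: "monomial (of_nat k *\<^sub>R x) = monomial x ^ k" for k
    by (induction k) (simp_all add: scaleR_add_left monomial_add)
  show ?thesis
  proof (cases n rule: int_cases2)
    case (nonneg k)
    then show ?thesis using nat[of k] by simp
  next
    case (nonpos k)
    then show ?thesis using nat[of k] by (simp add: monomial_minus power_int_minus)
  qed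
qed

lemma Fract_group_monom: "Fract (group_monom x z) 1 = scalar z * monomial x"
  by (simp add: scalar_def' monomial_def' group_monom_mult)

lemma Fract_sum: "Fract (sum f A) 1 = (\<Sum>x\<in>A. Fract (f x) 1)"
proof (induction A rule: infinite_finite_induct)
  case (insert x F)
  have "Fract (f x + sum f F) 1 = Fract (f x) 1 + Fract (sum f F) 1" by simp
  then show ?case using insert by simp
qed (simp_all add: fract_collapse)

text \<open>The linear map with \<open>x\<^sup>\<mu> \<mapsto> g \<mu>\<close>.\<close>

definition evaluate ::
  "('a \<Rightarrow> ('a, 'f) fun_field) \<Rightarrow> ('a::euclidean_space, 'f::field) group_algebra \<Rightarrow> ('a, 'f) fun_field" where
  "evaluate g a = (\<Sum>x\<in>Poly_Mapping.keys (coeff_map a). scalar (Poly_Mapping.lookup (coeff_map a) x) * g x)"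

lemma evaluate_superset:
  assumes "finite S" "Poly_Mapping.keys (coeff_map a) \<subseteq> S"
  shows "evaluate g a = (\<Sum>x\<in>S. scalar (Poly_Mapping.lookup (coeff_map a) x) * g x)"
  unfolding evaluate_def using assms
  by (intro sum.mono_neutral_left) (auto simp: in_keys_iff)

lemma evaluate_0 [simp]: "evaluate g 0 = 0"
  by (simp add: evaluate_def)

lemma evaluate_add: "evaluate g (a + b) = evaluate g a + evaluate g b"
proof -
  let ?S = "Poly_Mapping.keys (coeff_map a) \<union> Poly_Mapping.keys (coeff_map b)"
  have k: "Poly_Mapping.keys (coeff_map (a + b)) \<subseteq> ?S"
    using keys_add[of "coeff_map a" "coeff_map b"] by simp
  show ?thesis
    by (simp add: evaluate_superset[of ?S] k lookup_add scalar_add distrib_right sum.distrib del: coeff_map_hom)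
       (simp add: lookup_add scalar_add distrib_right sum.distrib)
qed

lemma evaluate_sum: "evaluate g (sum f A) = (\<Sum>x\<in>A. evaluate g (f x))"
  by (induction A rule: infinite_finite_induct) (auto simp: evaluate_add)

lemma evaluate_group_monom [simp]: "evaluate g (group_monom x z) = scalar z * g x"
  by (cases "z = 0") (simp_all add: evaluate_def group_monom_def)

lemma evaluate_one: "evaluate g 1 = g 0"
  by (simp flip: group_monom_one)

lemma evaluate_monomial: "evaluate monomial a = Fract a 1"
proof -
  have "Fract a 1 = Fract (\<Sum>x\<in>Poly_Mapping.keys (coeff_map a). group_monom x (Poly_Mapping.lookup (coeff_map a) x)) 1"
    by (simp flip: group_algebra_decompose)
  then show ?thesis by (simp add: evaluate_def Fract_sum Fract_group_monom)
qed

lemma evaluate_mult: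
  assumes "Poly_Mapping.keys (coeff_map a) \<subseteq> A" "Poly_Mapping.keys (coeff_map b) \<subseteq> B"
    and "\<And>x y. x \<in> A \<Longrightarrow> y \<in> B \<Longrightarrow> g (x + y) = h x * g' y"
  shows "evaluate g (a * b) = evaluate h a * evaluate g' b"
proof -
  let ?a = "\<lambda>x. Poly_Mapping.lookup (coeff_map a) x" and ?b = "\<lambda>x. Poly_Mapping.lookup (coeff_map b) x"
  have "a * b = (\<Sum>x\<in>Poly_Mapping.keys (coeff_map a). group_monom x (?a x)) *
      (\<Sum>y\<in>Poly_Mapping.keys (coeff_map b). group_monom y (?b y))"
    by (simp flip: group_algebra_decompose)
  also have "\<dots> = (\<Sum>x\<in>Poly_Mapping.keys (coeff_map a). \<Sum>y\<in>Poly_Mapping.keys (coeff_map b). group_monom (x + y) (?a x * ?b y))"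
    by (simp add: sum_product group_monom_mult)
  finally have "evaluate g (a * b) = (\<Sum>x\<in>Poly_Mapping.keys (coeff_map a). \<Sum>y\<in>Poly_Mapping.keys (coeff_map b). scalar (?a x * ?b y) * g (x + y))"
    by (simp add: evaluate_sum)
  also have "\<dots> = (\<Sum>x\<in>Poly_Mapping.keys (coeff_map a). \<Sum>y\<in>Poly_Mapping.keys (coeff_map b). (scalar (?a x) * h x) * (scalar (?b y) * g' y))"
    using assms by (intro sum.cong refl) (auto simp: scalar_mult subset_iff)
  also have "\<dots> = evaluate h a * evaluate g' b"
    by (simp add: evaluate_def sum_product)
  finally show ?thesis .
qed

definition supported :: "'a::euclidean_space set \<Rightarrow> ('a, 'f::field) group_algebra set" where
  "supported B = {p. Poly_Mapping.keys (coeff_map p) \<subseteq> B}"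

lemma supported_0 [simp]: "0 \<in> supported B"
  by (simp add: supported_def)

lemma supported_1 [simp]: "0 \<in> B \<Longrightarrow> 1 \<in> supported B"
  by (simp add: supported_def)

lemma supported_add: "a \<in> supported B \<Longrightarrow> b \<in> supported B \<Longrightarrow> a + b \<in> supported B"
  unfolding supported_def using keys_add[of "coeff_map a" "coeff_map b"] by auto

lemma supported_minus: "a \<in> supported B \<Longrightarrow> - a \<in> supported B"
  by (simp add: supported_def in_keys_iff subset_iff)

lemma supported_mult:
  assumes "a \<in> supported A" "b \<in> supported B" "\<And>x y. x \<in> A \<Longrightarrow> y \<in> B \<Longrightarrow> x + y \<in> C"
  shows "a * b \<in> supported C"
  using assms keys_mult[of "coeff_map a" "coeff_map b"] by (fastforce simp: supported_def)

lemma supported_group_monom: "x \<in> B \<Longrightarrow> group_monom x z \<in> supported B"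
  by (cases "z = 0") (auto simp: supported_def group_monom_def)

text \<open>If \<open>B\<close> is stable under addition of elements of the lattice \<open>L\<close>, this is the span of the monomials
  with exponent in \<open>B\<close> over the quotient field of the group algebra of \<open>L\<close>, and for \<open>B = L\<close>
  that quotient field itself.\<close>

definition fractions_over ::
  "'a::euclidean_space set \<Rightarrow> 'a set \<Rightarrow> ('a, 'f::field) fun_field set" where
  "fractions_over L B = {Fract p b | p b. p \<in> supported B \<and> b \<in> supported L \<and> b \<noteq> 0}"

text \<open>
  The value at \<open>p/b\<close> is \<open>evaluate g p / evaluate th b\<close>: this is how a map \<open>g\<close> given on monomials
  extends to fractions, semilinearly for the ring homomorphism \<open>x\<^sup>\<mu> \<mapsto> th \<mu>\<close>.
\<close>

definition semilinear_extension ::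
  "'a::euclidean_space set \<Rightarrow> ('a \<Rightarrow> ('a, 'f::field) fun_field) \<Rightarrow> 'a set \<Rightarrow> ('a \<Rightarrow> ('a, 'f) fun_field)
     \<Rightarrow> ('a, 'f) fun_field \<Rightarrow> ('a, 'f) fun_field" where
  "semilinear_extension L th B g m = (THE h. \<exists>p\<in>supported B. \<exists>b\<in>supported L.
     b \<noteq> 0 \<and> m = Fract p b \<and> h = evaluate g p / evaluate th b)"

locale exponent_lattice =
  fixes L :: "'a::euclidean_space set"
  assumes zero_L: "0 \<in> L"
    and add_L: "x \<in> L \<Longrightarrow> y \<in> L \<Longrightarrow> x + y \<in> L"
begin

lemma supported_mult_L: "a \<in> supported L \<Longrightarrow> b \<in> supported L \<Longrightarrow> a * b \<in> supported L"
  using supported_mult add_L by blast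

lemma Fract_in_fractions: "p \<in> supported B \<Longrightarrow> b \<in> supported L \<Longrightarrow> b \<noteq> 0 \<Longrightarrow> Fract p b \<in> fractions_over L B"
  by (auto simp: fractions_over_def)

context
  fixes B :: "'a set"
  assumes B: "\<And>x y. x \<in> L \<Longrightarrow> y \<in> B \<Longrightarrow> x + y \<in> B"
begin

lemma supported_mult_B: "a \<in> supported L \<Longrightarrow> p \<in> supported B \<Longrightarrow> a * p \<in> supported B"
  using supported_mult B by blast

lemma fractions_mult:
  assumes "f \<in> fractions_over L L" "m \<in> fractions_over L B"
  shows "f * m \<in> fractions_over L B"
proof -
  obtain a b p d where "f = Fract a b" "m = Fract p d" "a \<in> supported L" "b \<in> supported L" "b \<noteq> 0"
    "p \<in> supported B" "d \<in> supported L" "d \<noteq> 0"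
    using assms by (auto simp: fractions_over_def)
  then show ?thesis
    by (auto simp: intro!: Fract_in_fractions supported_mult_L supported_mult_B)
qed

lemma fractions_add:
  assumes "n \<in> fractions_over L B" "m \<in> fractions_over L B"
  shows "n + m \<in> fractions_over L B"
proof -
  obtain a b p d where "n = Fract a b" "m = Fract p d" "a \<in> supported B" "b \<in> supported L" "b \<noteq> 0"
    "p \<in> supported B" "d \<in> supported L" "d \<noteq> 0"
    using assms by (auto simp: fractions_over_def)
  then show ?thesis
    using supported_mult_B[of b p] supported_mult_B[of d a]
    by (auto simp: add_fract mult.commute intro!: Fract_in_fractions supported_mult_L supported_add)
qed

lemma fractions_zero: "0 \<in> fractions_over L B"
  using Fract_in_fractions[of 0 B 1] by (simp add: zero_L fract_collapse)

lemma fractions_minus: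
  assumes "m \<in> fractions_over L B"
  shows "- m \<in> fractions_over L B"
  using assms by (auto simp: fractions_over_def supported_minus) (metis minus_fract supported_minus)

lemma fractions_sum:
  "(\<And>i. i \<in> I \<Longrightarrow> f i \<in> fractions_over L B) \<Longrightarrow> sum f I \<in> fractions_over L B"
  by (induction I rule: infinite_finite_induct) (auto intro: fractions_add fractions_zero)

lemma fractions_monomial: "y \<in> B \<Longrightarrow> monomial y \<in> fractions_over L B"
  by (simp add: monomial_def' Fract_in_fractions supported_group_monom zero_L)

end

lemma fractions_scalar: "scalar z \<in> fractions_over L L"
  by (simp add: scalar_def' Fract_in_fractions supported_group_monom zero_L)

lemma fractions_inverse: "f \<in> fractions_over L L \<Longrightarrow> inverse f \<in> fractions_over L L"
proof -
  assume "f \<in> fractions_over L L"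
  then obtain a b where ab: "f = Fract a b" "a \<in> supported L" "b \<in> supported L" "b \<noteq> 0"
    by (auto simp: fractions_over_def)
  show ?thesis
  proof (cases "a = 0")
    case True
    then show ?thesis using ab fractions_zero[OF add_L] by (simp add: fract_collapse)
  next
    case False
    then show ?thesis using ab by (simp add: Fract_in_fractions)
  qed
qed

end

text \<open>
  A ring homomorphism \<open>th\<close> of the group algebra of \<open>L\<close>, injective so that it extends to
  quotients, and a map \<open>g\<close> on the monomials with exponent in \<open>B\<close> that is compatible with it.
\<close>

locale semilinear_data = exponent_lattice L
  for L :: "'a::euclidean_space set" +
  fixes th :: "'a \<Rightarrow> ('a, 'f::field) fun_field" and B :: "'a set" and g :: "'a \<Rightarrow> ('a, 'f) fun_field"
  assumes th_mult: "x \<in> L \<Longrightarrow> y \<in> L \<Longrightarrow> th (x + y) = th x * th y"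
    and th_0: "th 0 = 1"
    and th_inj: "\<And>b. b \<in> supported L \<Longrightarrow> b \<noteq> 0 \<Longrightarrow> evaluate th b \<noteq> 0"
    and B_add: "x \<in> L \<Longrightarrow> y \<in> B \<Longrightarrow> x + y \<in> B"
    and g_mult: "x \<in> L \<Longrightarrow> y \<in> B \<Longrightarrow> g (x + y) = th x * g y"
begin

abbreviation "act \<equiv> semilinear_extension L th L th"
abbreviation "ext \<equiv> semilinear_extension L th B g"

lemma evaluate_th_mult: "a \<in> supported L \<Longrightarrow> b \<in> supported L \<Longrightarrow> evaluate th (a * b) = evaluate th a * evaluate th b"
  by (intro evaluate_mult[where A = L and B = L]) (auto simp: supported_def th_mult)

lemma evaluate_g_mult: "a \<in> supported L \<Longrightarrow> b \<in> supported B \<Longrightarrow> evaluate g (a * b) = evaluate th a * evaluate g b"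
  by (intro evaluate_mult[where A = L and B = B]) (auto simp: supported_def g_mult)

text \<open>The value does not depend on the representation as a fraction, by cross multiplication.\<close>

lemma ext_Fract:
  assumes "p \<in> supported B" "b \<in> supported L" "b \<noteq> 0"
  shows "ext (Fract p b) = evaluate g p / evaluate th b"
  unfolding semilinear_extension_def
proof (rule the_equality)
  show "\<exists>p'\<in>supported B. \<exists>b'\<in>supported L. b' \<noteq> 0 \<and> Fract p b = Fract p' b' \<and>
      evaluate g p / evaluate th b = evaluate g p' / evaluate th b'"
    using assms by blast
next
  fix h assume "\<exists>p'\<in>supported B. \<exists>b'\<in>supported L. b' \<noteq> 0 \<and> Fract p b = Fract p' b' \<and>
      h = evaluate g p' / evaluate th b'"
  then obtain p' b' where 1: "p' \<in> supported B" "b' \<in> supported L" "b' \<noteq> 0" "Fract p b = Fract p' b'"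
      "h = evaluate g p' / evaluate th b'" by blast
  then have "b' * p = b * p'" using assms by (simp add: eq_fract mult.commute)
  then have "evaluate th b' * evaluate g p = evaluate th b * evaluate g p'"
    using 1 assms by (metis evaluate_g_mult)
  then show "h = evaluate g p / evaluate th b"
    using th_inj[OF 1(2,3)] th_inj[OF assms(2,3)] unfolding 1(5)
    by (simp add: divide_eq_eq eq_divide_eq mult.commute)
qed

lemma ext_add:
  assumes "n \<in> fractions_over L B" "m \<in> fractions_over L B"
  shows "ext (n + m) = ext n + ext m"
proof -
  obtain a b p d where *: "n = Fract a b" "m = Fract p d" "a \<in> supported B" "b \<in> supported L" "b \<noteq> 0"
    "p \<in> supported B" "d \<in> supported L" "d \<noteq> 0"
    using assms by (auto simp: fractions_over_def)
  then have "n + m = Fract (d * a + b * p) (b * d)" by (simp add: mult.commute)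
  moreover have "d * a \<in> supported B" "b * p \<in> supported B" "b * d \<in> supported L"
    using * supported_mult_B[OF B_add] supported_mult_L by auto
  ultimately have "ext (n + m) = evaluate g (d * a + b * p) / evaluate th (b * d)"
    using * by (simp add: ext_Fract supported_add)
  then show ?thesis
    using * th_inj[of b] th_inj[of d]
    by (simp add: ext_Fract evaluate_add evaluate_g_mult evaluate_th_mult add_divide_distrib)
qed

end

sublocale semilinear_data \<subseteq> field_action: semilinear_data L th L th
  by unfold_locales (auto simp: th_mult th_0 th_inj add_L)

context semilinear_data
begin

lemma ext_mult:
  assumes "f \<in> fractions_over L L" "m \<in> fractions_over L B"
  shows "ext (f * m) = act f * ext m"
proof -
  obtain a b p d where *: "f = Fract a b" "m = Fract p d" "a \<in> supported L" "b \<in> supported L" "b \<noteq> 0"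
    "p \<in> supported B" "d \<in> supported L" "d \<noteq> 0"
    using assms by (auto simp: fractions_over_def)
  moreover have "a * p \<in> supported B" "b * d \<in> supported L"
    using * supported_mult_B[OF B_add] supported_mult_L by auto
  ultimately show ?thesis
    using th_inj[of b] th_inj[of d]
    by (simp add: ext_Fract field_action.ext_Fract evaluate_g_mult evaluate_th_mult)
qed

lemma ext_monomial: "y \<in> B \<Longrightarrow> ext (monomial y) = g y"
  by (simp add: monomial_def' ext_Fract supported_group_monom zero_L evaluate_one th_0)

lemma act_scalar: "act (scalar z) = scalar z"
  using field_action.ext_Fract[of "group_monom 0 z" 1]
  by (simp add: scalar_def'[symmetric] supported_group_monom zero_L evaluate_one th_0)

lemma ext_zero: "ext 0 = 0"
  using ext_Fract[of 0 1] by (simp add: zero_L fract_collapse)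

lemma ext_in:
  assumes "\<And>y. y \<in> B \<Longrightarrow> g y \<in> fractions_over L C" "\<And>x y. x \<in> L \<Longrightarrow> y \<in> C \<Longrightarrow> x + y \<in> C"
    and th: "\<And>x. x \<in> L \<Longrightarrow> th x \<in> fractions_over L L"
    and "m \<in> fractions_over L B"
  shows "ext m \<in> fractions_over L C"
proof -
  obtain p d where *: "m = Fract p d" "p \<in> supported B" "d \<in> supported L" "d \<noteq> 0"
    using assms by (auto simp: fractions_over_def)
  have "evaluate g p \<in> fractions_over L C"
    unfolding evaluate_def using * assms
    by (intro fractions_sum fractions_mult fractions_scalar) (auto simp: supported_def)
  moreover have "evaluate th d \<in> fractions_over L L"
    unfolding evaluate_def using * th add_L
    by (intro fractions_sum fractions_mult fractions_scalar) (auto simp: supported_def)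
  ultimately have "inverse (evaluate th d) * evaluate g p \<in> fractions_over L C"
    using assms(2) by (intro fractions_mult fractions_inverse)
  then show ?thesis using * by (simp add: ext_Fract divide_inverse mult.commute)
qed

end

text \<open>Expanding the numerator of a fraction shows that the fractions are indeed the span of the
  monomials, on whose multiples properties closed under addition can be tested.\<close>

lemma (in exponent_lattice) fractions_as_sum:
  assumes m: "m \<in> fractions_over L B"
  shows "\<exists>S f. m = (\<Sum>y\<in>S. f y * monomial y) \<and> finite S \<and> S \<subseteq> B \<and> (\<forall>y\<in>S. f y \<in> fractions_over L L)"
proof -
  obtain p d where *: "m = Fract p d" "p \<in> supported B" "d \<in> supported L" "d \<noteq> 0"
    using m by (auto simp: fractions_over_def)
  have "Fract p d = inverse (Fract d 1) * evaluate monomial p"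
    using * by (simp add: evaluate_monomial)
  also have "\<dots> = (\<Sum>x\<in>Poly_Mapping.keys (coeff_map p). (inverse (Fract d 1) * scalar (Poly_Mapping.lookup (coeff_map p) x)) * monomial x)"
    by (simp add: evaluate_def sum_distrib_left mult.assoc)
  finally have "m = (\<Sum>x\<in>Poly_Mapping.keys (coeff_map p). (inverse (Fract d 1) * scalar (Poly_Mapping.lookup (coeff_map p) x)) * monomial x)"
    using * by simp
  moreover have "inverse (Fract d 1) * scalar (Poly_Mapping.lookup (coeff_map p) x) \<in> fractions_over L L" for x
    using * by (intro fractions_mult add_L fractions_inverse fractions_scalar Fract_in_fractions) (auto simp: zero_L)
  moreover have "Poly_Mapping.keys (coeff_map p) \<subseteq> B" using * by (simp add: supported_def)
  ultimately show ?thesis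
    by (intro exI[of _ "Poly_Mapping.keys (coeff_map p)"]
        exI[of _ "\<lambda>x. inverse (Fract d 1) * scalar (Poly_Mapping.lookup (coeff_map p) x)"]) auto
qed

lemma (in exponent_lattice) fractions_induct [consumes 1, case_names zero add mult]:
  assumes m: "m \<in> fractions_over L B"
    and "P 0" "\<And>x y. P x \<Longrightarrow> P y \<Longrightarrow> P (x + y)"
    and mult: "\<And>f y. f \<in> fractions_over L L \<Longrightarrow> y \<in> B \<Longrightarrow> P (f * monomial y)"
  shows "P m"
proof -
  obtain S f where *: "m = (\<Sum>y\<in>S. f y * monomial y)" "finite S" "S \<subseteq> B" "\<forall>y\<in>S. f y \<in> fractions_over L L"
    using fractions_as_sum[OF m] by blast
  have "P (\<Sum>y\<in>S. f y * monomial y)" using *(2-4)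
    by (induction S rule: finite_induct) (auto intro: assms)
  then show ?thesis using * by simp
qed

section \<open>Reflections and the coroot lattice\<close>

lemma reflection_eq: "reflection a y = y - (2 * (a \<bullet> y) / (a \<bullet> a)) *\<^sub>R a"
  by (simp add: reflection_def coroot_def power2_norm_eq_inner)

lemma linear_reflection: "linear (reflection a)"
  unfolding reflection_def
  by (intro linearI) (simp_all add: inner_add_right scaleR_add_left algebra_simps)

lemma reflection_add: "reflection a (x + y) = reflection a x + reflection a y"
  and reflection_minus: "reflection a (- x) = - reflection a x"
  and reflection_scaleR: "reflection a (c *\<^sub>R x) = c *\<^sub>R reflection a x"
  and reflection_0 [simp]: "reflection a 0 = 0"
  using linear_reflection[of a] by (simp_all add: linear_add linear_neg linear_cmul linear_0)

lemma inner_coroot_self: "a \<noteq> 0 \<Longrightarrow> a \<bullet> coroot a = 2"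
  by (simp add: coroot_def power2_norm_eq_inner)

lemma coroot_minus: "coroot (- a) = - coroot a"
  by (simp add: coroot_def)

lemma reflection_neg_root: "reflection (- a) = reflection a"
  by (auto simp: reflection_def coroot_minus)

lemma reflection_involution [simp]: "reflection a (reflection a y) = y"
  by (cases "a = 0") (simp_all add: reflection_def inner_diff_right inner_coroot_self coroot_def power2_norm_eq_inner algebra_simps)

lemma reflection_inner: "reflection a x \<bullet> reflection a y = x \<bullet> y"
proof (cases "a = 0")
  case False
  let ?x = "2 * (a \<bullet> x) / (a \<bullet> a)" and ?y = "2 * (a \<bullet> y) / (a \<bullet> a)"
  have "reflection a x \<bullet> reflection a y = x \<bullet> y - ?x * (a \<bullet> y) - ?y * (x \<bullet> a - ?x * (a \<bullet> a))"
    unfolding reflection_eq by (simp only: inner_diff_left inner_diff_right inner_scaleR_left inner_scaleR_right)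
  also have "?x * (a \<bullet> a) = 2 * (x \<bullet> a)" using False by (simp add: inner_commute)
  also have "?x * (a \<bullet> y) = ?y * (x \<bullet> a)" by (simp add: inner_commute)
  finally show ?thesis by (simp add: algebra_simps)
qed (simp add: reflection_eq)

lemma reflection_inner_left: "reflection a x \<bullet> y = x \<bullet> reflection a y"
  using reflection_inner[of a x "reflection a y"] by simp

lemma norm_reflection [simp]: "norm (reflection a x) = norm x"
  by (simp add: norm_eq_sqrt_inner reflection_inner)

lemma reflection_coroot: "reflection a (coroot b) = coroot (reflection a b)"
  by (simp add: coroot_def reflection_scaleR)

lemma reflection_self: "reflection a a = - a"
  by (cases "a = 0") (simp_all add: reflection_eq scaleR_2)

lemma inner_coroot_commute: "a \<bullet> coroot b * (norm b)\<^sup>2 = b \<bullet> coroot a * (norm a)\<^sup>2"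
  by (cases "a = 0 \<or> b = 0") (auto simp: coroot_def inner_commute)

context reduced_irreducible_root_system
begin

lemma root_nonzero [simp]: "a \<in> \<Phi> \<Longrightarrow> a \<noteq> 0"
  using zero_not_root by auto

lemma root_minus: "a \<in> \<Phi> \<Longrightarrow> - a \<in> \<Phi>"
  using reflection_closed[of a a] by (simp add: reflection_self)

abbreviation (input) "L \<equiv> coroot_lattice \<Phi>"

lemma lattice_0 [simp]: "0 \<in> L"
  unfolding coroot_lattice_def by (auto intro!: exI[of _ "\<lambda>_. 0"])

lemma lattice_add: "\<mu> \<in> L \<Longrightarrow> \<nu> \<in> L \<Longrightarrow> \<mu> + \<nu> \<in> L"
proof -
  assume "\<mu> \<in> L" "\<nu> \<in> L"
  then obtain m n where "\<mu> = (\<Sum>a\<in>\<Phi>. of_int (m a) *\<^sub>R coroot a)" "\<nu> = (\<Sum>a\<in>\<Phi>. of_int (n a) *\<^sub>R coroot a)"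
    by (auto simp: coroot_lattice_def)
  then have "\<mu> + \<nu> = (\<Sum>a\<in>\<Phi>. of_int (m a + n a) *\<^sub>R coroot a)"
    by (simp add: sum.distrib scaleR_add_left)
  then show ?thesis by (auto simp: coroot_lattice_def intro!: exI[of _ "\<lambda>a. m a + n a"])
qed

lemma lattice_minus: "\<mu> \<in> L \<Longrightarrow> - \<mu> \<in> L"
proof -
  assume "\<mu> \<in> L"
  then obtain m where "\<mu> = (\<Sum>a\<in>\<Phi>. of_int (m a) *\<^sub>R coroot a)"
    by (auto simp: coroot_lattice_def)
  then have "- \<mu> = (\<Sum>a\<in>\<Phi>. of_int (- m a) *\<^sub>R coroot a)"
    by (simp add: sum_negf)
  then show ?thesis by (auto simp: coroot_lattice_def intro!: exI[of _ "\<lambda>a. - m a"])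
qed

lemma lattice_diff: "\<mu> \<in> L \<Longrightarrow> \<nu> \<in> L \<Longrightarrow> \<mu> - \<nu> \<in> L"
  using lattice_add[of \<mu> "- \<nu>"] lattice_minus by simp

lemma lattice_coroot: "a \<in> \<Phi> \<Longrightarrow> coroot a \<in> L"
proof -
  assume "a \<in> \<Phi>"
  then have "coroot a = (\<Sum>b\<in>\<Phi>. of_int (if b = a then 1 else 0) *\<^sub>R coroot b)"
  proof -
    have "(\<Sum>b\<in>\<Phi>. of_int (if b = a then 1 else 0) *\<^sub>R coroot b) = (\<Sum>b\<in>\<Phi>. if b = a then coroot b else 0)"
      by (intro sum.cong) auto
    then show ?thesis using finite_roots \<open>a \<in> \<Phi>\<close> by simp
  qed
  then show ?thesis by (auto simp: coroot_lattice_def intro!: exI[of _ "\<lambda>b. if b = a then 1 else 0"])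
qed

lemma lattice_int_scale: "\<mu> \<in> L \<Longrightarrow> of_int n *\<^sub>R \<mu> \<in> L"
proof -
  assume "\<mu> \<in> L"
  then obtain m where "\<mu> = (\<Sum>a\<in>\<Phi>. of_int (m a) *\<^sub>R coroot a)"
    by (auto simp: coroot_lattice_def)
  then have "of_int n *\<^sub>R \<mu> = (\<Sum>a\<in>\<Phi>. of_int (n * m a) *\<^sub>R coroot a)"
    by (simp add: scaleR_sum_right)
  then show ?thesis by (auto simp: coroot_lattice_def intro!: exI[of _ "\<lambda>a. n * m a"])
qed

lemma lattice_induct [consumes 1, case_names zero coroot add minus]:
  assumes "\<mu> \<in> L" "P 0" "\<And>a. a \<in> \<Phi> \<Longrightarrow> P (coroot a)"
    "\<And>x y. x \<in> L \<Longrightarrow> y \<in> L \<Longrightarrow> P x \<Longrightarrow> P y \<Longrightarrow> P (x + y)" "\<And>x. x \<in> L \<Longrightarrow> P x \<Longrightarrow> P (- x)"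
  shows "P \<mu>"
proof -
  have nat: "P (of_nat k *\<^sub>R coroot a) \<and> of_nat k *\<^sub>R coroot a \<in> L" if "a \<in> \<Phi>" for k a
    using that by (induction k) (auto simp: scaleR_add_left assms lattice_coroot lattice_add)
  have int: "P (of_int k *\<^sub>R coroot a) \<and> of_int k *\<^sub>R coroot a \<in> L" if "a \<in> \<Phi>" for k a
  proof (cases k rule: int_cases2)
    case (nonneg n)
    then show ?thesis using nat[OF that, of n] by simp
  next
    case (nonpos n)
    then show ?thesis using nat[OF that, of n] assms(5)[of "of_nat n *\<^sub>R coroot a"] lattice_minus by simp
  qed
  have "P (\<Sum>a\<in>A. of_int (m a) *\<^sub>R coroot a) \<and> (\<Sum>a\<in>A. of_int (m a) *\<^sub>R coroot a) \<in> L" if "A \<subseteq> \<Phi>" for A m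
    using finite_subset[OF that finite_roots] that
    by (induction A rule: finite_induct) (auto simp: assms int lattice_add)
  then show ?thesis using assms(1) by (auto simp: coroot_lattice_def)
qed

lemma root_lattice_integral: "a \<in> \<Phi> \<Longrightarrow> \<mu> \<in> L \<Longrightarrow> a \<bullet> \<mu> \<in> \<int>"
  by (auto simp: coroot_lattice_def inner_sum_right integral intro!: Ints_sum Ints_mult)

lemma lattice_reflection: "a \<in> \<Phi> \<Longrightarrow> \<mu> \<in> L \<Longrightarrow> reflection a \<mu> \<in> L"
proof -
  assume a: "a \<in> \<Phi>" and "\<mu> \<in> L"
  then obtain n where "a \<bullet> \<mu> = of_int n" using root_lattice_integral by (metis Ints_cases)
  then show ?thesis
    using \<open>\<mu> \<in> L\<close> by (simp add: reflection_def lattice_diff lattice_int_scale lattice_coroot a)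
qed

section \<open>The finite and the affine Weyl group\<close>

lemma finite_weyl_reflection: "a \<in> \<Phi> \<Longrightarrow> reflection a \<in> finite_weyl \<Phi>"
  using finite_weyl.intros(2)[OF _ finite_weyl.intros(1)] by simp

lemma finite_weyl_linear: "v \<in> finite_weyl \<Phi> \<Longrightarrow> linear v"
proof (induction rule: finite_weyl.induct)
  case (2 a v)
  then show ?case by (intro linear_compose linear_reflection)
qed (simp add: linear_id[unfolded id_def] id_def)

lemma finite_weyl_inner: "v \<in> finite_weyl \<Phi> \<Longrightarrow> v x \<bullet> v y = x \<bullet> y"
  by (induction rule: finite_weyl.induct) (auto simp: reflection_inner)

lemma finite_weyl_comp: "u \<in> finite_weyl \<Phi> \<Longrightarrow> v \<in> finite_weyl \<Phi> \<Longrightarrow> u \<circ> v \<in> finite_weyl \<Phi>"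
  by (induction rule: finite_weyl.induct) (auto simp: comp_assoc intro: finite_weyl.intros)

lemma finite_weyl_inverse:
  "v \<in> finite_weyl \<Phi> \<Longrightarrow> \<exists>u\<in>finite_weyl \<Phi>. u \<circ> v = id \<and> v \<circ> u = id"
proof (induction rule: finite_weyl.induct)
  case (2 a v)
  then obtain u where u: "u \<in> finite_weyl \<Phi>" "u \<circ> v = id" "v \<circ> u = id" by blast
  have "(u \<circ> reflection a) \<circ> (reflection a \<circ> v) = id" "(reflection a \<circ> v) \<circ> (u \<circ> reflection a) = id"
    using u by (auto simp: fun_eq_iff)
  then show ?case using u 2 finite_weyl_comp finite_weyl_reflection by blast
qed (rule bexI[of _ id], simp_all add: finite_weyl.intros)

lemma finite_weyl_root: "v \<in> finite_weyl \<Phi> \<Longrightarrow> a \<in> \<Phi> \<Longrightarrow> v a \<in> \<Phi>"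
  by (induction rule: finite_weyl.induct) (auto simp: reflection_closed)

lemma finite_weyl_lattice: "v \<in> finite_weyl \<Phi> \<Longrightarrow> \<mu> \<in> L \<Longrightarrow> v \<mu> \<in> L"
  by (induction rule: finite_weyl.induct) (auto simp: lattice_reflection)

lemma finite_weyl_coroot: "v \<in> finite_weyl \<Phi> \<Longrightarrow> v (coroot a) = coroot (v a)"
  by (induction rule: finite_weyl.induct) (auto simp: reflection_coroot)

lemma finite_weyl_norm: "v \<in> finite_weyl \<Phi> \<Longrightarrow> norm (v a) = norm a"
  by (simp add: norm_eq_sqrt_inner finite_weyl_inner)

abbreviation (input) "W \<equiv> affine_weyl \<Phi>"

text \<open>Membership in terms of the two components that the actions on the torus and on rational
  functions refer to.\<close>

lemma affine_weyl_iff: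
  "w \<in> W \<longleftrightarrow> w 0 \<in> L \<and> linear_part w \<in> finite_weyl \<Phi>"
proof
  assume "w \<in> W"
  then obtain \<nu> v where w: "w = translation \<nu> \<circ> v" "\<nu> \<in> L" "v \<in> finite_weyl \<Phi>"
    by (auto simp: affine_weyl_def)
  then have "v 0 = 0" using finite_weyl_linear linear_0 by blast
  then have "w 0 = \<nu>" "linear_part w = v"
    using w by (auto simp: translation_def linear_part_def fun_eq_iff)
  then show "w 0 \<in> L \<and> linear_part w \<in> finite_weyl \<Phi>" using w by simp
next
  assume "w 0 \<in> L \<and> linear_part w \<in> finite_weyl \<Phi>"
  moreover have "w = translation (w 0) \<circ> linear_part w"
    by (auto simp: translation_def linear_part_def)
  ultimately show "w \<in> W" unfolding affine_weyl_def by blast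
qed

lemma affine_weyl_apply: "w y = linear_part w y + w 0"
  by (simp add: linear_part_def)

lemma affine_linear: "w \<in> W \<Longrightarrow> linear (linear_part w)"
  using affine_weyl_iff finite_weyl_linear by blast

lemma linear_part_comp:
  assumes "u \<in> W"
  shows "linear_part (u \<circ> w) = linear_part u \<circ> linear_part w" "(u \<circ> w) 0 = u 0 + linear_part u (w 0)"
proof -
  have *: "u y - u z = linear_part u (y - z)" for y z
    using affine_linear[OF assms] by (simp add: linear_diff) (simp add: linear_part_def)
  show "linear_part (u \<circ> w) = linear_part u \<circ> linear_part w"
    using * by (simp add: fun_eq_iff linear_part_def[of "u \<circ> w"]) (simp add: linear_part_def)
  show "(u \<circ> w) 0 = u 0 + linear_part u (w 0)"
    by (simp add: linear_part_def)
qed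

lemma affine_weyl_comp: "u \<in> W \<Longrightarrow> w \<in> W \<Longrightarrow> u \<circ> w \<in> W"
  by (subst affine_weyl_iff)
     (simp add: linear_part_comp affine_weyl_iff finite_weyl_comp lattice_add finite_weyl_lattice del: comp_apply)

lemma affine_weyl_id: "id \<in> W"
proof -
  have "linear_part id = id" by (auto simp: linear_part_def)
  then show ?thesis using finite_weyl.intros(1)[of \<Phi>]
    by (metis affine_weyl_iff id_apply lattice_0)
qed

lemma linear_part_id [simp]: "linear_part id = id"
  by (auto simp: linear_part_def)

lemma linear_part_linear: "linear v \<Longrightarrow> linear_part v = v"
  by (auto simp: linear_part_def linear_0)

lemma finite_in_affine: "v \<in> finite_weyl \<Phi> \<Longrightarrow> v \<in> W"
  using finite_weyl_linear[of v] by (simp add: affine_weyl_iff linear_part_linear linear_0)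

lemma linear_part_translation [simp]: "linear_part (translation \<mu>) = id"
  by (auto simp: linear_part_def translation_def)

lemma translation_in_affine: "\<mu> \<in> L \<Longrightarrow> translation \<mu> \<in> W"
  by (simp add: affine_weyl_iff finite_weyl.intros) (simp add: translation_def)

lemma affine_weyl_inverse:
  assumes "w \<in> W"
  shows "\<exists>u\<in>W. u \<circ> w = id \<and> w \<circ> u = id"
proof -
  obtain \<nu> v where w: "w = translation \<nu> \<circ> v" "\<nu> \<in> L" "v \<in> finite_weyl \<Phi>"
    using assms by (auto simp: affine_weyl_def)
  obtain u where u: "u \<in> finite_weyl \<Phi>" "u \<circ> v = id" "v \<circ> u = id"
    using finite_weyl_inverse w by blast
  have "u \<circ> translation (- \<nu>) \<in> W"
    using u w by (intro affine_weyl_comp finite_in_affine translation_in_affine lattice_minus)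
  moreover have "(u \<circ> translation (- \<nu>)) \<circ> w = id" "w \<circ> (u \<circ> translation (- \<nu>)) = id"
    using u by (auto simp: w translation_def fun_eq_iff)
  ultimately show ?thesis by blast
qed

lemma linear_part_finite: "w \<in> W \<Longrightarrow> linear_part w \<in> finite_weyl \<Phi>"
  and at_0_lattice: "w \<in> W \<Longrightarrow> w 0 \<in> L"
  by (auto simp: affine_weyl_iff)

end

section \<open>Integrality of the exponents\<close>

context root_data
begin

text \<open>Some long root is not orthogonal to a given root: otherwise the roots orthogonal to all long
  roots would split the root system, as a root meeting a long root reflects it to a long root.\<close>

lemma ex_long_root_not_orthogonal:
  assumes "a \<in> \<Phi>"
  obtains b where "b \<in> \<Phi>" "\<And>d. d \<in> \<Phi> \<Longrightarrow> norm d \<le> norm b" "a \<bullet> b \<noteq> 0"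
proof -
  define long where "long = (\<lambda>b. b \<in> \<Phi> \<and> (\<forall>d\<in>\<Phi>. norm d \<le> norm b))"
  define A where "A = {a\<in>\<Phi>. \<forall>b. long b \<longrightarrow> a \<bullet> b = 0}"
  have "A = {} \<or> \<Phi> - A = {}"
  proof (rule irreducible)
    fix x y assume x: "x \<in> A" and "y \<in> \<Phi> - A"
    then obtain b where b: "long b" "y \<bullet> b \<noteq> 0" "y \<in> \<Phi>" by (auto simp: A_def)
    have "long (reflection y b)"
      using b reflection_closed by (simp add: long_def)
    then have "x \<bullet> reflection y b = 0" "x \<bullet> b = 0" using x b by (auto simp: A_def)
    then have "(y \<bullet> b) * (x \<bullet> coroot y) = 0" by (simp add: reflection_def inner_diff_right)
    then show "x \<bullet> y = 0" using b by (simp add: coroot_def)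
  qed (auto simp: A_def)
  moreover have "\<exists>b. long b"
  proof -
    have "Max (norm ` \<Phi>) \<in> norm ` \<Phi>" using finite_roots nonempty by simp
    then obtain b where "b \<in> \<Phi>" "norm b = Max (norm ` \<Phi>)" by auto
    then show ?thesis using finite_roots by (intro exI[of _ b]) (auto simp: long_def)
  qed
  then obtain b where b: "long b" by blast
  then have "b \<in> \<Phi> - A" by (auto simp: A_def long_def)
  ultimately have "a \<notin> A" by blast
  then show ?thesis using that assms by (auto simp: A_def long_def)
qed

text \<open>
  For a long root \<open>b\<close> not orthogonal to \<open>a\<close>, the Cartan integers \<open>x\<close> and \<open>y\<close> of the pair have product
  at most 4 and quotient \<open>x / y = \<parallel>b\<parallel>\<^sup>2 / \<parallel>a\<parallel>\<^sup>2\<close>, at least 1.  Therefore the quotient is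
  an integer, and \<open>2 / \<parallel>b\<parallel>\<^sup>2\<close> is a square by the normalisation.
\<close>

lemma two_over_norm_integral:
  assumes a: "a \<in> \<Phi>"
  shows "2 / (norm a)\<^sup>2 \<in> \<int>"
proof -
  obtain b where b: "b \<in> \<Phi>" "\<And>d. d \<in> \<Phi> \<Longrightarrow> norm d \<le> norm b" "a \<bullet> b \<noteq> 0"
    using ex_long_root_not_orthogonal[OF a] by metis
  obtain m :: nat where m: "m > 0" "(norm b)\<^sup>2 = 2 / (real m)\<^sup>2"
    using normalised b by blast
  obtain x y :: int where x: "b \<bullet> coroot a = of_int x" and y: "a \<bullet> coroot b = of_int y"
    using integral[of a b] integral[of b a] a b by (metis Ints_cases)
  let ?A = "(norm a)\<^sup>2" and ?B = "(norm b)\<^sup>2"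
  have pos: "?A > 0" "?B > 0" using a b by auto
  have le: "?A \<le> ?B" using b a by (simp add: power_mono)
  have eq: "real_of_int y * ?B = real_of_int x * ?A"
    using inner_coroot_commute[of a b] x y by simp
  have xval: "of_int x = 2 * (a \<bullet> b) / ?A" and yval: "of_int y = 2 * (a \<bullet> b) / ?B"
    using x y by (simp_all add: coroot_def inner_commute)
  have nz: "x \<noteq> 0" "y \<noteq> 0" using b xval yval pos by auto
  have "(a \<bullet> b)\<^sup>2 \<le> ?A * ?B"
    using Cauchy_Schwarz_ineq[of a b] by (simp add: power2_norm_eq_inner)
  then have "4 * (a \<bullet> b)\<^sup>2 / (?A * ?B) \<le> 4"
    using pos by (subst divide_le_eq) simp
  then have "real_of_int (x * y) \<le> 4"
    by (simp add: xval yval power2_eq_square)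
  then have xy: "x * y \<le> 4" by linarith
  have sgn: "x * y > 0"
  proof -
    have "real_of_int (x * y) * (?A * ?B) = 4 * (a \<bullet> b)\<^sup>2"
      using pos by (simp add: xval yval field_simps power2_eq_square)
    also have "\<dots> > 0" using b by simp
    finally have "real_of_int (x * y) > 0" using pos by (metis mult_pos_pos zero_less_mult_pos2)
    then show ?thesis by (simp only: of_int_0_less_iff)
  qed
  have "\<bar>real_of_int y\<bar> * ?B = \<bar>real_of_int x\<bar> * ?A"
    using arg_cong[OF eq, of abs] pos by (simp add: abs_mult)
  then have yx: "\<bar>y\<bar> \<le> \<bar>x\<bar>"
  proof -
    have "\<bar>real_of_int y\<bar> * ?A \<le> \<bar>real_of_int y\<bar> * ?B" using le by (simp add: mult_left_mono)
    then have "\<bar>real_of_int y\<bar> * ?A \<le> \<bar>real_of_int x\<bar> * ?A"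
      using \<open>\<bar>real_of_int y\<bar> * ?B = \<bar>real_of_int x\<bar> * ?A\<close> by simp
    then show ?thesis using pos by simp
  qed
  have "y dvd x"
  proof -
    have "\<bar>x\<bar> * \<bar>y\<bar> \<le> 4" using xy sgn by (simp flip: abs_mult)
    have "\<bar>y\<bar> = 1 \<or> \<bar>y\<bar> = 2 \<and> \<bar>x\<bar> = 2"
    proof -
      have "\<bar>y\<bar> * \<bar>y\<bar> \<le> 4" using yx \<open>\<bar>x\<bar> * \<bar>y\<bar> \<le> 4\<close> mult_right_mono[OF yx, of "\<bar>y\<bar>"] by linarith
      then have "\<bar>y\<bar> < 3" using mult_mono[of 3 "\<bar>y\<bar>" 3 "\<bar>y\<bar>"] by (cases "\<bar>y\<bar> \<ge> 3") auto
      then have "\<bar>y\<bar> = 1 \<or> \<bar>y\<bar> = 2" using nz by linarith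
      then show ?thesis using yx \<open>\<bar>x\<bar> * \<bar>y\<bar> \<le> 4\<close> by auto
    qed
    then have "\<bar>y\<bar> dvd \<bar>x\<bar>" by (metis dvd_refl one_dvd)
    then show ?thesis by simp
  qed
  then obtain z where z: "x = y * z" by (auto simp: dvd_def)
  have "?B = of_int z * ?A"
    using eq nz by (simp add: z)
  moreover have "z \<noteq> 0" using nz z by auto
  ultimately have "2 / ?A = of_int z * (2 / ?B)" using pos by (simp add: field_simps)
  also have "\<dots> = of_int (z * (int m)\<^sup>2)" using m by simp
  finally show ?thesis by (metis Ints_of_int)
qed

lemma coroot_inner_lattice: "a \<in> \<Phi> \<Longrightarrow> coroot a \<bullet> \<mu> = 2 / (norm a)\<^sup>2 * (a \<bullet> \<mu>)"
  by (simp add: coroot_def)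

lemma lattice_integral: "\<mu> \<in> coroot_lattice \<Phi> \<Longrightarrow> \<nu> \<in> coroot_lattice \<Phi> \<Longrightarrow> \<mu> \<bullet> \<nu> \<in> \<int>"
proof (induction rule: lattice_induct)
  case (coroot a)
  then show ?case
    using two_over_norm_integral root_lattice_integral by (simp add: coroot_inner_lattice del: times_divide_eq_left)
qed (simp_all add: inner_add_left)

end

section \<open>Affine roots\<close>

text \<open>The pair \<open>(a, l)\<close> stands for the affine function \<open>y \<mapsto> a \<bullet> y + l\<close>.\<close>

definition affine_value :: "'a::euclidean_space \<times> int \<Rightarrow> 'a \<Rightarrow> real" where
  "affine_value b y = fst b \<bullet> y + of_int (snd b)"

definition affine_reflection :: "'a::euclidean_space \<times> int \<Rightarrow> 'a \<Rightarrow> 'a" where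
  "affine_reflection b y = y - affine_value b y *\<^sub>R coroot (fst b)"

text \<open>The affine function \<open>b \<circ> w\<^sup>-\<^sup>1\<close>; the floor only converts an integer from the reals.\<close>

definition affine_action :: "('a::euclidean_space \<Rightarrow> 'a) \<Rightarrow> 'a \<times> int \<Rightarrow> 'a \<times> int" where
  "affine_action w b = (linear_part w (fst b), snd b - \<lfloor>linear_part w (fst b) \<bullet> w 0\<rfloor>)"

context root_data
begin

abbreviation "grad \<equiv> gradient \<alpha> \<phi>"
abbreviation "sr \<equiv> simple_reflection \<alpha> \<phi>"
abbreviation "sval \<equiv> affine_root \<alpha> \<phi>"

definition simple_affine_root :: "nat \<Rightarrow> 'a \<times> int" where
  "simple_affine_root j = (grad j, if j = 0 then 1 else 0)"

lemma affine_root_eq: "sval j y = affine_value (simple_affine_root j) y"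
  by (simp add: affine_root_def affine_value_def simple_affine_root_def)

lemma gradient_root: "j \<in> {0..r} \<Longrightarrow> grad j \<in> \<Phi>"
  using simple_roots highest_root root_minus by (auto simp: gradient_def)

lemma simple_reflection_eq: "sr j = affine_reflection (simple_affine_root j)"
  by (auto simp: fun_eq_iff simple_reflection_def affine_reflection_def simple_affine_root_def
      affine_value_def gradient_def translation_def reflection_def coroot_minus algebra_simps)

lemma affine_reflection_affine:
  assumes "fst b \<in> \<Phi>" shows "affine_reflection b \<in> affine_weyl \<Phi>"
proof -
  have "affine_reflection b = translation (of_int (- snd b) *\<^sub>R coroot (fst b)) \<circ> reflection (fst b)"
    by (auto simp: fun_eq_iff affine_reflection_def affine_value_def translation_def reflection_def algebra_simps)
  moreover have "of_int (- snd b) *\<^sub>R coroot (fst b) \<in> coroot_lattice \<Phi>"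
    using assms lattice_coroot lattice_int_scale by blast
  ultimately show ?thesis
    using assms by (simp only: affine_weyl_comp translation_in_affine finite_in_affine finite_weyl_reflection)
qed

lemma simple_reflection_affine: "j \<in> {0..r} \<Longrightarrow> sr j \<in> affine_weyl \<Phi>"
  using gradient_root[of j] by (simp add: simple_reflection_eq affine_reflection_affine simple_affine_root_def)

lemma affine_reflection_involution:
  assumes "fst b \<in> \<Phi>" shows "affine_reflection b (affine_reflection b y) = y"
  using assms by (simp add: affine_reflection_def affine_value_def inner_diff_right inner_coroot_self algebra_simps)

lemma simple_reflection_involution [simp]: "j \<in> {0..r} \<Longrightarrow> sr j (sr j y) = y"
  using gradient_root[of j] by (simp add: simple_reflection_eq affine_reflection_involution simple_affine_root_def)

lemma affine_value_reflection:
  "affine_value b (affine_reflection b' y) = affine_value b y - affine_value b' y * (fst b \<bullet> coroot (fst b'))"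
  by (simp add: affine_reflection_def affine_value_def inner_diff_right)

lemma affine_action_root: "w \<in> affine_weyl \<Phi> \<Longrightarrow> fst b \<in> \<Phi> \<Longrightarrow> fst (affine_action w b) \<in> \<Phi>"
  by (simp add: affine_action_def finite_weyl_root linear_part_finite)

lemma affine_value_action:
  assumes "w \<in> affine_weyl \<Phi>" "fst b \<in> \<Phi>"
  shows "affine_value (affine_action w b) (w y) = affine_value b y"
proof -
  let ?v = "linear_part w"
  have v: "?v \<in> finite_weyl \<Phi>" "w 0 \<in> coroot_lattice \<Phi>" using assms affine_weyl_iff by auto
  then have "?v (fst b) \<bullet> w 0 \<in> \<int>" using root_lattice_integral finite_weyl_root assms by blast
  then have "of_int \<lfloor>?v (fst b) \<bullet> w 0\<rfloor> = ?v (fst b) \<bullet> w 0" by (metis Ints_cases floor_of_int)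
  moreover have "?v (fst b) \<bullet> w y = fst b \<bullet> y + ?v (fst b) \<bullet> w 0"
    using finite_weyl_inner[OF v(1)] affine_weyl_apply[of w y] by (simp add: inner_add_right)
  ultimately show ?thesis unfolding affine_value_def affine_action_def fst_conv snd_conv of_int_diff by linarith
qed

lemma affine_reflection_action:
  assumes "w \<in> affine_weyl \<Phi>" "fst b \<in> \<Phi>"
  shows "affine_reflection (affine_action w b) (w y) = w (affine_reflection b y)"
proof -
  let ?v = "linear_part w"
  have v: "?v \<in> finite_weyl \<Phi>" using assms affine_weyl_iff by auto
  let ?c = "- affine_value b y *\<^sub>R coroot (fst b)"
  have "w (affine_reflection b y) = w (?c + y)"
    by (simp add: affine_reflection_def)
  also have "\<dots> = ?v ?c + w y"
    unfolding affine_weyl_apply[of w y] affine_weyl_apply[of w "?c + y"] linear_add[OF affine_linear[OF assms(1)]]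
    by simp
  also have "?v (- affine_value b y *\<^sub>R coroot (fst b)) = - affine_value b y *\<^sub>R coroot (?v (fst b))"
    using affine_linear[OF assms(1)] finite_weyl_coroot[OF v] by (simp add: linear_cmul linear_neg)
  finally show ?thesis
    using affine_value_action[OF assms] by (simp add: affine_reflection_def affine_action_def)
qed

lemma affine_value_simple_action:
  assumes "j \<in> {0..r}" "fst b \<in> \<Phi>"
  shows "affine_value (affine_action (sr j) b) y = affine_value b (sr j y)"
  using affine_value_action[OF simple_reflection_affine[OF assms(1)] assms(2), of "sr j y"] assms(1)
  by simp

lemma affine_value_simple_reflection:
  "affine_value b (sr j y) = affine_value b y - sval j y * (fst b \<bullet> coroot (grad j))"
  unfolding simple_reflection_eq affine_value_reflection affine_root_eq by (simp add: simple_affine_root_def)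

section \<open>Positive affine roots\<close>

lemma simple_cone_add: "x \<in> simple_cone r \<alpha> \<Longrightarrow> y \<in> simple_cone r \<alpha> \<Longrightarrow> x + y \<in> simple_cone r \<alpha>"
proof -
  assume "x \<in> simple_cone r \<alpha>" "y \<in> simple_cone r \<alpha>"
  then obtain m n where "x = (\<Sum>i = 1..r. of_nat (m i) *\<^sub>R \<alpha> i)" "y = (\<Sum>i = 1..r. of_nat (n i) *\<^sub>R \<alpha> i)"
    by (auto simp: simple_cone_def)
  then have "x + y = (\<Sum>i = 1..r. of_nat (m i + n i) *\<^sub>R \<alpha> i)"
    by (simp add: sum.distrib scaleR_add_left)
  then show ?thesis by (auto simp: simple_cone_def intro!: exI[of _ "\<lambda>i. m i + n i"])
qed

lemma simple_coneE:
  assumes "x \<in> simple_cone r \<alpha>"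
  obtains m :: "nat \<Rightarrow> nat" where "x = (\<Sum>i = 1..r. of_nat (m i) *\<^sub>R \<alpha> i)"
  using assms unfolding simple_cone_def by blast

lemma simple_cone_0: "0 \<in> simple_cone r \<alpha>"
  by (auto simp: simple_cone_def intro!: exI[of _ "\<lambda>i. 0"])

lemma simple_cone_scale: "x \<in> simple_cone r \<alpha> \<Longrightarrow> of_nat k *\<^sub>R x \<in> simple_cone r \<alpha>"
  by (induction k) (auto simp: scaleR_add_left simple_cone_0 simple_cone_add)

lemma simple_in_cone: "i \<in> {1..r} \<Longrightarrow> \<alpha> i \<in> simple_cone r \<alpha>"
proof -
  assume i: "i \<in> {1..r}"
  have "(\<Sum>k = 1..r. of_nat (if k = i then 1 else 0) *\<^sub>R \<alpha> k) = (\<Sum>k = 1..r. if k = i then \<alpha> k else 0)"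
    by (intro sum.cong) auto
  also have "\<dots> = \<alpha> i" using i by simp
  finally have "\<alpha> i = (\<Sum>k = 1..r. of_nat (if k = i then 1 else 0) *\<^sub>R \<alpha> k)" ..
  then show ?thesis unfolding simple_cone_def
    by (intro CollectI exI[of _ "\<lambda>k. if k = i then 1 else 0"] conjI TrueI)
qed

lemma ex_point_with_simple_values: "\<exists>x. \<forall>i\<in>{1..r}. \<alpha> i \<bullet> x = f i"
proof -
  obtain g :: "'a \<Rightarrow> real" where g: "linear g" "\<And>x. x \<in> \<alpha> ` {1..r} \<Longrightarrow> g x = (f \<circ> inv_into {1..r} \<alpha>) x"
    using linear_independent_extend[OF simple_independent] by metis
  have "\<alpha> i \<bullet> adjoint g 1 = f i" if "i \<in> {1..r}" for i
    using g that simple_inj adjoint_works[OF g(1), of "\<alpha> i" 1] by simp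
  then show ?thesis by blast
qed

text \<open>Otherwise \<open>-\<phi>\<close> and \<open>\<phi> - (-\<phi>)\<close>, the latter because \<open>\<phi>\<close> is highest, would both be nonnegative
  combinations of the simple roots.\<close>

lemma highest_root_in_cone: "\<phi> \<in> simple_cone r \<alpha>"
proof (rule ccontr)
  assume "\<phi> \<notin> simple_cone r \<alpha>"
  then have "- \<phi> \<in> simple_cone r \<alpha>" using simple_base highest_root by blast
  moreover have "\<phi> - (- \<phi>) \<in> simple_cone r \<alpha>" using highest root_minus highest_root by blast
  ultimately obtain m n where m: "- \<phi> = (\<Sum>i = 1..r. of_nat (m i) *\<^sub>R \<alpha> i)"
    and n: "\<phi> - (- \<phi>) = (\<Sum>i = 1..r. of_nat (n i) *\<^sub>R \<alpha> i)"
    by (elim simple_coneE)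
  obtain x where x: "\<forall>i\<in>{1..r}. \<alpha> i \<bullet> x = 1" using ex_point_with_simple_values[of "\<lambda>_. 1"] by blast
  have *: "(\<Sum>i = 1..r. of_nat (k i) *\<^sub>R \<alpha> i) \<bullet> x = (\<Sum>i = 1..r. real (k i))" for k
    unfolding inner_sum_left by (intro sum.cong) (use x in auto)
  have "- \<phi> \<bullet> x = (\<Sum>i = 1..r. real (m i))" unfolding m by (rule *)
  moreover have "(\<phi> - (- \<phi>)) \<bullet> x = (\<Sum>i = 1..r. real (n i))" unfolding n by (rule *)
  moreover have "(\<Sum>i = 1..r. real (m i)) \<ge> 0" "(\<Sum>i = 1..r. real (n i)) \<ge> 0" by (simp_all add: sum_nonneg)
  ultimately have "(\<Sum>i = 1..r. real (m i)) = 0" by (simp only: inner_diff_left inner_minus_left)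
  then have "\<forall>i\<in>{1..r}. m i = 0" by (simp add: sum_nonneg_eq_0_iff)
  then have "- \<phi> = 0" unfolding m by (intro sum.neutral) simp
  then show False using highest_root by simp
qed

lemma cone_inner_nonneg:
  assumes "x \<in> simple_cone r \<alpha>" "\<And>i. i \<in> {1..r} \<Longrightarrow> \<alpha> i \<bullet> y \<ge> 0"
  shows "x \<bullet> y \<ge> 0"
  using assms by (auto simp: simple_cone_def inner_sum_left intro!: sum_nonneg mult_nonneg_nonneg)

text \<open>
  An affine root \<open>(a, l)\<close> with \<open>l \<ge> 0\<close> is \<open>l \<alpha>\<^sub>0\<close> plus the linear function \<open>a + l \<phi>\<close>, which lies in the simple
  cone: for \<open>l \<ge> 1\<close> it is \<open>(\<phi> - (-a)) + (l - 1) \<phi>\<close>, and \<open>\<phi>\<close> is highest; for \<open>l = 0\<close> this holds after a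
  change of sign if necessary.
\<close>

lemma affine_root_simple_combination:
  assumes "fst b \<in> \<Phi>"
  obtains b' and n :: "nat \<Rightarrow> nat" where "b' = b \<or> b' = (- fst b, - snd b)"
    "fst b' = (\<Sum>j = 0..r. of_nat (n j) *\<^sub>R grad j)" "\<And>y. affine_value b' y = (\<Sum>j = 0..r. of_nat (n j) * sval j y)"
    "snd b' = int (n 0)"
proof -
  have "\<exists>n :: nat \<Rightarrow> nat. fst c = (\<Sum>j = 0..r. of_nat (n j) *\<^sub>R grad j) \<and>
      (\<forall>y. affine_value c y = (\<Sum>j = 0..r. of_nat (n j) * sval j y)) \<and> snd c = int (n 0)"
    if "snd c \<ge> 0" "fst c + of_int (snd c) *\<^sub>R \<phi> \<in> simple_cone r \<alpha>" for c
  proof -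
    obtain m where m: "fst c + of_int (snd c) *\<^sub>R \<phi> = (\<Sum>i = 1..r. of_nat (m i) *\<^sub>R \<alpha> i)"
      using simple_coneE[OF \<open>_ \<in> simple_cone r \<alpha>\<close>] by blast
    define n where "n = (\<lambda>j. if j = 0 then nat (snd c) else m j)"
    have "{0..r} = insert 0 {1..r}" by auto
    then have "(\<Sum>j = 0..r. of_nat (n j) *\<^sub>R grad j) = of_int (snd c) *\<^sub>R (- \<phi>) + (\<Sum>j = 1..r. of_nat (m j) *\<^sub>R \<alpha> j)"
      using that(1) by (simp add: n_def gradient_def)
    then have 1: "(\<Sum>j = 0..r. of_nat (n j) *\<^sub>R grad j) = fst c"
      using m by (metis add.commute add_diff_cancel_right' scaleR_minus_right uminus_add_conv_diff)
    have "(\<Sum>j = 0..r. of_nat (n j) * sval j y) = (\<Sum>j = 0..r. of_nat (n j) *\<^sub>R grad j) \<bullet> y + of_int (snd c)" for y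
    proof -
      have "(\<Sum>j = 0..r. of_nat (n j) * sval j y) = (\<Sum>j = 0..r. of_nat (n j) *\<^sub>R grad j) \<bullet> y + (\<Sum>j = 0..r. if j = 0 then real (n j) else 0)"
        unfolding inner_sum_left sum.distrib[symmetric]
        by (intro sum.cong) (auto simp: affine_root_def algebra_simps)
      then show ?thesis using that(1) by (simp add: n_def)
    qed
    then show ?thesis using 1 that(1) by (intro exI[of _ n]) (auto simp: affine_value_def n_def)
  qed
  moreover obtain b' where "b' = b \<or> b' = (- fst b, - snd b)" "snd b' \<ge> 0" "fst b' + of_int (snd b') *\<^sub>R \<phi> \<in> simple_cone r \<alpha>"
  proof -
    have *: "a + of_int l *\<^sub>R \<phi> \<in> simple_cone r \<alpha>" if "a \<in> simple_cone r \<alpha>" "l \<ge> 0" for a l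
      using simple_cone_add[OF that(1) simple_cone_scale[OF highest_root_in_cone, of "nat l"]] that(2) by simp
    have **: "a + of_int l *\<^sub>R \<phi> \<in> simple_cone r \<alpha>" if "a \<in> \<Phi>" "l \<ge> 1" for a l
    proof -
      have "\<phi> - (- a) \<in> simple_cone r \<alpha>" using highest root_minus that by blast
      from *[OF this, of "l - 1"] have "(\<phi> - (- a)) + of_int (l - 1) *\<^sub>R \<phi> \<in> simple_cone r \<alpha>" using that by simp
      then show ?thesis by (simp add: algebra_simps)
    qed
    consider "snd b \<ge> 1" | "snd b \<le> -1" | "snd b = 0" by linarith
    then show ?thesis
    proof cases
      case 1
      then show ?thesis using ** assms that[of b] by auto
    next
      case 2
      then show ?thesis using **[of "- fst b" "- snd b"] assms root_minus that[of "(- fst b, - snd b)"] by auto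
    next
      case 3
      then show ?thesis using simple_base[OF assms] that[of b] that[of "(- fst b, - snd b)"] by auto
    qed
  qed
  ultimately show ?thesis using that by blast
qed

text \<open>The point where all affine simple roots have the same value \<open>1/h\<close>: it is in the open alcove,
  and every affine root takes a value in \<open>\<int>/h\<close> there, which is its height up to the factor.\<close>

lemma ex_base_point: "\<exists>p. \<exists>h::nat. 0 < h \<and> (\<forall>j\<in>{0..r}. sval j p = 1 / real h)"
proof -
  obtain m where m: "\<phi> = (\<Sum>i = 1..r. of_nat (m i) *\<^sub>R \<alpha> i)"
    using highest_root_in_cone by (elim simple_coneE)
  define h where "h = (\<Sum>i = 1..r. m i) + 1"
  obtain x where x: "\<forall>i\<in>{1..r}. \<alpha> i \<bullet> x = 1 / real h" using ex_point_with_simple_values[of "\<lambda>_. 1 / real h"] by blast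
  have "\<phi> \<bullet> x = (\<Sum>i = 1..r. real (m i) * (1 / real h))"
    unfolding m inner_sum_left by (intro sum.cong) (use x in auto)
  also have "\<dots> = (\<Sum>i = 1..r. real (m i)) * (1 / real h)" by (simp only: sum_distrib_right)
  also have "\<dots> = (real h - 1) * (1 / real h)" by (simp add: h_def)
  also have "\<dots> = 1 - 1 / real h"
  proof -
    have "real h > 0" unfolding h_def of_nat_0_less_iff by simp
    then show ?thesis by (simp add: field_simps)
  qed
  finally have "sval 0 x = 1 / real h" by (simp add: affine_root_def gradient_def)
  moreover have "sval j x = 1 / real h" if "j \<in> {1..r}" for j
    using x that by (auto simp: affine_root_def gradient_def)
  ultimately have "\<forall>j\<in>{0..r}. sval j x = 1 / real h" by (metis atLeastAtMost_iff less_one not_less zero_le)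
  moreover have "h > 0" by (simp add: h_def)
  ultimately show ?thesis by blast
qed

text \<open>A point in the interior of a wall of the alcove.  For the wall of \<open>\<alpha>\<^sub>0\<close> the base point is scaled until
  \<open>\<phi>\<close> is 1; for another wall the value of one simple root at the base point is lowered to 0,
  which can only decrease \<open>\<phi>\<close>.\<close>

lemma ex_wall_point:
  assumes "j \<in> {0..r}"
  shows "\<exists>x. sval j x = 0 \<and> (\<forall>i\<in>{0..r} - {j}. sval i x > 0)"
proof -
  obtain p and h :: nat where p: "h > 0" "\<And>j. j \<in> {0..r} \<Longrightarrow> sval j p = 1 / real h"
    using ex_base_point by blast
  have p': "\<alpha> i \<bullet> p = 1 / real h" if "i \<in> {1..r}" for i
    using p(2)[of i] that by (auto simp: affine_root_def gradient_def)
  have \<phi>p: "\<phi> \<bullet> p = 1 - 1 / real h" using p(2)[of 0] by (simp add: affine_root_def gradient_def)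
  have \<phi>pos: "\<phi> \<bullet> p > 0"
  proof -
    obtain m where m: "\<phi> = (\<Sum>i = 1..r. of_nat (m i) *\<^sub>R \<alpha> i)"
      using highest_root_in_cone by (elim simple_coneE)
    have "\<exists>i\<in>{1..r}. m i \<noteq> 0"
    proof (rule ccontr)
      assume "\<not> ?thesis"
      then have "\<phi> = 0" unfolding m by (intro sum.neutral) simp
      then show False using highest_root by simp
    qed
    then obtain i where "i \<in> {1..r}" "m i \<noteq> 0" by blast
    then show ?thesis unfolding m inner_sum_left
      using p' p(1) by (intro sum_pos2[of _ i]) auto
  qed
  show ?thesis
  proof (cases "j = 0")
    case True
    define x where "x = (1 / (\<phi> \<bullet> p)) *\<^sub>R p"
    have "sval 0 x = 0" using \<phi>pos by (simp add: affine_root_def gradient_def x_def)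
    moreover have "sval i x > 0" if "i \<in> {0..r} - {0}" for i
      using that p'[of i] p(1) \<phi>pos by (simp add: affine_root_def gradient_def x_def)
    ultimately show ?thesis using True by blast
  next
    case False
    obtain x where x: "\<forall>i\<in>{1..r}. \<alpha> i \<bullet> x = (if i = j then 0 else 1 / real h)"
      using ex_point_with_simple_values[of "\<lambda>i. if i = j then 0 else 1 / real h"] by blast
    have "\<phi> \<bullet> (p - x) \<ge> 0"
      using cone_inner_nonneg[OF highest_root_in_cone, of "p - x"] x p' p(1) by (simp add: inner_diff_right)
    then have "sval 0 x > 0" using \<phi>p p(1) by (simp add: affine_root_def gradient_def inner_diff_right)
       (smt (verit) divide_pos_pos of_nat_0_less_iff)
    moreover have "sval i x > 0" if "i \<in> {0..r} - {j}" "i \<noteq> 0" for i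
      using that x p(1) by (auto simp: affine_root_def gradient_def)
    moreover have "sval j x = 0" using x False assms by (auto simp: affine_root_def gradient_def)
    ultimately show ?thesis by metis
  qed
qed

definition base_point :: 'a where
  "base_point = (SOME p. \<exists>h::nat. 0 < h \<and> (\<forall>j\<in>{0..r}. sval j p = 1 / real h))"

lemma base_point: "\<exists>h::nat. 0 < h \<and> (\<forall>j\<in>{0..r}. sval j base_point = 1 / real h)"
  unfolding base_point_def by (rule someI_ex) (rule ex_base_point)

definition positive :: "'a \<times> int \<Rightarrow> bool" where
  "positive b \<longleftrightarrow> affine_value b base_point > 0"

lemma affine_value_uminus: "affine_value (- fst b, - snd b) y = - affine_value b y"
  by (simp add: affine_value_def)

lemma positive_combination:
  assumes "fst b \<in> \<Phi>" "positive b"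
  obtains n :: "nat \<Rightarrow> nat" where
    "fst b = (\<Sum>j = 0..r. of_nat (n j) *\<^sub>R grad j)" "\<And>y. affine_value b y = (\<Sum>j = 0..r. of_nat (n j) * sval j y)"
    "snd b = int (n 0)"
proof -
  obtain b' and n :: "nat \<Rightarrow> nat" where b': "b' = b \<or> b' = (- fst b, - snd b)"
    "fst b' = (\<Sum>j = 0..r. of_nat (n j) *\<^sub>R grad j)" "\<And>y. affine_value b' y = (\<Sum>j = 0..r. of_nat (n j) * sval j y)"
    "snd b' = int (n 0)"
    by (rule affine_root_simple_combination[OF assms(1)]) blast
  obtain h :: nat where "h > 0" "\<forall>j\<in>{0..r}. sval j base_point = 1 / real h" using base_point by blast
  then have "affine_value b' base_point \<ge> 0" unfolding b' by (intro sum_nonneg) auto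
  then have "b' = b"
    using b'(1) assms(2) by (auto simp: positive_def affine_value_uminus)
  then show ?thesis using b' that by blast
qed

lemma affine_root_regular:
  assumes "fst b \<in> \<Phi>" shows "affine_value b base_point \<noteq> 0"
proof
  assume 0: "affine_value b base_point = 0"
  obtain b' and n :: "nat \<Rightarrow> nat" where b': "b' = b \<or> b' = (- fst b, - snd b)"
    "fst b' = (\<Sum>j = 0..r. of_nat (n j) *\<^sub>R grad j)" "\<And>y. affine_value b' y = (\<Sum>j = 0..r. of_nat (n j) * sval j y)"
    by (rule affine_root_simple_combination[OF assms(1)]) blast
  obtain h :: nat where h: "h > 0" "\<forall>j\<in>{0..r}. sval j base_point = 1 / real h" using base_point by blast
  have "(\<Sum>j = 0..r. real (n j) * (1 / real h)) = 0"
    using b'(1) b'(3)[of base_point] h(2) 0 affine_value_uminus[of b base_point] by auto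
  then have "\<forall>j\<in>{0..r}. n j = 0" using h(1) by (simp add: sum_nonneg_eq_0_iff)
  then have "fst b' = 0" using b'(2) by simp
  then show False using b'(1) assms by auto
qed

lemma positive_or_negative:
  assumes "fst b \<in> \<Phi>" shows "positive b \<or> positive (- fst b, - snd b)"
  using affine_root_regular[OF assms] by (auto simp: positive_def affine_value_uminus)

lemma simple_positive: "j \<in> {0..r} \<Longrightarrow> positive (simple_affine_root j)"
  using base_point by (auto simp: positive_def simp flip: affine_root_eq)

lemma positive_nonneg_on_alcove:
  assumes "fst b \<in> \<Phi>" "positive b" "\<And>j. j \<in> {0..r} \<Longrightarrow> sval j x \<ge> 0"
  shows "affine_value b x \<ge> 0"
proof (rule positive_combination[OF assms(1,2)])
  fix n :: "nat \<Rightarrow> nat"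
  assume "\<And>y. affine_value b y = (\<Sum>j = 0..r. of_nat (n j) * sval j y)"
  then have "affine_value b x = (\<Sum>j = 0..r. of_nat (n j) * sval j x)" .
  also have "\<dots> \<ge> 0" by (intro sum_nonneg mult_nonneg_nonneg assms(3)) auto
  finally show ?thesis .
qed

text \<open>A simple reflection changes the sign of no other positive affine root: where only
  \<open>\<alpha>\<^sub>j\<close> vanishes, all other positive affine roots are positive, and \<open>s\<^sub>j\<close> fixes such points.\<close>

lemma simple_reflection_positive:
  assumes b: "fst b \<in> \<Phi>" "positive b" and j: "j \<in> {0..r}" and ne: "b \<noteq> simple_affine_root j"
  shows "positive (affine_action (sr j) b)"
proof (rule ccontr)
  let ?b = "affine_action (sr j) b"
  assume neg: "\<not> ?thesis"
  obtain n :: "nat \<Rightarrow> nat" where n: "fst b = (\<Sum>j = 0..r. of_nat (n j) *\<^sub>R grad j)"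
    "\<And>y. affine_value b y = (\<Sum>j = 0..r. of_nat (n j) * sval j y)" "snd b = int (n 0)"
    by (rule positive_combination[OF b]) blast
  obtain x where x: "sval j x = 0" "\<And>i. i \<in> {0..r} - {j} \<Longrightarrow> sval i x > 0"
    using ex_wall_point[OF j] by blast
  have root: "fst ?b \<in> \<Phi>" using j b affine_action_root simple_reflection_affine by blast
  then have "positive (- fst ?b, - snd ?b)" using neg positive_or_negative by blast
  then have "affine_value (- fst ?b, - snd ?b) x \<ge> 0"
  proof (rule positive_nonneg_on_alcove[rotated])
    show "sval i x \<ge> 0" if "i \<in> {0..r}" for i
      using x(1) x(2)[of i] that by (cases "i = j") simp_all
  qed (use root root_minus in simp)
  moreover have "sr j x = x" using x(1) by (simp add: simple_reflection_eq affine_reflection_def affine_root_eq)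
  ultimately have "affine_value b x \<le> 0"
    using j b by (simp add: affine_value_uminus affine_value_simple_action)
  have nz: "n i = 0" if i: "i \<in> {0..r}" "i \<noteq> j" for i
  proof (rule ccontr)
    assume "n i \<noteq> 0"
    have "(\<Sum>j = 0..r. real (n j) * sval j x) > 0"
    proof (rule sum_pos2[of _ i])
      show "0 < real (n i) * sval i x" using x(2)[of i] i \<open>n i \<noteq> 0\<close> by simp
      show "0 \<le> real (n k) * sval k x" if "k \<in> {0..r}" for k
        using x(1) x(2)[of k] that by (cases "k = j") simp_all
    qed (use i in auto)
    then show False using \<open>affine_value b x \<le> 0\<close> n(2) by simp
  qed
  have "fst b = (\<Sum>i = 0..r. if i = j then of_nat (n j) *\<^sub>R grad j else 0)"
    unfolding n(1) using nz by (intro sum.cong) auto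
  then have "fst b = of_nat (n j) *\<^sub>R grad j" using j by simp
  moreover have "real (n j) = 1"
    using reduced[OF gradient_root[OF j], of "real (n j)"] b(1) calculation by auto
  ultimately have "fst b = grad j" "n j = 1" by auto
  moreover have "snd b = (if j = 0 then 1 else 0)" using n(3) nz[of 0] \<open>n j = 1\<close> by auto
  ultimately show False using ne by (simp add: simple_affine_root_def prod_eq_iff)
qed

text \<open>The nonzero gradient of a nonnegative combination of simple roots makes an acute angle with
  one of them.\<close>

lemma ex_acute_simple:
  assumes "fst b \<in> \<Phi>" "positive b"
  obtains j where "j \<in> {0..r}" "fst b \<bullet> grad j > 0" "affine_value b x = 0 \<Longrightarrow> (\<And>i. i \<in> {0..r} \<Longrightarrow> sval i x \<ge> 0) \<Longrightarrow> sval j x = 0"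
proof -
  obtain n :: "nat \<Rightarrow> nat" where n: "fst b = (\<Sum>j = 0..r. of_nat (n j) *\<^sub>R grad j)"
    "\<And>y. affine_value b y = (\<Sum>j = 0..r. of_nat (n j) * sval j y)"
    by (rule positive_combination[OF assms]) blast
  have "fst b \<bullet> fst b > 0" using assms by simp
  then have "(\<Sum>j = 0..r. of_nat (n j) * (fst b \<bullet> grad j)) > 0"
    by (subst (asm) (2) n(1)) (simp add: inner_sum_right)
  then have "\<exists>j\<in>{0..r}. of_nat (n j) * (fst b \<bullet> grad j) > 0"
    by (meson not_le sum_nonpos)
  then obtain j where j: "j \<in> {0..r}" "of_nat (n j) * (fst b \<bullet> grad j) > 0" by blast
  then have "n j > 0" "fst b \<bullet> grad j > 0" by (auto simp: zero_less_mult_iff)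
  moreover have "sval j x = 0" if "affine_value b x = 0" "\<And>i. i \<in> {0..r} \<Longrightarrow> sval i x \<ge> 0"
  proof -
    have "(\<Sum>j = 0..r. real (n j) * sval j x) = 0" using that(1) n(2)[of x] by simp
    then have "\<forall>i\<in>{0..r}. real (n i) * sval i x = 0"
      by (subst (asm) sum_nonneg_eq_0_iff) (use that(2) in auto)
    then have "real (n j) * sval j x = 0" using j(1) by blast
    then show ?thesis using \<open>n j > 0\<close> by simp
  qed
  ultimately show ?thesis using that j by blast
qed

text \<open>
  Induction on the height: a positive affine root that is not simple is reflected to a lower
  positive one in a simple root making an acute angle with it.  The switch \<open>C\<close> adds a refinement for a
  point \<open>x\<close> of the closed alcove at which the root vanishes: then all roots and reflections in the
  induction can be taken to vanish at \<open>x\<close> and to fix it.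
\<close>

lemma positive_root_induct [consumes 2, case_names simple reflect]:
  assumes "fst b \<in> \<Phi>" "positive b"
    and simple: "\<And>j. j \<in> {0..r} \<Longrightarrow> affine_value (simple_affine_root j) x = 0 \<or> \<not> C \<Longrightarrow> P (simple_affine_root j)"
    and step: "\<And>b j. fst b \<in> \<Phi> \<Longrightarrow> positive b \<Longrightarrow> j \<in> {0..r} \<Longrightarrow> sval j x = 0 \<or> \<not> C \<Longrightarrow>
      P (affine_action (sr j) b) \<Longrightarrow> P b"
    and C: "C \<Longrightarrow> affine_value b x = 0" "C \<Longrightarrow> (\<And>i. i \<in> {0..r} \<Longrightarrow> sval i x \<ge> 0)"
  shows "P b"
proof -
  obtain h :: nat where h: "h > 0" "\<forall>j\<in>{0..r}. sval j base_point = 1 / real h" using base_point by blast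
  have int: "\<exists>k::nat. affine_value b base_point = k / real h" if b: "fst b \<in> \<Phi>" "positive b" for b
  proof -
    obtain n :: "nat \<Rightarrow> nat" where n: "fst b = (\<Sum>j = 0..r. of_nat (n j) *\<^sub>R grad j)"
      "\<And>y. affine_value b y = (\<Sum>j = 0..r. of_nat (n j) * sval j y)"
      by (rule positive_combination[OF b]) blast
    have "affine_value b base_point = (\<Sum>j = 0..r. of_nat (n j) * sval j base_point)"
      by (rule n(2))
    also have "\<dots> = (\<Sum>j = 0..r. of_nat (n j) * (1 / real h))" using h by (intro sum.cong) auto
    also have "\<dots> = of_nat (\<Sum>j = 0..r. n j) / real h" by (simp add: sum_divide_distrib)
    finally show ?thesis by blast
  qed
  have "P b" if "fst b \<in> \<Phi>" "positive b" "affine_value b base_point = real k / real h" "C \<Longrightarrow> affine_value b x = 0" for k b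
    using that
  proof (induction k arbitrary: b rule: less_induct)
    case (less k)
    obtain j where j: "j \<in> {0..r}" "fst b \<bullet> grad j > 0"
      "affine_value b x = 0 \<Longrightarrow> (\<And>i. i \<in> {0..r} \<Longrightarrow> sval i x \<ge> 0) \<Longrightarrow> sval j x = 0"
      using ex_acute_simple[OF less.prems(1,2), where x = x] by metis
    have jx: "sval j x = 0 \<or> \<not> C" using j(3) C(2) less.prems(4) by blast
    show ?case
    proof (cases "b = simple_affine_root j")
      case True
      then show ?thesis using simple[OF j(1)] jx by (simp add: affine_root_eq)
    next
      case False
      let ?b = "affine_action (sr j) b"
      have pos: "positive ?b" using simple_reflection_positive less.prems j(1) False by blast
      have root: "fst ?b \<in> \<Phi>" using j less.prems affine_action_root simple_reflection_affine by blast
      obtain k' where k': "affine_value ?b base_point = real k' / real h" using int[OF root pos] by blast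
      have "affine_value ?b base_point = affine_value b base_point - (1 / real h) * (fst b \<bullet> coroot (grad j))"
        using h j(1) affine_value_simple_action[OF j(1) less.prems(1)] by (simp add: affine_value_simple_reflection)
      also have "\<dots> < affine_value b base_point"
        using j(1,2) gradient_root[of j] h by (simp add: coroot_def)
      finally have "k' < k" using k' less.prems(3) h(1) by (simp add: divide_less_cancel)
      moreover have "affine_value ?b x = 0" if C
      proof -
        have "sr j x = x" using jx that by (simp add: simple_reflection_eq affine_reflection_def affine_root_eq)
        then show ?thesis using that less.prems j(1) by (simp add: affine_value_simple_action)
      qed
      ultimately have "P ?b" using less.IH[OF _ root pos k'] by blast
      then show ?thesis using step less.prems j(1) jx by blast
    qed
  qed
  then show ?thesis using int assms(1,2) C(1) by metis
qed

section \<open>Words in the simple reflections\<close>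

definition word :: "nat list \<Rightarrow> 'a \<Rightarrow> 'a" where
  "word js = foldr (\<lambda>j u. sr j \<circ> u) js id"

lemma word_simps [simp]: "word [] = id" "word (j # js) = sr j \<circ> word js"
  by (simp_all add: word_def)

lemma word_append: "word (js @ ks) = word js \<circ> word ks"
  by (induction js) (auto simp: comp_assoc)

lemma word_affine: "set js \<subseteq> {0..r} \<Longrightarrow> word js \<in> affine_weyl \<Phi>"
proof (induction js)
  case (Cons j js)
  then show ?case unfolding word_simps by (intro affine_weyl_comp simple_reflection_affine) auto
qed (simp add: affine_weyl_id)

lemma word_rev: "set js \<subseteq> {0..r} \<Longrightarrow> word (rev js) (word js y) = y"
  by (induction js arbitrary: y) (auto simp: word_append)

text \<open>The induction on the height conjugates the reflection in an affine root to the one in a simple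
  root.\<close>

lemma affine_reflection_word:
  assumes "fst b \<in> \<Phi>" shows "\<exists>js. set js \<subseteq> {0..r} \<and> affine_reflection b = word js"
proof -
  have *: "\<exists>js. set js \<subseteq> {0..r} \<and> affine_reflection b = word js" if "fst b \<in> \<Phi>" "positive b" for b
    using that
  proof (induction rule: positive_root_induct[where C = False and x = 0])
    case (simple j)
    then show ?case by (intro exI[of _ "[j]"]) (auto simp: simple_reflection_eq)
  next
    case (reflect b j)
    then obtain js where js: "set js \<subseteq> {0..r}" "affine_reflection (affine_action (sr j) b) = word js" by blast
    have "affine_reflection b y = word ([j] @ js @ [j]) y" for y
    proof -
      have "word js (sr j y) = sr j (affine_reflection b y)"
        using affine_reflection_action[OF simple_reflection_affine[OF reflect(3)] reflect(1), of y] js by simp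
      then show ?thesis using reflect(3) by (simp add: word_append)
    qed
    then show ?case using js reflect(3) by (intro exI[of _ "[j] @ js @ [j]"]) auto
  qed auto
  show ?thesis
  proof (cases "positive b")
    case False
    then have "positive (- fst b, - snd b)" using positive_or_negative assms by blast
    moreover have "affine_reflection (- fst b, - snd b) = affine_reflection b"
      by (auto simp: affine_reflection_def affine_value_def coroot_minus fun_eq_iff algebra_simps)
    ultimately show ?thesis using *[of "(- fst b, - snd b)"] root_minus assms by auto
  qed (use * assms in blast)
qed

lemma affine_weyl_word:
  assumes "w \<in> affine_weyl \<Phi>" shows "\<exists>js. set js \<subseteq> {0..r} \<and> w = word js"
proof -
  have comp: "\<exists>js. set js \<subseteq> {0..r} \<and> u \<circ> v = word js"
    if "\<exists>js. set js \<subseteq> {0..r} \<and> u = word js" "\<exists>js. set js \<subseteq> {0..r} \<and> v = word js" for u v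
    using that by (metis word_append set_append Un_subset_iff)
  have "\<exists>js. set js \<subseteq> {0..r} \<and> v = word js" if "v \<in> finite_weyl \<Phi>" for v
    using that
  proof (induction rule: finite_weyl.induct)
    case (2 a v)
    have "reflection a = affine_reflection (a, 0)"
      by (auto simp: affine_reflection_def affine_value_def reflection_def)
    then show ?case using comp affine_reflection_word[of "(a, 0)"] 2 by (metis fst_conv)
  qed (auto intro!: exI[of _ "[]"])
  moreover have "\<exists>js. set js \<subseteq> {0..r} \<and> translation \<mu> = word js" if "\<mu> \<in> coroot_lattice \<Phi>" for \<mu>
    using that
  proof (induction rule: lattice_induct)
    case zero
    then show ?case by (intro exI[of _ "[]"]) (auto simp: translation_def)
  next
    case (coroot a)
    have "translation (coroot a) = affine_reflection (a, -1) \<circ> affine_reflection (a, 0)"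
      using coroot by (auto simp: affine_reflection_def affine_value_def translation_def inner_diff_right inner_coroot_self algebra_simps)
    then show ?case
      using comp affine_reflection_word[of "(a, 0)"] affine_reflection_word[of "(a, -1)"] coroot
      by (metis fst_conv)
  next
    case (add x y)
    have "translation (x + y) = translation x \<circ> translation y" by (auto simp: translation_def algebra_simps)
    then show ?case using add comp by metis
  next
    case (minus x)
    then obtain js where js: "set js \<subseteq> {0..r}" "translation x = word js" by blast
    have "translation (- x) y = word (rev js) y" for y
    proof -
      have "word js (translation (- x) y) = y" unfolding js(2)[symmetric] by (simp add: translation_def)
      then show ?thesis using word_rev[OF js(1)] by metis
    qed
    then show ?case using js(1) by (intro exI[of _ "rev js"]) auto
  qed
  ultimately show ?thesis using assms comp by (auto simp: affine_weyl_def)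
qed

text \<open>Exchange: a gallery from the base point to \<open>w p\<close> on whose way the sign of \<open>b\<close> changes crosses
  the hyperplane of \<open>b\<close>, and reflecting its tail there saves a letter.\<close>

lemma exchange:
  assumes "set js \<subseteq> {0..r}" "fst b \<in> \<Phi>" "positive b" "affine_value b (word js base_point) < 0"
  shows "\<exists>ks. set ks \<subseteq> {0..r} \<and> length js = Suc (length ks) \<and> affine_reflection b \<circ> word js = word ks"
  using assms
proof (induction js arbitrary: b)
  case Nil
  then show ?case by (simp add: positive_def)
next
  case (Cons j js)
  then have j: "j \<in> {0..r}" by simp
  show ?case
  proof (cases "b = simple_affine_root j")
    case True
    then have "affine_reflection b \<circ> word (j # js) = word js"
      using j by (simp add: fun_eq_iff flip: simple_reflection_eq)
    then show ?thesis using Cons.prems(1)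
      by (metis length_Cons list.set_intros(2) subset_iff)
  next
    case False
    let ?b = "affine_action (sr j) b"
    have "positive ?b" using simple_reflection_positive Cons.prems(2,3) j False by blast
    moreover have root: "fst ?b \<in> \<Phi>" using j Cons.prems affine_action_root simple_reflection_affine by blast
    moreover have "affine_value ?b (word js base_point) < 0"
      using Cons.prems j by (simp add: affine_value_simple_action)
    ultimately obtain ks where ks: "set ks \<subseteq> {0..r}" "length js = Suc (length ks)" "affine_reflection ?b \<circ> word js = word ks"
      using Cons.IH[of ?b] Cons.prems(1) by (metis insert_subset list.simps(15))
    have "affine_reflection b (word (j # js) y) = word (j # ks) y" for y
    proof -
      have "affine_reflection b (sr j (word js y)) = sr j (sr j (affine_reflection b (sr j (word js y))))"
        using j by simp
      also have "sr j (affine_reflection b (sr j (word js y))) = affine_reflection ?b (sr j (sr j (word js y)))"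
        using affine_reflection_action[OF simple_reflection_affine[OF j] Cons.prems(2)] by simp
      also have "\<dots> = word ks y" using ks(3) j by (simp add: fun_eq_iff)
      finally show ?thesis by simp
    qed
    then show ?thesis using ks j by (intro exI[of _ "j # ks"]) auto
  qed
qed

abbreviation "len \<equiv> weyl_length r \<alpha> \<phi>"

definition reduced_word :: "nat list \<Rightarrow> bool" where
  "reduced_word js \<longleftrightarrow> set js \<subseteq> {0..r} \<and> length js = len (word js)"

lemma len_le: "set js \<subseteq> {0..r} \<Longrightarrow> len (word js) \<le> length js"
  unfolding weyl_length_def word_def by (intro Least_le) blast

lemma ex_reduced_word:
  assumes "w \<in> affine_weyl \<Phi>" shows "\<exists>js. reduced_word js \<and> word js = w"
proof -
  have "\<exists>js. length js = len w \<and> set js \<subseteq> {0..r} \<and> w = word js"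
    unfolding weyl_length_def word_def
    by (rule LeastI_ex) (use affine_weyl_word[OF assms] in \<open>unfold word_def, blast\<close>)
  then show ?thesis by (auto simp: reduced_word_def)
qed

text \<open>If \<open>w\<close> times the base point lies on the negative side of the wall \<open>j\<close>, exchange deletes a letter.\<close>

lemma len_descent:
  assumes "w \<in> affine_weyl \<Phi>" "j \<in> {0..r}" "sval j (w base_point) < 0"
  shows "len (sr j \<circ> w) < len w"
proof -
  obtain js where js: "reduced_word js" "word js = w" using ex_reduced_word[OF assms(1)] by blast
  have "\<exists>ks. set ks \<subseteq> {0..r} \<and> length js = Suc (length ks) \<and> sr j \<circ> word js = word ks"
    unfolding simple_reflection_eq
    using js assms gradient_root[OF assms(2)]
    by (intro exchange simple_positive) (auto simp: reduced_word_def affine_root_eq simple_affine_root_def)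
  then obtain ks where "set ks \<subseteq> {0..r}" "length js = Suc (length ks)" "sr j \<circ> w = word ks" using js by auto
  then show ?thesis using js len_le[of ks] by (simp add: reduced_word_def)
qed

lemma sval_regular:
  assumes "w \<in> affine_weyl \<Phi>" "j \<in> {0..r}" shows "sval j (w base_point) \<noteq> 0"
proof -
  obtain u where u: "u \<in> affine_weyl \<Phi>" "u \<circ> w = id" using affine_weyl_inverse[OF assms(1)] by blast
  let ?b = "affine_action u (simple_affine_root j)"
  have root: "fst (simple_affine_root j) \<in> \<Phi>" using gradient_root[OF assms(2)] by (simp add: simple_affine_root_def)
  have "u (w base_point) = base_point" using u by (metis comp_apply id_apply)
  then have "affine_value ?b base_point = sval j (w base_point)"
    using affine_value_action[OF u(1) root, of "w base_point"] by (simp add: affine_root_eq)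
  then show ?thesis using affine_root_regular affine_action_root[OF u(1) root] by metis
qed

lemma sval_simple_reflection_self: "j \<in> {0..r} \<Longrightarrow> sval j (sr j y) = - sval j y"
  using gradient_root[of j]
  by (simp add: affine_root_eq simple_reflection_eq affine_value_reflection)
     (simp add: simple_affine_root_def inner_coroot_self)

lemma len_descent_iff:
  assumes "w \<in> affine_weyl \<Phi>" "j \<in> {0..r}"
  shows "sval j (w base_point) < 0 \<longleftrightarrow> len (sr j \<circ> w) < len w"
proof
  assume *: "len (sr j \<circ> w) < len w"
  show "sval j (w base_point) < 0"
  proof (rule ccontr)
    assume "\<not> ?thesis"
    then have "sval j (w base_point) > 0" using sval_regular[OF assms] by simp
    then have "sval j ((sr j \<circ> w) base_point) < 0" using assms(2) by (simp add: sval_simple_reflection_self)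
    then have "len (sr j \<circ> (sr j \<circ> w)) < len (sr j \<circ> w)"
      using len_descent affine_weyl_comp[OF simple_reflection_affine[OF assms(2)] assms(1)] assms(2) by blast
    moreover have "sr j \<circ> (sr j \<circ> w) = w" using assms(2) by auto
    ultimately show False using * by simp
  qed
qed (use len_descent assms in blast)

text \<open>A point of the closed alcove is stabilised only by products of the simple reflections that fix it:
  at a descent \<open>j\<close> of a stabilising element \<open>w\<close> the affine root \<open>\<alpha>\<^sub>j \<circ> w\<close> is negative, so it is at most 0 at the
  point, where it has the same value as \<open>\<alpha>\<^sub>j\<close>.\<close>

lemma stabiliser_word:
  assumes "w \<in> affine_weyl \<Phi>" "w c = c" and c: "\<And>j. j \<in> {0..r} \<Longrightarrow> sval j c \<ge> 0"
  shows "\<exists>js. set js \<subseteq> {j\<in>{0..r}. sval j c = 0} \<and> w = word js"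
  using assms(1,2)
proof (induction "len w" arbitrary: w rule: less_induct)
  case less
  obtain js where js: "reduced_word js" "word js = w" using ex_reduced_word[OF less.prems(1)] by blast
  show ?case
  proof (cases js)
    case Nil
    then show ?thesis using js by (intro exI[of _ "[]"]) auto
  next
    case (Cons j ks)
    have j: "j \<in> {0..r}" "set ks \<subseteq> {0..r}" using js Cons by (auto simp: reduced_word_def)
    have ks: "sr j \<circ> w = word ks" using js Cons j by auto
    have "len (word ks) \<le> length ks" using len_le j by blast
    then have desc: "len (sr j \<circ> w) < len w" using js Cons by (simp add: ks reduced_word_def)
    then have neg: "sval j (w base_point) < 0" using len_descent_iff less.prems(1) j(1) by blast
    obtain u where u: "u \<in> affine_weyl \<Phi>" "u \<circ> w = id" using affine_weyl_inverse[OF less.prems(1)] by blast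
    let ?b = "affine_action u (simple_affine_root j)"
    have root: "fst (simple_affine_root j) \<in> \<Phi>" using gradient_root[OF j(1)] by (simp add: simple_affine_root_def)
    have uw: "u (w y) = y" for y using u by (metis comp_apply id_apply)
    have val: "affine_value ?b y = sval j (w y)" for y
      using affine_value_action[OF u(1) root, of "w y"] uw by (simp add: affine_root_eq)
    then have "positive (- fst ?b, - snd ?b)" using neg by (simp add: positive_def affine_value_uminus)
    then have "affine_value (- fst ?b, - snd ?b) c \<ge> 0"
      using positive_nonneg_on_alcove[OF _ _ c] root_minus affine_action_root[OF u(1) root] by simp
    then have "sval j c \<le> 0" using val[of c] less.prems(2) by (simp add: affine_value_uminus)
    then have 0: "sval j c = 0" using c j(1) by (simp add: antisym)
    then have "(sr j \<circ> w) c = c" using less.prems(2)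
      by (simp add: simple_reflection_eq affine_reflection_def affine_root_eq)
    then obtain ls where "set ls \<subseteq> {j\<in>{0..r}. sval j c = 0}" "sr j \<circ> w = word ls"
      using less.hyps[OF desc] affine_weyl_comp[OF simple_reflection_affine[OF j(1)] less.prems(1)] by blast
    moreover have "w = sr j \<circ> (sr j \<circ> w)" using j by auto
    ultimately show ?thesis using 0 j(1) by (intro exI[of _ "j # ls"]) auto
  qed
qed

end

section \<open>The torus points\<close>

lemma floor_mult_Ints: "x \<in> \<int> \<Longrightarrow> y \<in> \<int> \<Longrightarrow> \<lfloor>x * y\<rfloor> = \<lfloor>x\<rfloor> * (\<lfloor>y\<rfloor> :: int)" for x y :: real
  by (auto elim!: Ints_cases simp flip: of_int_mult)

lemma floor_minus_Ints: "x \<in> \<int> \<Longrightarrow> \<lfloor>- x\<rfloor> = - (\<lfloor>x\<rfloor> :: int)" for x :: real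
  by (auto elim!: Ints_cases simp flip: of_int_minus)

lemma of_int_floor_Ints: "x \<in> \<int> \<Longrightarrow> of_int \<lfloor>x\<rfloor> = x" for x :: real
  by (auto elim!: Ints_cases)

locale quasi_polynomial_data = root_data \<Phi> r \<alpha> \<phi>
  for \<Phi> :: "'a::euclidean_space set" and r :: nat and \<alpha> :: "nat \<Rightarrow> 'a" and \<phi> :: 'a +
  fixes q :: "'f::field_char_0" and k :: "'a \<Rightarrow> 'f" and J :: "nat set" and c :: 'a and t :: "'a \<Rightarrow> 'f"
  assumes q_nonzero: "q \<noteq> 0"
    and k_nonzero: "a \<in> \<Phi> \<Longrightarrow> k a \<noteq> 0"
    and k_norm: "a \<in> \<Phi> \<Longrightarrow> b \<in> \<Phi> \<Longrightarrow> norm a = norm b \<Longrightarrow> k a = k b"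
    and c_face: "c \<in> alcove_face \<Phi> r \<alpha> \<phi> J"
    and J_subset: "J \<subseteq> {0..r}"
    and t_face: "t \<in> torus_face q \<Phi> \<alpha> \<phi> J"
begin

lemma c_nonneg: "j \<in> {0..r} \<Longrightarrow> sval j c \<ge> 0"
proof -
  assume j: "j \<in> {0..r}"
  have c: "a \<in> positive_roots \<Phi> r \<alpha> \<Longrightarrow> 0 \<le> a \<bullet> c \<and> a \<bullet> c \<le> 1" for a
    using c_face by (auto simp: alcove_face_def closed_alcove_def)
  have "\<phi> \<in> positive_roots \<Phi> r \<alpha>" using highest_root highest_root_in_cone by (simp add: positive_roots_def)
  moreover have "\<alpha> j \<in> positive_roots \<Phi> r \<alpha>" if "j \<noteq> 0"
    using simple_roots simple_in_cone[of j] that j by (auto simp: positive_roots_def)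
  ultimately show ?thesis using c[of \<phi>] c[of "\<alpha> j"] by (auto simp: affine_root_def gradient_def)
qed

lemma root_at_c: "a \<in> \<Phi> \<Longrightarrow> \<bar>a \<bullet> c\<bar> \<le> 1"
proof -
  assume a: "a \<in> \<Phi>"
  have c: "a \<in> positive_roots \<Phi> r \<alpha> \<Longrightarrow> 0 \<le> a \<bullet> c \<and> a \<bullet> c \<le> 1" for a
    using c_face by (auto simp: alcove_face_def closed_alcove_def)
  show ?thesis using simple_base[OF a] c[of a] c[of "- a"] a root_minus by (auto simp: positive_roots_def)
qed

lemma sval_c_0_iff: "j \<in> {0..r} \<Longrightarrow> sval j c = 0 \<longleftrightarrow> j \<in> J"
  using c_face by (auto simp: alcove_face_def)

definition qpow :: "real \<Rightarrow> 'f" where "qpow x = q powi \<lfloor>x\<rfloor>"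

lemma qpow_nonzero [simp]: "qpow x \<noteq> 0"
  by (simp add: qpow_def q_nonzero)

lemma qpow_add: "x \<in> \<int> \<Longrightarrow> y \<in> \<int> \<Longrightarrow> qpow (x + y) = qpow x * qpow y"
  by (simp add: qpow_def power_int_add q_nonzero)

lemma qpow_minus: "x \<in> \<int> \<Longrightarrow> qpow (- x) = inverse (qpow x)"
  by (simp add: qpow_def floor_minus_Ints power_int_minus)

lemma qpow_0 [simp]: "qpow 0 = 1"
  by (simp add: qpow_def)

lemma q_root_nonzero [simp]: "q_root q a \<noteq> 0"
  by (simp add: q_root_def q_nonzero)

lemma q_root_powi: "a \<in> \<Phi> \<Longrightarrow> \<mu> \<in> L \<Longrightarrow> q_root q a powi \<lfloor>a \<bullet> \<mu>\<rfloor> = qpow (coroot a \<bullet> \<mu>)"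
  unfolding qpow_def q_root_def coroot_inner_lattice
  by (simp only: floor_mult_Ints[OF two_over_norm_integral root_lattice_integral] power_int_mult)

lemma torus_add: "s \<in> torus \<Phi> \<Longrightarrow> \<mu> \<in> L \<Longrightarrow> \<nu> \<in> L \<Longrightarrow> s (\<mu> + \<nu>) = s \<mu> * s \<nu>"
  and torus_nonzero: "s \<in> torus \<Phi> \<Longrightarrow> \<mu> \<in> L \<Longrightarrow> s \<mu> \<noteq> 0"
  by (auto simp: torus_def)

lemma torus_zero: "s \<in> torus \<Phi> \<Longrightarrow> s 0 = 1"
  using torus_add[of s 0 0] torus_nonzero[of s 0] by simp

lemma torus_minus: "s \<in> torus \<Phi> \<Longrightarrow> \<mu> \<in> L \<Longrightarrow> s (- \<mu>) = inverse (s \<mu>)"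
  using torus_add[of s "- \<mu>" \<mu>] torus_zero[of s] lattice_minus[of \<mu>] torus_nonzero[of s \<mu>]
  by (simp add: field_simps)

lemma torus_int_scale: "s \<in> torus \<Phi> \<Longrightarrow> \<mu> \<in> L \<Longrightarrow> s (of_int n *\<^sub>R \<mu>) = s \<mu> powi n"
proof -
  assume s: "s \<in> torus \<Phi>" and \<mu>: "\<mu> \<in> L"
  have nat: "s (of_nat m *\<^sub>R \<mu>) = s \<mu> ^ m" for m
  proof (induction m)
    case (Suc m)
    have "of_nat m *\<^sub>R \<mu> \<in> L" using lattice_int_scale[OF \<mu>, of "int m"] by simp
    then show ?case using torus_add[OF s \<mu>] Suc by (simp add: scaleR_add_left)
  qed (simp add: torus_zero s)
  show ?thesis
  proof (cases n rule: int_cases2)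
    case (nonneg m)
    then show ?thesis using nat[of m] by simp
  next
    case (nonpos m)
    have "of_nat m *\<^sub>R \<mu> \<in> L" using lattice_int_scale[OF \<mu>, of "int m"] by simp
    then show ?thesis using nat[of m] nonpos torus_minus[OF s] by (simp add: power_int_minus)
  qed
qed

lemma linear_part_inverse:
  assumes "w \<in> W" "u \<in> finite_weyl \<Phi>" "linear_part w \<circ> u = id"
  shows "inv_into UNIV (linear_part w) = u"
proof -
  obtain u' where u': "u' \<in> finite_weyl \<Phi>" "u' \<circ> linear_part w = id" "linear_part w \<circ> u' = id"
    using finite_weyl_inverse[OF linear_part_finite[OF assms(1)]] by blast
  then have "inj (linear_part w)" by (metis inj_on_id inj_on_imageI2 )
  then show ?thesis using assms(3) by (intro ext inv_f_eq) (auto simp: fun_eq_iff)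
qed


lemma torus_action_apply:
  assumes "w \<in> W" shows "torus_action q w s (linear_part w \<mu>) = qpow (w 0 \<bullet> linear_part w \<mu>) * s \<mu>"
proof -
  obtain u where u: "u \<in> finite_weyl \<Phi>" "u \<circ> linear_part w = id" "linear_part w \<circ> u = id"
    using finite_weyl_inverse[OF linear_part_finite[OF assms(1)]] by blast
  then have "inv_into UNIV (linear_part w) = u" using linear_part_inverse assms by blast
  then show ?thesis using u by (simp add: torus_action_def qpow_def fun_eq_iff)
qed

lemma lattice_linear_part_surj:
  assumes "w \<in> W" "\<mu> \<in> L" obtains \<nu> where "\<nu> \<in> L" "\<mu> = linear_part w \<nu>"
proof -
  obtain u where u: "u \<in> finite_weyl \<Phi>" "u \<circ> linear_part w = id" "linear_part w \<circ> u = id"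
    using finite_weyl_inverse[OF linear_part_finite[OF assms(1)]] by blast
  show ?thesis using that[of "u \<mu>"] u finite_weyl_lattice[OF u(1) assms(2)] by (simp add: fun_eq_iff)
qed

lemma torus_action_torus:
  assumes "w \<in> W" "s \<in> torus \<Phi>" shows "torus_action q w s \<in> torus \<Phi>"
  unfolding torus_def
proof (intro CollectI conjI ballI)
  fix \<mu> assume "\<mu> \<in> L"
  then obtain \<nu> where "\<nu> \<in> L" "\<mu> = linear_part w \<nu>" using lattice_linear_part_surj[OF assms(1)] by blast
  then show "torus_action q w s \<mu> \<noteq> 0" using assms by (simp add: torus_action_apply torus_nonzero)
next
  fix \<mu> \<mu>' assume "\<mu> \<in> L" "\<mu>' \<in> L"
  then obtain \<nu> \<nu>' where *: "\<nu> \<in> L" "\<mu> = linear_part w \<nu>" "\<nu>' \<in> L" "\<mu>' = linear_part w \<nu>'"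
    using lattice_linear_part_surj[OF assms(1)] by metis
  then have "\<mu> + \<mu>' = linear_part w (\<nu> + \<nu>')" using affine_linear[OF assms(1)] by (simp add: linear_add)
  moreover have "w 0 \<bullet> \<mu> \<in> \<int>" "w 0 \<bullet> \<mu>' \<in> \<int>"
    using \<open>\<mu> \<in> L\<close> \<open>\<mu>' \<in> L\<close> lattice_integral at_0_lattice[OF assms(1)] by blast+
  ultimately show "torus_action q w s (\<mu> + \<mu>') = torus_action q w s \<mu> * torus_action q w s \<mu>'"
    using * assms by (simp add: torus_action_apply torus_add)
      (simp add: linear_add[OF affine_linear[OF assms(1)]] inner_add_right qpow_add)
qed

lemma torus_action_comp:
  assumes "u \<in> W" "w \<in> W" "\<mu> \<in> L"
  shows "torus_action q (u \<circ> w) s \<mu> = torus_action q u (torus_action q w s) \<mu>"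
proof -
  obtain \<nu> where \<nu>: "\<nu> \<in> L" "\<mu> = linear_part (u \<circ> w) \<nu>"
    using lattice_linear_part_surj[OF affine_weyl_comp[OF assms(1,2)] assms(3)] by blast
  let ?u = "linear_part u" and ?w = "linear_part w"
  have "?w \<nu> \<in> L" using \<nu> finite_weyl_lattice linear_part_finite assms by blast
  have \<mu>: "\<mu> = ?u (?w \<nu>)" using \<nu> linear_part_comp(1)[OF assms(1)] by simp
  have i: "u 0 \<bullet> \<mu> \<in> \<int>" "w 0 \<bullet> ?w \<nu> \<in> \<int>"
    using lattice_integral at_0_lattice assms \<open>?w \<nu> \<in> L\<close> by blast+
  have "torus_action q (u \<circ> w) s \<mu> = qpow ((u 0 + ?u (w 0)) \<bullet> \<mu>) * s \<nu>"
    using torus_action_apply[OF affine_weyl_comp[OF assms(1,2)], of s \<nu>] \<nu> linear_part_comp(2)[OF assms(1), of w] by simp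
  also have "(u 0 + ?u (w 0)) \<bullet> \<mu> = u 0 \<bullet> \<mu> + w 0 \<bullet> ?w \<nu>"
    using finite_weyl_inner[OF linear_part_finite[OF assms(1)]] \<mu> by (simp add: inner_add_left)
  also have "qpow (u 0 \<bullet> \<mu> + w 0 \<bullet> ?w \<nu>) * s \<nu> = qpow (u 0 \<bullet> \<mu>) * (qpow (w 0 \<bullet> ?w \<nu>) * s \<nu>)"
    using i by (simp add: qpow_add)
  also have "\<dots> = torus_action q u (torus_action q w s) \<mu>"
    unfolding \<mu> torus_action_apply[OF assms(1)] torus_action_apply[OF assms(2)] ..
  finally show ?thesis .
qed

lemma torus_action_cong:
  assumes "w \<in> W" "\<mu> \<in> L" "\<And>\<nu>. \<nu> \<in> L \<Longrightarrow> s \<nu> = s' \<nu>"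
  shows "torus_action q w s \<mu> = torus_action q w s' \<mu>"
proof -
  obtain \<nu> where "\<nu> \<in> L" "\<mu> = linear_part w \<nu>" using lattice_linear_part_surj[OF assms(1,2)] by blast
  then show ?thesis using assms by (simp add: torus_action_apply)
qed

lemma t_torus: "t \<in> torus \<Phi>"
  using t_face by (simp add: torus_face_def)

lemma linear_part_simple: "linear_part (sr j) = reflection (grad j)"
  by (cases "j = 0")
     (auto simp: linear_part_def simple_reflection_def translation_def gradient_def reflection_neg_root)

text \<open>A simple reflection changes \<open>t\<close> only by a power of its value at the simple coroot, which is 1.\<close>

lemma t_fixed_simple:
  assumes j: "j \<in> J" and "\<mu> \<in> L"
  shows "torus_action q (sr j) t \<mu> = t \<mu>"
proof -
  have jr: "j \<in> {0..r}" using j J_subset by blast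
  let ?a = "grad j"
  have a: "?a \<in> \<Phi>" by (rule gradient_root[OF jr])
  have 1: "torus_value q \<alpha> \<phi> t j = 1" using t_face j by (simp add: torus_face_def)
  have ta: "t (coroot ?a) = (if j = 0 then inverse (q_root q \<phi>) else 1)"
    using 1 by (auto simp: torus_value_def gradient_def coroot_minus field_simps)
  have int: "of_int \<lfloor>?a \<bullet> \<mu>\<rfloor> = ?a \<bullet> \<mu>" using root_lattice_integral[OF a assms(2)] by (rule of_int_floor_Ints)
  have "torus_action q (sr j) t (linear_part (sr j) (reflection ?a \<mu>)) = qpow (sr j 0 \<bullet> \<mu>) * t (reflection ?a \<mu>)"
    by (subst torus_action_apply[OF simple_reflection_affine[OF jr]]) (simp add: linear_part_simple)
  then have "torus_action q (sr j) t \<mu> = qpow (sr j 0 \<bullet> \<mu>) * t (reflection ?a \<mu>)"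
    by (simp add: linear_part_simple)
  also have "reflection ?a \<mu> = \<mu> + of_int (- \<lfloor>?a \<bullet> \<mu>\<rfloor>) *\<^sub>R coroot ?a"
    unfolding reflection_def of_int_minus int by simp
  also have "t \<dots> = t \<mu> * t (coroot ?a) powi (- \<lfloor>?a \<bullet> \<mu>\<rfloor>)"
    using torus_add[OF t_torus assms(2) lattice_int_scale[OF lattice_coroot[OF a]]]
      torus_int_scale[OF t_torus lattice_coroot[OF a]] by metis
  also have "qpow (sr j 0 \<bullet> \<mu>) * (t \<mu> * t (coroot ?a) powi (- \<lfloor>?a \<bullet> \<mu>\<rfloor>)) = t \<mu>"
  proof (cases "j = 0")
    case True
    have "\<phi> \<bullet> \<mu> \<in> \<int>" using highest_root assms(2) root_lattice_integral by blast
    then have "t (coroot ?a) powi (- \<lfloor>?a \<bullet> \<mu>\<rfloor>) = inverse (qpow (coroot \<phi> \<bullet> \<mu>))"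
      using ta True q_root_powi[OF highest_root assms(2)]
      by (simp add: gradient_def floor_minus_Ints power_int_inverse)
    moreover have "sr j 0 = coroot \<phi>" using True by (simp add: simple_reflection_def translation_def)
    ultimately show ?thesis by simp
  next
    case False
    then show ?thesis using ta by (simp add: simple_reflection_def)
  qed
  finally show ?thesis .
qed

text \<open>The stabiliser of \<open>c\<close> is generated by the simple reflections fixing \<open>c\<close>.\<close>

lemma t_fixed_stabiliser:
  assumes "w \<in> W" "w c = c" "\<mu> \<in> L"
  shows "torus_action q w t \<mu> = t \<mu>"
proof -
  obtain js where js: "set js \<subseteq> {j\<in>{0..r}. sval j c = 0}" "w = word js"
    using stabiliser_word[OF assms(1,2) c_nonneg] by blast
  have "torus_action q (word js) t \<mu> = t \<mu>" if "set js \<subseteq> {j\<in>{0..r}. sval j c = 0}" "\<mu> \<in> L" for \<mu> js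
    using that
  proof (induction js arbitrary: \<mu>)
    case Nil
    then show ?case using torus_action_apply[OF affine_weyl_id, of t \<mu>] by (simp add: id_def linear_part_def)
  next
    case (Cons j js)
    then have j: "j \<in> {0..r}" "j \<in> J" using sval_c_0_iff by auto
    have "set js \<subseteq> {0..r}" using Cons.prems(1) by auto
    then have j3: "word js \<in> W" by (rule word_affine)
    have "torus_action q (word (j # js)) t \<mu> = torus_action q (sr j) (torus_action q (word js) t) \<mu>"
      unfolding word_simps using torus_action_comp[OF simple_reflection_affine[OF j(1)] j3] Cons.prems by blast
    also have "\<dots> = torus_action q (sr j) t \<mu>"
      using Cons by (intro torus_action_cong simple_reflection_affine j) auto
    also have "\<dots> = t \<mu>" using t_fixed_simple j Cons.prems by blast
    finally show ?case .
  qed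
  then show ?thesis using js assms(3) by blast
qed

abbreviation (input) "Orb \<equiv> weyl_orbit \<Phi> c"
abbreviation "tp \<equiv> torus_point q \<Phi> r \<alpha> \<phi> c t"

text \<open>Any element carrying \<open>c\<close> to \<open>y\<close> may replace the shortest one in the definition of \<open>t\<^sub>y\<close>.\<close>

lemma torus_point_eq:
  assumes "w \<in> W" "\<mu> \<in> L" shows "tp (w c) \<mu> = torus_action q w t \<mu>"
proof -
  let ?s = "shortest_to \<Phi> r \<alpha> \<phi> c (w c)"
  have s: "?s \<in> W \<and> ?s c = w c"
    unfolding shortest_to_def by (rule arg_min_natI[where k = w]) (use assms in simp)
  obtain u where u: "u \<in> W" "u \<circ> w = id" "w \<circ> u = id" using affine_weyl_inverse[OF assms(1)] by blast
  have us: "u \<circ> ?s \<in> W" using affine_weyl_comp u s by blast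
  have "(u \<circ> ?s) c = c" using u s by (metis comp_apply id_apply)
  then have fixed: "torus_action q (u \<circ> ?s) t \<nu> = t \<nu>" if "\<nu> \<in> L" for \<nu>
    using t_fixed_stabiliser us that by blast
  have "?s = w \<circ> (u \<circ> ?s)" using u by (metis comp_assoc id_comp)
  then have "torus_action q ?s t \<mu> = torus_action q w (torus_action q (u \<circ> ?s) t) \<mu>"
    using torus_action_comp[OF assms(1) us assms(2)] by metis
  also have "\<dots> = torus_action q w t \<mu>" using fixed by (intro torus_action_cong assms)
  finally show ?thesis by (simp add: torus_point_def)
qed

lemma orbitE: assumes "y \<in> Orb" obtains w where "w \<in> W" "y = w c"
  using assms by (auto simp: weyl_orbit_def)

lemma orbit_closed: "w \<in> W \<Longrightarrow> y \<in> Orb \<Longrightarrow> w y \<in> Orb"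
  by (auto simp: weyl_orbit_def) (metis affine_weyl_comp comp_apply imageI)

lemma orbit_linear: "w \<in> W \<Longrightarrow> y \<in> Orb \<Longrightarrow> linear_part w y \<in> Orb"
  using orbit_closed finite_in_affine linear_part_finite by blast

lemma orbit_translate: "\<mu> \<in> L \<Longrightarrow> y \<in> Orb \<Longrightarrow> \<mu> + y \<in> Orb"
  using orbit_closed[OF translation_in_affine] by (simp add: translation_def add.commute)

lemma torus_point_action:
  assumes "u \<in> W" "y \<in> Orb" "\<mu> \<in> L" shows "tp (u y) \<mu> = torus_action q u (tp y) \<mu>"
proof -
  obtain w where w: "w \<in> W" "y = w c" using assms(2) orbitE by blast
  have "tp (u y) \<mu> = torus_action q (u \<circ> w) t \<mu>"
    using torus_point_eq[OF affine_weyl_comp[OF assms(1) w(1)] assms(3)] w by simp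
  also have "\<dots> = torus_action q u (torus_action q w t) \<mu>" using torus_action_comp assms w by blast
  also have "\<dots> = torus_action q u (tp y) \<mu>"
    using torus_point_eq[OF w(1)] w by (intro torus_action_cong assms) auto
  finally show ?thesis .
qed

lemma torus_point_torus: "y \<in> Orb \<Longrightarrow> tp y \<in> torus \<Phi>"
proof -
  assume "y \<in> Orb"
  then obtain w where w: "w \<in> W" "y = w c" using orbitE by blast
  have "torus_action q w t \<in> torus \<Phi>" using torus_action_torus t_torus w by blast
  then show ?thesis using torus_point_eq[OF w(1)] w lattice_add by (simp add: torus_def)
qed

lemma torus_point_linear:
  assumes "v \<in> finite_weyl \<Phi>" "y \<in> Orb" "\<mu> \<in> L" shows "tp (v y) (v \<mu>) = tp y \<mu>"
proof -
  have v: "v \<in> W" "linear_part v = v" "v 0 = 0"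
    using assms finite_in_affine linear_part_linear finite_weyl_linear linear_0 by blast+
  then show ?thesis
    using torus_point_action[OF v(1) assms(2), of "v \<mu>"] torus_action_apply[OF v(1), of "tp y" \<mu>] finite_weyl_lattice assms by simp
qed

lemma torus_point_translate:
  assumes "y \<in> Orb" "\<mu> \<in> L" "\<nu> \<in> L" shows "tp (\<nu> + y) \<mu> = qpow (\<nu> \<bullet> \<mu>) * tp y \<mu>"
  using torus_point_action[OF translation_in_affine[OF assms(3)] assms(1,2)]
    torus_action_apply[OF translation_in_affine[OF assms(3)], of "tp y" \<mu>]
  by (simp add: translation_def add.commute)

text \<open>The value of a torus element at the coroot of an affine root, which for \<open>\<alpha>\<^sub>0\<close> is the given
  convention.  It is the pairing that is invariant under \<open>W\<close>.\<close>

definition affine_coroot_value :: "('a \<Rightarrow> 'f) \<Rightarrow> 'a \<times> int \<Rightarrow> 'f" where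
  "affine_coroot_value s b = q_root q (fst b) powi snd b * s (coroot (fst b))"

lemma affine_coroot_value_action:
  assumes "w \<in> W" "fst b \<in> \<Phi>"
  shows "affine_coroot_value (torus_action q w s) (affine_action w b) = affine_coroot_value s b"
proof -
  let ?v = "linear_part w" and ?a = "fst b"
  have v: "?v \<in> finite_weyl \<Phi>" "w 0 \<in> L" using linear_part_finite at_0_lattice assms by blast+
  have va: "?v ?a \<in> \<Phi>" using finite_weyl_root v assms by blast
  have "q_root q (?v ?a) = q_root q ?a" by (simp add: q_root_def finite_weyl_norm v)
  moreover have "coroot (?v ?a) \<bullet> w 0 = w 0 \<bullet> ?v (coroot ?a)" using finite_weyl_coroot[OF v(1)] by (simp add: inner_commute)
  ultimately show ?thesis
    using q_root_powi[OF va v(2)] finite_weyl_coroot[OF v(1), of ?a] torus_action_apply[OF assms(1), of s "coroot ?a"]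
    by (simp add: affine_coroot_value_def affine_action_def power_int_diff)
qed

text \<open>By induction on the height the simple affine roots vanishing at \<open>c\<close> suffice, and for these the
  claim is \<open>t \<in> T\<^sub>J\<close>.\<close>

lemma affine_coroot_value_vanishing:
  assumes "fst b \<in> \<Phi>" "affine_value b c = 0"
  shows "affine_coroot_value t b = 1"
proof -
  have *: "affine_coroot_value t b = 1" if "fst b \<in> \<Phi>" "positive b" "affine_value b c = 0" for b
    using that(1,2)
  proof (induction rule: positive_root_induct[where C = True and x = c])
    case (simple j)
    then have "j \<in> J" using sval_c_0_iff by (simp add: affine_root_eq)
    then have "torus_value q \<alpha> \<phi> t j = 1" using t_face by (simp add: torus_face_def)
    then show ?case
      by (auto simp: torus_value_def affine_coroot_value_def simple_affine_root_def gradient_def q_root_def coroot_minus split: if_splits)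
  next
    case (reflect b j)
    then have j: "j \<in> J" using sval_c_0_iff by simp
    let ?b = "affine_action (sr j) b"
    have "affine_coroot_value t b = affine_coroot_value (torus_action q (sr j) t) ?b"
      using affine_coroot_value_action[OF simple_reflection_affine[OF reflect(3)] reflect(1)] by simp
    also have "\<dots> = affine_coroot_value t ?b"
      using t_fixed_simple[OF j] lattice_coroot affine_action_root[OF simple_reflection_affine[OF reflect(3)] reflect(1)]
      by (simp add: affine_coroot_value_def)
    finally show ?case using reflect by simp
  qed (use that c_nonneg in auto)
  show ?thesis
  proof (cases "positive b")
    case False
    let ?b = "(- fst b, - snd b)"
    have "positive ?b" using False positive_or_negative assms by blast
    then have "affine_coroot_value t ?b = 1" using *[of ?b] assms root_minus by (simp add: affine_value_uminus)
    then show ?thesis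
      using torus_minus[OF t_torus lattice_coroot[OF assms(1)]] torus_nonzero[OF t_torus lattice_coroot[OF assms(1)]]
      by (simp add: affine_coroot_value_def q_root_def coroot_minus power_int_minus field_simps)
  qed (use * assms in blast)
qed

lemma torus_point_vanishing:
  assumes "y \<in> Orb" "fst b \<in> \<Phi>" "affine_value b y = 0"
  shows "affine_coroot_value (tp y) b = 1"
proof -
  obtain w where w: "w \<in> W" "y = w c" using assms(1) orbitE by blast
  obtain u where u: "u \<in> W" "u \<circ> w = id" "w \<circ> u = id" using affine_weyl_inverse[OF w(1)] by blast
  have uw: "u (w x) = x" for x using u(2) by (metis comp_apply id_apply)
  let ?b = "affine_action u b"
  have root: "fst ?b \<in> \<Phi>" using affine_action_root u assms by blast
  have "affine_value ?b c = 0" using affine_value_action[OF u(1) assms(2), of y] w(2) uw assms(3) by simp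
  then have "affine_coroot_value t ?b = 1" using affine_coroot_value_vanishing root by blast
  moreover have "affine_coroot_value t ?b = affine_coroot_value (torus_action q u (tp y)) ?b"
    using torus_point_action[OF u(1) assms(1) lattice_coroot[OF root]] torus_point_eq[OF affine_weyl_id lattice_coroot[OF root]]
      torus_action_apply[OF affine_weyl_id, of t "coroot (fst ?b)"] w(2) uw
    by (simp add: affine_coroot_value_def)
  ultimately show ?thesis using affine_coroot_value_action[OF u(1) assms(2)] by simp
qed

lemma torus_point_highest_root:
  assumes "y \<in> Orb" "\<phi> \<bullet> y = of_int n"
  shows "tp y (coroot \<phi>) = q_root q \<phi> powi n"
  using torus_point_vanishing[OF assms(1), of "(\<phi>, - n)"] assms highest_root
  by (simp add: affine_value_def affine_coroot_value_def power_int_minus field_simps)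

end

section \<open>Pairs of simple reflections\<close>

fun alternating :: "nat \<Rightarrow> nat \<Rightarrow> nat \<Rightarrow> nat list" where
  "alternating i j 0 = []"
| "alternating i j (Suc n) = i # alternating j i n"

lemma alternating_numeral [simp]: "alternating i j (numeral n) = i # alternating j i (pred_numeral n)"
  by (simp add: numeral_eq_Suc)

lemma length_alternating [simp]: "length (alternating i j n) = n"
  by (induction i j n rule: alternating.induct) auto

lemma set_alternating: "set (alternating i j n) \<subseteq> {i, j}"
  by (induction i j n rule: alternating.induct) auto

context root_data
begin

text \<open>Minus the Cartan integers of two simple affine roots, with the order \<open>m\<close> of the product of
  their reflections.\<close>

definition bond :: "nat \<Rightarrow> nat \<Rightarrow> nat \<Rightarrow> bool" where
  "bond i j m \<longleftrightarrow> i \<in> {0..r} \<and> j \<in> {0..r} \<and>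
     (- (grad j \<bullet> coroot (grad i)), - (grad i \<bullet> coroot (grad j)), m) \<in>
       {(0, 0, 2), (1, 1, 3), (1, 2, 4), (2, 1, 4), (1, 3, 6), (3, 1, 6)}"

lemma bond_sym: "bond i j m \<Longrightarrow> bond j i m"
  by (auto simp: bond_def)

lemma bond_cases:
  assumes "bond i j m"
  obtains N M where "grad j \<bullet> coroot (grad i) = - N" "grad i \<bullet> coroot (grad j) = - M"
    "(N, M, m) \<in> {(0, 0, 2), (1, 1, 3), (1, 2, 4), (2, 1, 4), (1, 3, 6), (3, 1, 6)}"
  using assms that[of "- (grad j \<bullet> coroot (grad i))" "- (grad i \<bullet> coroot (grad j))"] by (simp add: bond_def)

lemma simple_affine_root_neq:
  assumes "i \<in> {0..r}" "j \<in> {0..r}" "i \<noteq> j"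
  shows "simple_affine_root i \<noteq> simple_affine_root j"
proof -
  obtain x where x: "sval i x = 0" "\<forall>k\<in>{0..r} - {i}. sval k x > 0" using ex_wall_point[OF assms(1)] by blast
  then have "sval i x \<noteq> sval j x" using assms by force
  then show ?thesis unfolding affine_root_eq by metis
qed

text \<open>If the angle were acute, reflecting one simple affine root in the other would give an affine
  root with coefficients of both signs.\<close>

lemma simple_obtuse:
  assumes i: "i \<in> {0..r}" and j: "j \<in> {0..r}" and ne: "i \<noteq> j"
  shows "grad i \<bullet> grad j \<le> 0"
proof (rule ccontr)
  assume "\<not> ?thesis"
  then have pos: "grad i \<bullet> coroot (grad j) > 0" using gradient_root[OF j] by (simp add: coroot_def)
  obtain x where x: "sval i x = 0" "\<forall>k\<in>{0..r} - {i}. sval k x > 0" using ex_wall_point[OF i] by blast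
  let ?b = "simple_affine_root i"
  have root: "fst ?b \<in> \<Phi>" using gradient_root[OF i] by (simp add: simple_affine_root_def)
  have "positive (affine_action (sr j) ?b)"
    using simple_reflection_positive[OF root simple_positive[OF i] j] simple_affine_root_neq[OF i j ne] by blast
  then have "affine_value (affine_action (sr j) ?b) x \<ge> 0"
  proof (rule positive_nonneg_on_alcove[rotated])
    show "sval k x \<ge> 0" if "k \<in> {0..r}" for k
      using x that by (cases "k = i") (auto intro: less_imp_le)
  qed (use affine_action_root[OF simple_reflection_affine[OF j] root] in simp)
  moreover have "affine_value (affine_action (sr j) ?b) x = - sval j x * (grad i \<bullet> coroot (grad j))"
    unfolding affine_value_simple_action[OF j root] affine_value_simple_reflection
    using x(1) by (simp add: affine_root_eq) (simp add: simple_affine_root_def)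
  moreover have "sval j x > 0" using x j ne by blast
  ultimately show False using pos by (simp add: mult_le_0_iff)
qed

text \<open>
  By Cauchy--Schwarz the product of the two Cartan integers is less than 4 unless the gradients
  are proportional, that is, opposite.  The latter happens only in rank one, where the product of
  the two reflections has infinite order.
\<close>

lemma bond_or_opposite:
  assumes i: "i \<in> {0..r}" and j: "j \<in> {0..r}" and ne: "i \<noteq> j"
  shows "(\<exists>m. bond i j m) \<or> grad i = - grad j"
proof (cases "grad i = - grad j")
  case False
  let ?a = "grad i" and ?b = "grad j"
  have a: "?a \<in> \<Phi>" and b: "?b \<in> \<Phi>" using gradient_root i j by auto
  obtain x y :: int where x: "?b \<bullet> coroot ?a = of_int x" and y: "?a \<bullet> coroot ?b = of_int y"
    using integral[OF a b] integral[OF b a] by (metis Ints_cases)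
  let ?A = "?a \<bullet> ?a" and ?B = "?b \<bullet> ?b"
  have pos: "?A > 0" "?B > 0" using a b by auto
  have xv: "of_int x = 2 * (?a \<bullet> ?b) / ?A" and yv: "of_int y = 2 * (?a \<bullet> ?b) / ?B"
    using x y by (simp_all add: coroot_def power2_norm_eq_inner inner_commute)
  have "of_int x \<le> (0::real)" "of_int y \<le> (0::real)"
    unfolding xv yv using pos simple_obtuse[OF i j ne] by (simp_all add: divide_nonpos_pos)
  then have le: "x \<le> 0" "y \<le> 0" by simp_all
  have zero: "x = 0 \<longleftrightarrow> y = 0"
  proof -
    have "of_int x = (0::real) \<longleftrightarrow> of_int y = (0::real)" unfolding xv yv using pos by simp
    then show ?thesis by simp
  qed
  have "(?a \<bullet> ?b)\<^sup>2 < ?A * ?B"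
  proof (rule ccontr)
    assume "\<not> ?thesis"
    then have eq: "(?a \<bullet> ?b)\<^sup>2 = ?A * ?B" using Cauchy_Schwarz_ineq[of ?a ?b] by simp
    let ?z = "?B *\<^sub>R ?a - (?a \<bullet> ?b) *\<^sub>R ?b"
    have "?z \<bullet> ?z = ?B * ?B * ?A - ?B * (?a \<bullet> ?b)\<^sup>2"
      by (simp add: inner_diff_left inner_diff_right inner_commute[of ?b ?a] power2_eq_square algebra_simps)
    then have "?z = 0" using eq by simp
    then have "?a = ((?a \<bullet> ?b) / ?B) *\<^sub>R ?b" using pos
      by (metis (no_types, lifting) divide_inverse_commute eq_iff_diff_eq_0 less_irrefl real_vector_affinity_eq
          scaleR_scaleR scaleR_one left_inverse)
    then obtain s where s: "?a = s *\<^sub>R ?b" by blast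
    then have "s = 1 \<or> s = -1" using reduced[OF b, of s] a by simp
    then have "s = 1" using False s by auto
    then show False using simple_obtuse[OF i j ne] s pos by simp
  qed
  then have "real_of_int (x * y) < 4"
  proof -
    have "real_of_int (x * y) * (?A * ?B) = 4 * (?a \<bullet> ?b)\<^sup>2"
      using pos by (simp add: xv yv power2_eq_square)
    also have "\<dots> < 4 * (?A * ?B)" using \<open>(?a \<bullet> ?b)\<^sup>2 < ?A * ?B\<close> by simp
    finally show ?thesis using pos by (simp add: mult_less_cancel_right)
  qed
  then have lt: "(- x) * (- y) < 4" by linarith
  have "(- x, - y) \<in> {(0, 0), (1, 1), (1, 2), (2, 1), (1, 3), (3, 1)}"
  proof (cases "x = 0")
    case True
    then show ?thesis using zero by simp
  next
    case False
    define X Y where "X = - x" and "Y = - y"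
    have X: "X \<ge> 1" "Y \<ge> 1" "X * Y < 4" using False zero le lt by (auto simp: X_def Y_def)
    have "X * 1 \<le> X * Y" "1 * Y \<le> X * Y" using X by (auto intro: mult_left_mono mult_right_mono)
    then have "X \<le> 3" "Y \<le> 3" using X by linarith+
    then have "X = 1 \<or> X = 2 \<or> X = 3" "Y = 1 \<or> Y = 2 \<or> Y = 3" using X by linarith+
    then have "(X, Y) \<in> {(1, 1), (1, 2), (2, 1), (1, 3), (3, 1)}" using X(3) by auto
    then show ?thesis by (simp add: X_def Y_def)
  qed
  then have "(- real_of_int x, - real_of_int y) \<in> {(0, 0), (1, 1), (1, 2), (2, 1), (1, 3), (3, 1)}"
    by (auto simp: minus_equation_iff)
  then have "\<exists>m. bond i j m" unfolding bond_def x y using i j by auto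
  then show ?thesis ..
qed simp

text \<open>In that case the two simple affine roots have a constant nonnegative sum.\<close>

lemma opposite_not_both_negative:
  assumes "i \<in> {0..r}" "j \<in> {0..r}" "grad i = - grad j"
  shows "\<not> (sval i y < 0 \<and> sval j y < 0)"
proof -
  have sum: "sval i z + sval j z = (if i = 0 then 1 else 0) + (if j = 0 then 1 else 0)" for z
    using assms(3) by (simp add: affine_root_def)
  have "sval i y + sval j y \<ge> 0" unfolding sum by simp
  then show ?thesis by linarith
qed

lemma sval_simple_reflection:
  "sval i (sr j y) = sval i y - sval j y * (grad i \<bullet> coroot (grad j))"
  using affine_value_simple_reflection[of "simple_affine_root i" j y]
  by (simp add: affine_root_eq simple_affine_root_def)

lemma simple_reflection_apply: "sr j y = y - sval j y *\<^sub>R coroot (grad j)"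
  by (simp add: simple_reflection_eq affine_reflection_def affine_root_eq)
     (simp add: simple_affine_root_def)

lemma word_braid:
  assumes "bond i j m" shows "word (alternating i j m) = word (alternating j i m)"
proof
  fix y
  obtain N M where NM: "grad j \<bullet> coroot (grad i) = - N" "grad i \<bullet> coroot (grad j) = - M"
    "(N, M, m) \<in> {(0, 0, 2), (1, 1, 3), (1, 2, 4), (2, 1, 4), (1, 3, 6), (3, 1, 6)}"
    using bond_cases[OF assms] by blast
  have ij: "i \<in> {0..r}" "j \<in> {0..r}" using assms by (auto simp: bond_def)
  have two: "(2 * u) *\<^sub>R x = u *\<^sub>R x + u *\<^sub>R x" for u :: real and x :: 'a
    by (simp flip: scaleR_add_left)
  \<comment> \<open>In these coordinates both reflections are affine maps of the plane.\<close>
  define P where "P u v = y - u *\<^sub>R coroot (grad i) - v *\<^sub>R coroot (grad j)" for u v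
  have i: "sr i (P u v) = P (sval i y - u + M * v) v" for u v
  proof -
    have "sval i (P u v) = sval i y - u - u + M * v"
      using NM gradient_root[OF ij(1)] by (simp add: P_def affine_root_def inner_diff_right inner_coroot_self)
    then show ?thesis
      by (simp add: simple_reflection_apply[of i "P u v"])
        (simp add: P_def scaleR_left_diff_distrib scaleR_left_distrib two)
  qed
  have j: "sr j (P u v) = P u (sval j y - v + N * u)" for u v
  proof -
    have "sval j (P u v) = sval j y - v - v + N * u"
      using NM gradient_root[OF ij(2)] by (simp add: P_def affine_root_def inner_diff_right inner_coroot_self)
    then show ?thesis
      by (simp add: simple_reflection_apply[of j "P u v"])
        (simp add: P_def scaleR_left_diff_distrib scaleR_left_distrib two)
  qed
  have y: "y = P 0 0" by (simp add: P_def)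
  show "word (alternating i j m) y = word (alternating j i m) y"
    unfolding y using NM(3) by (auto simp: i j algebra_simps)
qed

lemma word_rev': "set js \<subseteq> {0..r} \<Longrightarrow> word js (word (rev js) y) = y"
  using word_rev[of "rev js" y] by simp

lemma word_rev_braid:
  assumes "bond i j m" shows "word (rev (alternating i j m)) = word (rev (alternating j i m))"
proof
  fix y
  have "i \<in> {0..r}" "j \<in> {0..r}" using assms by (auto simp: bond_def)
  then have s: "set (alternating i j m) \<subseteq> {0..r}" "set (alternating j i m) \<subseteq> {0..r}"
    using set_alternating[of i j m] set_alternating[of j i m] by blast+
  have "word (rev (alternating i j m)) y =
      word (rev (alternating i j m)) (word (alternating i j m) (word (rev (alternating j i m)) y))"
    unfolding word_braid[OF assms] word_rev'[OF s(2)] ..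
  also have "\<dots> = word (rev (alternating j i m)) y" by (rule word_rev[OF s(1)])
  finally show "word (rev (alternating i j m)) y = word (rev (alternating j i m)) y" .
qed

text \<open>Every letter of the word, applied in turn from the left, crosses its wall to the positive side.\<close>

fun descending :: "nat list \<Rightarrow> 'a \<Rightarrow> bool" where
  "descending [] y \<longleftrightarrow> True"
| "descending (j # js) y \<longleftrightarrow> sval j y < 0 \<and> descending js (sr j y)"

lemma descending_alternating:
  assumes "bond i j m" "sval i y < 0" "sval j y < 0"
  shows "descending (alternating i j m) y"
proof -
  obtain N M where NM: "grad j \<bullet> coroot (grad i) = - N" "grad i \<bullet> coroot (grad j) = - M"
    "(N, M, m) \<in> {(0, 0, 2), (1, 1, 3), (1, 2, 4), (2, 1, 4), (1, 3, 6), (3, 1, 6)}"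
    using bond_cases[OF assms(1)] by blast
  have ij: "i \<in> {0..r}" "j \<in> {0..r}" using assms by (auto simp: bond_def)
  have *: "sval i (sr i y) = - sval i y" "sval j (sr j y) = - sval j y"
    "sval j (sr i y) = sval j y + sval i y * N" "sval i (sr j y) = sval i y + sval j y * M" for y
    using NM ij by (simp_all add: sval_simple_reflection_self) (simp_all add: sval_simple_reflection)
  show ?thesis using NM(3) assms(2,3) by (auto simp: *)
qed

lemma len_descending:
  assumes "w \<in> affine_weyl \<Phi>" "set js \<subseteq> {0..r}" "descending js (w base_point)"
  shows "len (word (rev js) \<circ> w) + length js \<le> len w"
  using assms
proof (induction js arbitrary: w)
  case Nil
  then show ?case by (simp add: comp_def)
next
  case (Cons j js)
  have j: "j \<in> {0..r}" using Cons.prems by simp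
  have "len (word (rev js) \<circ> (sr j \<circ> w)) + length js \<le> len (sr j \<circ> w)"
    using Cons.prems by (intro Cons.IH affine_weyl_comp simple_reflection_affine) auto
  moreover have "len (sr j \<circ> w) < len w" using len_descent[OF Cons.prems(1) j] Cons.prems(3) by simp
  moreover have *: "word (rev (j # js)) \<circ> w = word (rev js) \<circ> (sr j \<circ> w)" by (auto simp: word_append)
  ultimately show ?case unfolding list.size * by linarith
qed

section \<open>From braid relations to an action of the affine Weyl group\<close>

lemma reduced_word_tail:
  assumes "reduced_word (j # js)" shows "reduced_word js"
proof -
  have s: "set js \<subseteq> {0..r}" "j \<in> {0..r}" using assms by (auto simp: reduced_word_def)
  obtain ks where ks: "reduced_word ks" "word ks = word js" using ex_reduced_word[OF word_affine[OF s(1)]] by blast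
  have "word (j # ks) = word (j # js)" using ks(2) by simp
  then have "len (word (j # js)) \<le> Suc (length ks)"
    using len_le[of "j # ks"] ks s by (simp add: reduced_word_def del: word_simps)
  then have "length js \<le> len (word js)" using assms ks by (simp add: reduced_word_def del: word_simps)
  then show ?thesis using len_le[OF s(1)] s by (simp add: reduced_word_def)
qed

lemma reduced_word_head_descent:
  assumes "reduced_word (j # js)" shows "sval j (word (j # js) base_point) < 0"
proof -
  have s: "set js \<subseteq> {0..r}" "j \<in> {0..r}" using assms by (auto simp: reduced_word_def)
  have W: "word (j # js) \<in> affine_weyl \<Phi>" using s by (intro word_affine) auto
  have "sr j \<circ> word (j # js) = word js" using s(2) by (auto simp: fun_eq_iff)
  then have "len (sr j \<circ> word (j # js)) < len (word (j # js))"
    using assms reduced_word_tail[OF assms] by (simp add: reduced_word_def del: word_simps)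
  then show ?thesis using len_descent_iff[OF W s(2)] by blast
qed

text \<open>Operators satisfying the relations of the simple reflections; the braid relations come first, as
  they alone make the operator of a reduced word well defined.\<close>

context
  fixes S :: "nat \<Rightarrow> 'b \<Rightarrow> 'b" and D :: "'b set"
  assumes closed: "\<And>j x. j \<in> {0..r} \<Longrightarrow> x \<in> D \<Longrightarrow> S j x \<in> D"
    and braid: "\<And>i j m x. bond i j m \<Longrightarrow> x \<in> D \<Longrightarrow> foldr S (alternating i j m) x = foldr S (alternating j i m) x"
begin

lemma operators_closed: "set js \<subseteq> {0..r} \<Longrightarrow> x \<in> D \<Longrightarrow> foldr S js x \<in> D"
  by (induction js) (auto intro: closed)

text \<open>Matsumoto's theorem.  If two reduced words of \<open>w\<close> start with different letters \<open>i\<close> and \<open>j\<close>,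
  both are descents of \<open>w\<close>; then \<open>w\<close> also has reduced words starting with the two alternating words
  of length \<open>m\<close> and continuing equally, to which the braid relation applies.\<close>

lemma reduced_words_same_operator:
  assumes "reduced_word js" "reduced_word ks" "word js = word ks" "x \<in> D"
  shows "foldr S js x = foldr S ks x"
  using assms(1-3)
proof (induction "length js" arbitrary: js ks rule: less_induct)
  case less
  have len_eq: "length js = length ks" using less.prems by (simp add: reduced_word_def)
  show ?case
  proof (cases js)
    case Nil
    then show ?thesis using len_eq by simp
  next
    case (Cons i js')
    then obtain j ks' where ks: "ks = j # ks'" using len_eq by (cases ks) auto
    have ij: "i \<in> {0..r}" "j \<in> {0..r}" using less.prems Cons ks by (auto simp: reduced_word_def)
    have red: "reduced_word js'" "reduced_word ks'" using less.prems Cons ks reduced_word_tail by blast+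
    show ?thesis
    proof (cases "i = j")
      case True
      have "word js' y = word ks' y" for y
      proof -
        have "sr i (word js' y) = sr i (word ks' y)" using fun_cong[OF less.prems(3), of y] Cons ks True by simp
        then show ?thesis using simple_reflection_involution[OF ij(1)] by metis
      qed
      then have "foldr S js' x = foldr S ks' x" using less.hyps[of js' ks'] Cons red by auto
      then show ?thesis using Cons ks True by simp
    next
      case False
      define w where "w = word js"
      have W: "w \<in> affine_weyl \<Phi>" unfolding w_def using less.prems(1) by (intro word_affine) (simp add: reduced_word_def)
      have desc: "sval i (w base_point) < 0"
        using reduced_word_head_descent[of i js'] less.prems(1) unfolding w_def Cons .
      have desc': "sval j (w base_point) < 0"
        using reduced_word_head_descent[of j ks'] less.prems(2) unfolding w_def less.prems(3) unfolding ks .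
      from desc desc' obtain m where m: "bond i j m"
        using bond_or_opposite[OF ij False] opposite_not_both_negative[OF ij] by blast
      let ?a = "alternating i j m" and ?b = "alternating j i m"
      have s: "set ?a \<subseteq> {0..r}" "set ?b \<subseteq> {0..r}"
        using ij set_alternating[of i j m] set_alternating[of j i m] by blast+
      define v where "v = word (rev ?a) \<circ> w"
      have vb: "v = word (rev ?b) \<circ> w" by (simp add: v_def word_rev_braid[OF m])
      have V: "v \<in> affine_weyl \<Phi>" unfolding v_def using s W by (intro affine_weyl_comp word_affine) auto
      have "len v + m \<le> len w" unfolding v_def
        using len_descending[OF W s(1) descending_alternating[OF m desc desc']] by simp
      obtain vs where vs: "reduced_word vs" "word vs = v" using ex_reduced_word[OF V] by blast
      have "word (?a @ vs) = w" "word (?b @ vs) = w"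
        using vs(2) word_rev'[OF s(1)] word_rev'[OF s(2)]
        by (auto simp: word_append fun_eq_iff v_def) (auto simp: word_rev_braid[OF m])
      moreover have "length (?a @ vs) \<le> len w" "length (?b @ vs) \<le> len w"
        using \<open>len v + m \<le> len w\<close> vs by (simp_all add: reduced_word_def)
      ultimately have ra: "reduced_word (?a @ vs)" "word (?a @ vs) = w" and rb: "reduced_word (?b @ vs)" "word (?b @ vs) = w"
        using len_le[of "?a @ vs"] len_le[of "?b @ vs"] s vs by (auto simp: reduced_word_def)
      obtain n where n: "m = Suc n" using m by (auto simp: bond_def)
      have same_tail: "foldr S us x = foldr S us' x"
        if "reduced_word (l # us)" "reduced_word (l # us')" "word (l # us) = w" "word (l # us') = w" for l us us'
      proof -
        have l: "l \<in> {0..r}" using that by (simp add: reduced_word_def)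
        have "word us y = word us' y" for y
        proof -
          have "sr l (word us y) = sr l (word us' y)" using that fun_cong[of _ _ y] by (metis comp_apply word_simps(2))
          then show ?thesis using simple_reflection_involution[OF l] by metis
        qed
        then have eq: "word us = word us'" by blast
        have "length us < length js"
          using that less.prems(1) by (simp add: reduced_word_def w_def)
        then show ?thesis using less.hyps[of us us'] that eq reduced_word_tail by blast
      qed
      have "foldr S js' x = foldr S (alternating j i n @ vs) x"
        using same_tail[of i js' "alternating j i n @ vs"] less.prems(1) ra Cons n by (simp add: w_def)
      moreover have "foldr S ks' x = foldr S (alternating i j n @ vs) x"
        using same_tail[of j ks' "alternating i j n @ vs"] less.prems(2,3) rb ks n by (simp add: w_def)
      ultimately have "foldr S js x = foldr S ?a (foldr S vs x)" "foldr S ks x = foldr S ?b (foldr S vs x)"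
        using Cons ks n by simp_all
      then show ?thesis using braid[OF m] operators_closed vs assms(4) by (simp add: reduced_word_def)
    qed
  qed
qed

definition weyl_operator :: "('a \<Rightarrow> 'a) \<Rightarrow> 'b \<Rightarrow> 'b" where
  "weyl_operator w = foldr S (SOME js. reduced_word js \<and> word js = w)"

lemma weyl_operator_reduced:
  assumes "reduced_word js" "x \<in> D" shows "weyl_operator (word js) x = foldr S js x"
proof -
  have "reduced_word (SOME ks. reduced_word ks \<and> word ks = word js) \<and> word (SOME ks. reduced_word ks \<and> word ks = word js) = word js"
    by (rule someI[of _ js]) (use assms in simp)
  then show ?thesis unfolding weyl_operator_def
    using reduced_words_same_operator[OF _ assms(1) _ assms(2)] by blast
qed

context
  assumes invol: "\<And>j x. j \<in> {0..r} \<Longrightarrow> x \<in> D \<Longrightarrow> S j (S j x) = x"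
begin

lemma weyl_operator_simple_comp:
  assumes "w \<in> affine_weyl \<Phi>" "j \<in> {0..r}" "x \<in> D"
  shows "weyl_operator (sr j \<circ> w) x = S j (weyl_operator w x)"
proof -
  have up: "weyl_operator (sr j \<circ> u) x = S j (weyl_operator u x)"
    if u: "u \<in> affine_weyl \<Phi>" "len u < len (sr j \<circ> u)" for u
  proof -
    obtain js where js: "reduced_word js" "word js = u" using ex_reduced_word[OF u(1)] by blast
    have "len (word (j # js)) \<le> length (j # js)" using js assms(2) by (intro len_le) (auto simp: reduced_word_def)
    then have "reduced_word (j # js)" using js assms(2) u(2) by (auto simp: reduced_word_def)
    then have "weyl_operator (word (j # js)) x = foldr S (j # js) x" using weyl_operator_reduced assms(3) by blast
    moreover have "weyl_operator u x = foldr S js x" using weyl_operator_reduced[OF js(1) assms(3)] js by simp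
    ultimately show ?thesis using js by simp
  qed
  have sW: "sr j \<circ> w \<in> affine_weyl \<Phi>" using affine_weyl_comp[OF simple_reflection_affine[OF assms(2)] assms(1)] .
  have ss: "sr j \<circ> (sr j \<circ> w) = w" using assms(2) by auto
  show ?thesis
  proof (cases "sval j (w base_point) < 0")
    case True
    then have "len (sr j \<circ> w) < len w" using len_descent assms by blast
    then have "weyl_operator w x = S j (weyl_operator (sr j \<circ> w) x)" using up[OF sW] ss by simp
    moreover have "weyl_operator (sr j \<circ> w) x \<in> D"
    proof -
      obtain js where "reduced_word js" "word js = sr j \<circ> w" using ex_reduced_word[OF sW] by blast
      then show ?thesis using weyl_operator_reduced[of js x] assms(3) operators_closed by (auto simp: reduced_word_def)
    qed
    ultimately show ?thesis using invol assms(2) by simp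
  next
    case False
    then have "sval j (w base_point) > 0" using sval_regular[OF assms(1,2)] by simp
    then have "sval j ((sr j \<circ> w) base_point) < 0" using sval_simple_reflection_self[OF assms(2)] by simp
    then have "len (sr j \<circ> (sr j \<circ> w)) < len (sr j \<circ> w)" using len_descent[OF sW assms(2)] by blast
    then show ?thesis using up[OF assms(1)] ss by simp
  qed
qed

lemma weyl_operator_word:
  assumes "set js \<subseteq> {0..r}" "x \<in> D" shows "weyl_operator (word js) x = foldr S js x"
  using assms
proof (induction js)
  case Nil
  have "reduced_word []" using len_le[of "[]"] by (simp add: reduced_word_def)
  from weyl_operator_reduced[OF this assms(2)] show ?case .
next
  case (Cons j js)
  then have j: "j \<in> {0..r}" "set js \<subseteq> {0..r}" by auto
  show ?case unfolding word_simps weyl_operator_simple_comp[OF word_affine[OF j(2)] j(1) assms(2)]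
    using Cons j by simp
qed

lemma weyl_operator_comp:
  assumes "u \<in> affine_weyl \<Phi>" "w \<in> affine_weyl \<Phi>" "x \<in> D"
  shows "weyl_operator (u \<circ> w) x = weyl_operator u (weyl_operator w x)"
proof -
  obtain us ws where *: "set us \<subseteq> {0..r}" "u = word us" "set ws \<subseteq> {0..r}" "w = word ws"
    using affine_weyl_word assms by metis
  then have "weyl_operator (u \<circ> w) x = foldr S (us @ ws) x"
    using weyl_operator_word[of "us @ ws" x] assms(3) by (simp add: word_append)
  also have "\<dots> = weyl_operator u (weyl_operator w x)"
    using * weyl_operator_word assms(3) operators_closed by simp
  finally show ?thesis .
qed

end

end

end

section \<open>Yang--Baxter equations of rank two\<close>

text \<open>
  The Cayley graph of the dihedral group of order \<open>2 m\<close>: a cycle of length \<open>2 m\<close> whose edges are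
  labelled alternately by the two generators, with the label \<open>True\<close> on the edge from 0 to 1.  The identity
  is the vertex 0, the longest element the vertex \<open>m\<close>, and the length of an element is its distance
  from 0.
\<close>

definition neighbour :: "nat \<Rightarrow> bool \<Rightarrow> nat \<Rightarrow> nat" where
  "neighbour m l u = (if even u = l then (if Suc u = 2 * m then 0 else Suc u)
     else (if u = 0 then 2 * m - 1 else u - 1))"

definition depth :: "nat \<Rightarrow> nat \<Rightarrow> nat" where
  "depth m u = min u (2 * m - u)"

definition descent :: "nat \<Rightarrow> bool \<Rightarrow> nat \<Rightarrow> bool" where
  "descent m l u \<longleftrightarrow> depth m (neighbour m l u) < depth m u"

lemma neighbour_less: "m > 0 \<Longrightarrow> u < 2 * m \<Longrightarrow> neighbour m l u < 2 * m"
  by (auto simp: neighbour_def)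

lemma neighbour_neighbour: "m > 0 \<Longrightarrow> u < 2 * m \<Longrightarrow> neighbour m l (neighbour m l u) = u"
  by (auto simp: neighbour_def elim!: oddE evenE) presburger+

text \<open>Tables for the four groups that occur.\<close>

lemma neighbour_2:
  "neighbour 2 True 0 = 1" "neighbour 2 True 1 = 0" "neighbour 2 True 2 = 3" "neighbour 2 True 3 = 2"
  "neighbour 2 False 0 = 3" "neighbour 2 False 1 = 2" "neighbour 2 False 2 = 1" "neighbour 2 False 3 = 0"
  by (simp_all add: neighbour_def)

lemma descent_2:
  "\<not> descent 2 True 0" "descent 2 True 1" "descent 2 True 2" "\<not> descent 2 True 3"
  "\<not> descent 2 False 0" "\<not> descent 2 False 1" "descent 2 False 2" "descent 2 False 3"
  by (simp_all del: One_nat_def add: descent_def depth_def neighbour_2)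

lemma neighbour_3:
  "neighbour 3 True 0 = 1" "neighbour 3 True 1 = 0" "neighbour 3 True 2 = 3" "neighbour 3 True 3 = 2"
  "neighbour 3 True 4 = 5" "neighbour 3 True 5 = 4" "neighbour 3 False 0 = 5" "neighbour 3 False 1 = 2"
  "neighbour 3 False 2 = 1" "neighbour 3 False 3 = 4" "neighbour 3 False 4 = 3" "neighbour 3 False 5 = 0"
  by (simp_all add: neighbour_def)

lemma descent_3:
  "\<not> descent 3 True 0" "descent 3 True 1" "\<not> descent 3 True 2" "descent 3 True 3"
  "descent 3 True 4" "\<not> descent 3 True 5" "\<not> descent 3 False 0" "\<not> descent 3 False 1"
  "descent 3 False 2" "descent 3 False 3" "\<not> descent 3 False 4" "descent 3 False 5"
  by (simp_all del: One_nat_def add: descent_def depth_def neighbour_3)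

lemma neighbour_4:
  "neighbour 4 True 0 = 1" "neighbour 4 True 1 = 0" "neighbour 4 True 2 = 3" "neighbour 4 True 3 = 2"
  "neighbour 4 True 4 = 5" "neighbour 4 True 5 = 4" "neighbour 4 True 6 = 7" "neighbour 4 True 7 = 6"
  "neighbour 4 False 0 = 7" "neighbour 4 False 1 = 2" "neighbour 4 False 2 = 1" "neighbour 4 False 3 = 4"
  "neighbour 4 False 4 = 3" "neighbour 4 False 5 = 6" "neighbour 4 False 6 = 5" "neighbour 4 False 7 = 0"
  by (simp_all add: neighbour_def)

lemma descent_4:
  "\<not> descent 4 True 0" "descent 4 True 1" "\<not> descent 4 True 2" "descent 4 True 3"
  "descent 4 True 4" "\<not> descent 4 True 5" "descent 4 True 6" "\<not> descent 4 True 7"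
  "\<not> descent 4 False 0" "\<not> descent 4 False 1" "descent 4 False 2" "\<not> descent 4 False 3"
  "descent 4 False 4" "descent 4 False 5" "\<not> descent 4 False 6" "descent 4 False 7"
  by (simp_all del: One_nat_def add: descent_def depth_def neighbour_4)

lemma neighbour_6:
  "neighbour 6 True 0 = 1" "neighbour 6 True 1 = 0" "neighbour 6 True 2 = 3" "neighbour 6 True 3 = 2"
  "neighbour 6 True 4 = 5" "neighbour 6 True 5 = 4" "neighbour 6 True 6 = 7" "neighbour 6 True 7 = 6"
  "neighbour 6 True 8 = 9" "neighbour 6 True 9 = 8" "neighbour 6 True 10 = 11" "neighbour 6 True 11 = 10"
  "neighbour 6 False 0 = 11" "neighbour 6 False 1 = 2" "neighbour 6 False 2 = 1" "neighbour 6 False 3 = 4"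
  "neighbour 6 False 4 = 3" "neighbour 6 False 5 = 6" "neighbour 6 False 6 = 5" "neighbour 6 False 7 = 8"
  "neighbour 6 False 8 = 7" "neighbour 6 False 9 = 10" "neighbour 6 False 10 = 9" "neighbour 6 False 11 = 0"
  by (simp_all add: neighbour_def)

lemma descent_6:
  "\<not> descent 6 True 0" "descent 6 True 1" "\<not> descent 6 True 2" "descent 6 True 3"
  "\<not> descent 6 True 4" "descent 6 True 5" "descent 6 True 6" "\<not> descent 6 True 7"
  "descent 6 True 8" "\<not> descent 6 True 9" "descent 6 True 10" "\<not> descent 6 True 11"
  "\<not> descent 6 False 0" "\<not> descent 6 False 1" "descent 6 False 2" "\<not> descent 6 False 3"
  "descent 6 False 4" "\<not> descent 6 False 5" "descent 6 False 6" "descent 6 False 7"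
  "\<not> descent 6 False 8" "descent 6 False 9" "\<not> descent 6 False 10" "descent 6 False 11"
  by (simp_all del: One_nat_def add: descent_def depth_def neighbour_6)

text \<open>
  The coefficient at the vertex \<open>u\<close> of the product of the factors \<open>T + p\<close>, with \<open>p\<close> in the list and \<open>T\<close>
  alternately one of the two generators of the Hecke algebra \<open>T\<^sup>2 = 1 + h T\<close>, in the basis indexed by the
  group.  Multiplication by \<open>T\<close> takes a basis element to its neighbour, plus \<open>h\<close> times itself at a
  descent.
\<close>

fun coefficient :: "nat \<Rightarrow> (bool \<Rightarrow> 'k::comm_ring_1) \<Rightarrow> bool \<Rightarrow> 'k list \<Rightarrow> nat \<Rightarrow> 'k" where
  "coefficient m h l [] u = (if u = 0 then 1 else 0)"
| "coefficient m h l (p # ps) u = coefficient m h (\<not> l) ps (neighbour m l u)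
     + (p + (if descent m l u then h l else 0)) * coefficient m h (\<not> l) ps u"

text \<open>The label at position \<open>n\<close> of the alternating word starting with \<open>l\<close>.\<close>

fun letter :: "bool \<Rightarrow> nat \<Rightarrow> bool" where
  "letter l n = (even n = l)"

text \<open>
  The Yang--Baxter equations, with spectral parameters \<open>h / (X - 1)\<close> for the monomials \<open>X\<close> of the positive
  coroots in their convex order.  The variables are \<open>u = 1 / (X - 1)\<close>; if three of the monomials satisfy
  \<open>X'' = X X'\<close>, the corresponding variables satisfy \<open>u u' = u'' (1 + u + u')\<close>, and these relations
  are all that is needed.
\<close>

lemma yang_baxter_A1_A1:
  fixes h :: "bool \<Rightarrow> 'k::field"
  assumes "u < 4"
  shows "coefficient 2 h True [p1, p2] u = coefficient 2 h False [p2, p1] u"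
proof -
  have "u \<in> {0, 1, 2, 3}" using assms(1) by auto
  then show ?thesis by (elim insertE emptyE) (simp_all add: neighbour_2 descent_2 algebra_simps del: One_nat_def)
qed

lemma yang_baxter_A2:
  fixes h :: "bool \<Rightarrow> 'k::field"
  assumes "u < 6" "h True = h False" and r: "u1 * u3 = u2 * (1 + u1 + u3)"
  defines "a \<equiv> h True"
  shows "coefficient 3 h True [a * u1, a * u2, a * u3] u = coefficient 3 h False [a * u3, a * u2, a * u1] u"
proof -
  have h: "h True = a" "h False = a" using assms(2) by (simp_all add: a_def)
  have r': "a * a * (u1 * u3) = a * a * (u2 * (1 + u1 + u3))" by (simp only: r)
  have "u \<in> {0, 1, 2, 3, 4, 5}" using assms(1) by auto
  then show ?thesis using r' by (elim insertE emptyE) (simp_all add: neighbour_3 descent_3 h algebra_simps del: One_nat_def)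
qed

lemma yang_baxter_B2:
  fixes h :: "bool \<Rightarrow> 'k::field"
  assumes "u < 8" and r: "u1 * u4 = u3 * (1 + u1 + u4)" "u1 * u3 = u2 * (1 + u1 + u3)"
  defines "a \<equiv> h True" and "b \<equiv> h False"
  shows "coefficient 4 h True [a * u1, b * u2, a * u3, b * u4] u =
    coefficient 4 h False [b * u4, a * u3, b * u2, a * u1] u"
proof -
  have h: "h True = a" "h False = b" by (simp_all add: a_def b_def)
  \<comment> \<open>Only the coefficients at elements of length 2 differ formally, by plus or minus this combination of
    the relations.\<close>
  have "a * b * (u1 * u4 - u3 * (1 + u1 + u4)) + a * b * (u1 * u3 - u2 * (1 + u1 + u3)) = 0" by (simp only: r) simp
  then have r': "a * b * (u1 * u4) = a * b * (u1 * u2 + u2 * u3 + u2 + u3 * u4 + u3)" by (simp add: algebra_simps)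
  have "u \<in> {0, 1, 2, 3, 4, 5, 6, 7}" using assms(1) by auto
  then show ?thesis using r' by (elim insertE emptyE) (simp_all add: neighbour_4 descent_4 h algebra_simps del: One_nat_def)
qed

lemma yang_baxter_G2:
  fixes h :: "bool \<Rightarrow> 'k::field"
  assumes "u < 12"
    and A: "u1 * u5 = u3 * (1 + u1 + u5)" and B: "u2 * u6 = u4 * (1 + u2 + u6)"
    and C: "u1 * u6 = u5 * (1 + u1 + u6)" and D: "u1 * u3 = u2 * (1 + u1 + u3)"
    and E: "u5 * u3 = u4 * (1 + u5 + u3)"
  defines "a \<equiv> h True" and "b \<equiv> h False"
  shows "coefficient 6 h True [a * u1, b * u2, a * u3, b * u4, a * u5, b * u6] u =
    coefficient 6 h False [b * u6, a * u5, b * u4, a * u3, b * u2, a * u1] u"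
proof -
  have h: "h True = a" "h False = b" by (simp_all add: a_def b_def)
  define A' where "A' = u1 * u5 - u3 * (1 + u1 + u5)"
  define B' where "B' = u2 * u6 - u4 * (1 + u2 + u6)"
  define C' where "C' = u1 * u6 - u5 * (1 + u1 + u6)"
  define D' where "D' = u1 * u3 - u2 * (1 + u1 + u3)"
  define E' where "E' = u5 * u3 - u4 * (1 + u5 + u3)"
  have 0: "A' = 0" "B' = 0" "C' = 0" "D' = 0" "E' = 0"
    by (simp_all only: A B C D E A'_def B'_def C'_def D'_def E'_def diff_self)
  note defs = A'_def B'_def C'_def D'_def E'_def
  \<comment> \<open>Only the coefficients at elements of length 2 (the vertices 2 and 10) and 4 (the vertices 4 and 8) differ
    formally; each difference is exhibited in the ideal generated by the relations.\<close>
  have length_4: "coefficient 6 h True [a * u1, b * u2, a * u3, b * u4, a * u5, b * u6] 4 -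
    coefficient 6 h False [b * u6, a * u5, b * u4, a * u3, b * u2, a * u1] 4 = a * b * (A' + C' + D' + E')"
    by (simp del: One_nat_def add: neighbour_6 descent_6 h defs algebra_simps)
  have length_4': "coefficient 6 h True [a * u1, b * u2, a * u3, b * u4, a * u5, b * u6] 8 -
    coefficient 6 h False [b * u6, a * u5, b * u4, a * u3, b * u2, a * u1] 8 = - (a * b * (A' + C' + D' + E'))"
    by (simp del: One_nat_def add: neighbour_6 descent_6 h defs algebra_simps)
  define R where "R = a * a * A' + b * b * B' + a * a * b * b * (- u1 * u6 * E' + (u5 * u6 + u5 + u4 * u5 + u4) * D'
      + u3 * (C' + u4 * C' + u1 * B'))"
  have length_2: "coefficient 6 h True [a * u1, b * u2, a * u3, b * u4, a * u5, b * u6] 2 -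
    coefficient 6 h False [b * u6, a * u5, b * u4, a * u3, b * u2, a * u1] 2 = R"
    by (simp del: One_nat_def add: neighbour_6 descent_6 h R_def defs algebra_simps)
  have length_2': "coefficient 6 h True [a * u1, b * u2, a * u3, b * u4, a * u5, b * u6] 10 -
    coefficient 6 h False [b * u6, a * u5, b * u4, a * u3, b * u2, a * u1] 10 = - R"
    by (simp del: One_nat_def add: neighbour_6 descent_6 h R_def defs algebra_simps)
  have "R = 0" by (simp add: R_def 0)
  note zero = length_4[unfolded 0] length_4'[unfolded 0] length_2[unfolded \<open>R = 0\<close>] length_2'[unfolded \<open>R = 0\<close>]
  have "u \<in> {2, 4, 8, 10} \<or> u \<in> {0, 1, 3, 5, 6, 7, 9, 11}" using assms(1) unfolding insert_iff empty_iff by presburger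
  then show ?thesis
  proof
    assume "u \<in> {2, 4, 8, 10}"
    then show ?thesis
      by (elim insertE emptyE)
        (use zero in \<open>simp_all only: add_0_left mult_zero_right minus_zero right_minus_eq\<close>)
  next
    assume "u \<in> {0, 1, 3, 5, 6, 7, 9, 11}"
    then show ?thesis by (elim insertE emptyE) (simp_all add: neighbour_6 descent_6 h algebra_simps del: One_nat_def)
  qed
qed

section \<open>Baxterised Hecke operators of rank two\<close>

text \<open>
  Two semilinear involutions \<open>S True\<close> and \<open>S False\<close> on a space \<open>D\<close> over a field \<open>Q\<close>, both inside a larger
  field.  Here \<open>X l\<close> plays the role of the monomial of a simple coroot and \<open>- n l\<close> that of a Cartan integer.
  Indexing by \<open>bool\<close> gives the other index as the negation.
\<close>

locale rank_two_operators =
  fixes S act :: "bool \<Rightarrow> 'k::field \<Rightarrow> 'k" and Q D :: "'k set" and X kk :: "bool \<Rightarrow> 'k"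
    and n :: "bool \<Rightarrow> int"
  assumes Q_closed: "\<And>x y. x \<in> Q \<Longrightarrow> y \<in> Q \<Longrightarrow> x + y \<in> Q" "\<And>x. x \<in> Q \<Longrightarrow> - x \<in> Q"
      "\<And>x y. x \<in> Q \<Longrightarrow> y \<in> Q \<Longrightarrow> x * y \<in> Q" "\<And>x. x \<in> Q \<Longrightarrow> inverse x \<in> Q" "0 \<in> Q" "1 \<in> Q"
    and act_hom: "\<And>l x y. x \<in> Q \<Longrightarrow> y \<in> Q \<Longrightarrow> act l (x + y) = act l x + act l y"
      "\<And>l x y. x \<in> Q \<Longrightarrow> y \<in> Q \<Longrightarrow> act l (x * y) = act l x * act l y" "\<And>l. act l 1 = 1"
    and act_closed: "\<And>l x. x \<in> Q \<Longrightarrow> act l x \<in> Q"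
    and D_closed: "0 \<in> D" "\<And>x y. x \<in> D \<Longrightarrow> y \<in> D \<Longrightarrow> x + y \<in> D" "\<And>f x. f \<in> Q \<Longrightarrow> x \<in> D \<Longrightarrow> f * x \<in> D"
    and S_add: "\<And>l x y. x \<in> D \<Longrightarrow> y \<in> D \<Longrightarrow> S l (x + y) = S l x + S l y"
    and S_mult: "\<And>l f x. f \<in> Q \<Longrightarrow> x \<in> D \<Longrightarrow> S l (f * x) = act l f * S l x"
    and S_closed: "\<And>l x. x \<in> D \<Longrightarrow> S l x \<in> D"
    and S_invol: "\<And>l x. x \<in> D \<Longrightarrow> S l (S l x) = x"
    and XQ: "\<And>l. X l \<in> Q" and kQ: "\<And>l. kk l \<in> Q" and k0: "\<And>l. kk l \<noteq> 0" and X0: "\<And>l. X l \<noteq> 0"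
    and act_k: "\<And>l l'. act l (kk l') = kk l'"
    and act_X: "\<And>l. act l (X l) = inverse (X l)" "\<And>l. act l (X (\<not> l)) = X (\<not> l) * X l powi n l"
    and X_indep: "\<And>a b. X True powi a * X False powi b = 1 \<Longrightarrow> a = 0 \<and> b = 0"
    and pole: "\<And>l. kk l * X l - inverse (kk l) \<noteq> 0"
begin

definition "A l = (X l - 1) / (kk l * X l - inverse (kk l))"
definition "h l = kk l - inverse (kk l)"
definition "P l = h l / (X l - 1)"

lemma X_neq_1: "X l \<noteq> 1"
  using X_indep[of 1 0] X_indep[of 0 1] by (cases l) auto

lemma Q_diff: "x \<in> Q \<Longrightarrow> y \<in> Q \<Longrightarrow> x - y \<in> Q"
  using Q_closed(1)[of x "- y"] Q_closed(2) by simp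

lemma Q_divide: "x \<in> Q \<Longrightarrow> y \<in> Q \<Longrightarrow> x / y \<in> Q"
  by (simp add: divide_inverse Q_closed)

lemma Q_power: "x \<in> Q \<Longrightarrow> x ^ m \<in> Q"
  by (induction m) (auto intro: Q_closed)

lemma Q_powi: "x \<in> Q \<Longrightarrow> x powi m \<in> Q"
  by (simp add: power_int_def Q_power Q_closed)

lemma hQ: "h l \<in> Q" by (simp add: h_def Q_diff kQ Q_closed)
lemma AQ: "A l \<in> Q" by (simp add: A_def Q_diff Q_divide kQ XQ Q_closed)
lemma PQ: "P l \<in> Q" by (simp add: P_def Q_diff Q_divide hQ XQ Q_closed)

lemma act_0: "act l 0 = 0"
  using act_hom(1)[of 0 0 l] Q_closed(5) by (metis add_cancel_right_right add_0)

lemma act_minus: "x \<in> Q \<Longrightarrow> act l (- x) = - act l x"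
  using act_hom(1)[of x "- x" l] Q_closed act_0 by (simp add: eq_neg_iff_add_eq_0 add.commute)

lemma act_diff: "x \<in> Q \<Longrightarrow> y \<in> Q \<Longrightarrow> act l (x - y) = act l x - act l y"
  using act_hom(1)[of x "- y" l] act_minus[of y l] Q_closed(2) by simp

lemma act_inverse: "x \<in> Q \<Longrightarrow> act l (inverse x) = inverse (act l x)"
proof (cases "x = 0")
  case False
  assume "x \<in> Q"
  then have "act l x * act l (inverse x) = 1"
    using act_hom(2)[of x "inverse x" l] Q_closed act_hom(3) False by simp
  then show ?thesis by (metis inverse_unique)
qed (simp add: act_0)

lemma act_divide: "x \<in> Q \<Longrightarrow> y \<in> Q \<Longrightarrow> act l (x / y) = act l x / act l y"
  by (simp add: divide_inverse act_hom act_inverse Q_closed)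

lemma act_power: "x \<in> Q \<Longrightarrow> act l (x ^ m) = act l x ^ m"
  by (induction m) (auto simp: act_hom Q_power)

lemma act_powi: "x \<in> Q \<Longrightarrow> act l (x powi m) = act l x powi m"
  by (simp add: power_int_def act_power act_inverse Q_closed)

lemma act_h: "act l (h l') = h l'"
  by (simp add: h_def act_diff kQ Q_closed act_inverse act_k)

lemma act_P: "act l (P l) = - P l - h l"
proof -
  have "act l (P l) = h l / (inverse (X l) - 1)"
    by (simp add: P_def act_divide act_diff act_h act_X act_hom hQ XQ Q_diff Q_closed)
  also have "\<dots> = - P l - h l" using X0[of l] X_neq_1[of l] by (simp add: P_def field_simps)
  finally show ?thesis .
qed

lemma act_A: "act l (A l) = (1 - X l) / (kk l - inverse (kk l) * X l)"
proof -
  have "act l (A l) = (inverse (X l) - 1) / (kk l * inverse (X l) - inverse (kk l))"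
    by (simp add: A_def act_divide act_diff act_X act_hom act_k act_inverse kQ XQ Q_diff Q_closed)
  also have "\<dots> = ((inverse (X l) - 1) * X l) / ((kk l * inverse (X l) - inverse (kk l)) * X l)" using X0[of l] by simp
  also have "(inverse (X l) - 1) * X l = 1 - X l" using X0[of l] by (simp add: algebra_simps)
  also have "(kk l * inverse (X l) - inverse (kk l)) * X l = kk l - inverse (kk l) * X l"
    using X0[of l] by (simp add: algebra_simps)
  finally show ?thesis .
qed

lemma A_neq_0: "A l \<noteq> 0"
  using pole X_neq_1 by (simp add: A_def)

lemma pole': "kk l - inverse (kk l) * X l \<noteq> 0"
proof
  assume "kk l - inverse (kk l) * X l = 0"
  then have "act l (kk l - inverse (kk l) * X l) = 0" by (simp add: act_0)
  then have "kk l - inverse (kk l) * inverse (X l) = 0"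
    by (simp add: act_diff act_hom act_inverse act_X act_k kQ XQ Q_closed)
  moreover have "kk l * X l - inverse (kk l) = (kk l - inverse (kk l) * inverse (X l)) * X l"
    using X0[of l] by (simp add: left_diff_distrib mult.assoc)
  ultimately have "kk l * X l - inverse (kk l) = 0" by simp
  then show False using pole by blast
qed

text \<open>In \<open>S\<^sup>2\<close> with \<open>S = A (L + P)\<close> and \<open>L\<^sup>2 = 1 + h L\<close>, this is the term without \<open>L\<close>, while \<open>act_P\<close> makes the
  coefficient of \<open>L\<close> vanish.\<close>

lemma unitarity: "A l * act l (A l) * (1 + P l * act l (P l)) = 1"
proof -
  let ?k = "kk l" and ?X = "X l"
  have X1: "?X - 1 \<noteq> 0" using X_neq_1 by simp
  have "P l * act l (P l) = - (h l * h l * ?X / ((?X - 1) * (?X - 1)))"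
    unfolding act_P using X1 by (simp add: P_def divide_simps) (simp add: algebra_simps)
  then have "1 + P l * act l (P l) = ((?X - 1) * (?X - 1) - h l * h l * ?X) / ((?X - 1) * (?X - 1))"
    using X1 by (simp add: diff_divide_distrib)
  also have "(?X - 1) * (?X - 1) - h l * h l * ?X = - ((?k * ?X - inverse ?k) * (?k - inverse ?k * ?X))"
    using k0[of l] by (simp add: h_def field_simps)
  finally have *: "1 + P l * act l (P l) = - ((?k * ?X - inverse ?k) * (?k - inverse ?k * ?X)) / ((?X - 1) * (?X - 1))" .
  have **: "x / a * (- x / b) * (- (a * b) / (x * x)) = 1" if "a \<noteq> 0" "b \<noteq> 0" "x \<noteq> 0" for a b x :: 'k
    using that by simp
  have "1 - ?X = - (?X - 1)" by simp
  then show ?thesis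
    unfolding * act_A unfolding A_def using **[OF pole pole' X1] by simp
qed

definition L :: "bool \<Rightarrow> 'k \<Rightarrow> 'k" where
  "L l x = S l x / A l - P l * x"

lemma S_eq_L: "S l x = A l * (L l x + P l * x)"
  using A_neq_0[of l] by (simp add: L_def field_simps)

lemma L_closed: "x \<in> D \<Longrightarrow> L l x \<in> D"
proof -
  assume x: "x \<in> D"
  have "L l x = inverse (A l) * S l x + (- P l) * x" by (simp add: L_def divide_inverse)
  show ?thesis unfolding \<open>L l x = _\<close> by (intro D_closed Q_closed AQ PQ S_closed x)
qed

text \<open>This is the quadratic relation \<open>L\<^sup>2 = 1 + h L\<close> of the Hecke algebra, multiplied by \<open>A\<close> after adding
  \<open>P L\<close> to both sides.\<close>

lemma S_L:
  assumes x: "x \<in> D" shows "S l (L l x) = A l * (x + (P l + h l) * L l x)"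
proof -
  let ?A' = "act l (A l)" and ?P' = "act l (P l)"
  have "x = S l (A l * (L l x + P l * x))" using S_invol[OF x, of l] S_eq_L[of l x] by simp
  also have "\<dots> = ?A' * (S l (L l x) + ?P' * S l x)"
    using x L_closed[OF x] by (simp add: S_mult S_add D_closed AQ PQ)
  finally have "?A' * S l (L l x) = x - ?A' * ?P' * (A l * (L l x + P l * x))"
    unfolding S_eq_L[of l x] by (simp add: algebra_simps)
  then have "A l * (?A' * S l (L l x)) = A l * (x - ?A' * ?P' * (A l * (L l x + P l * x)))" by simp
  also have "\<dots> = (A l * ?A') * (A l * (x * (1 + P l * ?P') - ?P' * L l x - P l * ?P' * x))"
  proof -
    have "(A l * ?A') * (A l * (x * (1 + P l * ?P'))) = A l * x"
      using unitarity[of l] by (metis (no_types, lifting) mult.assoc mult.left_commute mult.right_neutral)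
    then show ?thesis by (simp add: algebra_simps)
  qed
  also have "\<dots> = (A l * ?A') * (A l * (x + (P l + h l) * L l x))"
    by (simp add: act_P algebra_simps)
  finally have "(A l * ?A') * S l (L l x) = (A l * ?A') * (A l * (x + (P l + h l) * L l x))"
    by (simp add: mult.assoc)
  moreover have "A l * ?A' \<noteq> 0" using unitarity[of l] by auto
  ultimately show ?thesis by (metis mult_left_cancel)
qed

fun chain :: "bool \<Rightarrow> 'k \<Rightarrow> nat \<Rightarrow> 'k" where
  "chain l e 0 = e"
| "chain l e (Suc m) = L (letter l m) (chain l e m)"

lemma chain_closed: "e \<in> D \<Longrightarrow> chain l e m \<in> D"
  by (induction m) (auto simp: L_closed)

fun iter :: "bool \<Rightarrow> 'k \<Rightarrow> nat \<Rightarrow> 'k" where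
  "iter l e 0 = e"
| "iter l e (Suc m) = S l (iter (\<not> l) e m)"

text \<open>When the scalars in a product of operators \<open>S = A (L + P)\<close> are collected on the left, every \<open>S\<close> moves
  those to its right by its action.  This gives the following values of \<open>P\<close> and \<open>A\<close> for the
  alternating word of length \<open>m\<close> starting with \<open>l\<close>.\<close>

fun params :: "bool \<Rightarrow> nat \<Rightarrow> 'k list" where
  "params l 0 = []"
| "params l (Suc m) = P l # map (act l) (params (\<not> l) m)"

fun factors :: "bool \<Rightarrow> nat \<Rightarrow> 'k list" where
  "factors l 0 = []"
| "factors l (Suc m) = A l # map (act l) (factors (\<not> l) m)"

lemma params_Q: "set (params l m) \<subseteq> Q"
  by (induction l m rule: params.induct) (auto intro: PQ act_closed)

lemma factors_Q: "set (factors l m) \<subseteq> Q"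
  by (induction l m rule: factors.induct) (auto intro: AQ act_closed)

lemma coefficient_Q: "set ps \<subseteq> Q \<Longrightarrow> coefficient m h l ps u \<in> Q"
  by (induction m h l ps u rule: coefficient.induct) (auto intro: Q_closed hQ)

lemma act_coefficient:
  "set ps \<subseteq> Q \<Longrightarrow> act l' (coefficient m h l ps u) = coefficient m h l (map (act l') ps) u"
  by (induction m h l ps u rule: coefficient.induct)
    (auto simp: act_hom act_h act_0 Q_closed hQ coefficient_Q)

lemma prod_list_Q: "set xs \<subseteq> Q \<Longrightarrow> prod_list xs \<in> Q"
  by (induction xs) (auto intro: Q_closed)

lemma act_prod_list: "set xs \<subseteq> Q \<Longrightarrow> act l (prod_list xs) = prod_list (map (act l) xs)"
  by (induction xs) (auto simp: act_hom prod_list_Q)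

lemma D_sum: "(\<And>i. i \<in> I \<Longrightarrow> f i \<in> D) \<Longrightarrow> sum f I \<in> D"
  by (induction I rule: infinite_finite_induct) (auto intro: D_closed)

lemma S_0: "S l 0 = 0"
  using S_mult[of 0 0 l] by (simp add: Q_closed D_closed act_0)

lemma S_sum: "(\<And>i. i \<in> I \<Longrightarrow> f i \<in> D) \<Longrightarrow> S l (sum f I) = (\<Sum>i\<in>I. S l (f i))"
  by (induction I rule: infinite_finite_induct) (auto simp: S_0 S_add D_sum)

text \<open>Vectors \<open>v u\<close> on which the operators \<open>L\<close> act as the Hecke generators act on the basis elements give
  a map from the regular representation, so the coefficients are those of the product of
  factors.\<close>

lemma iter_expansion:
  assumes m: "m > 0" and v: "\<And>u. u < 2 * m \<Longrightarrow> v u \<in> D"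
    and S: "\<And>l u. u < 2 * m \<Longrightarrow> S l (v u) = A l * (v (neighbour m l u) + (P l + (if descent m l u then h l else 0)) * v u)"
  shows "iter l (v 0) j = prod_list (factors l j) * (\<Sum>u<2*m. coefficient m h l (params l j) u * v u)"
proof (induction j arbitrary: l)
  case 0
  have "(\<Sum>u<2*m. coefficient m h l [] u * v u) = (\<Sum>u<2*m. if u = 0 then v u else 0)"
    by (intro sum.cong) auto
  then show ?case using m by simp
next
  case (Suc j)
  let ?l = "\<not> l" and ?ps = "params (\<not> l) j" and ?as = "factors (\<not> l) j"
  define C where "C = coefficient m h ?l (map (act l) ?ps)"
  have cD: "coefficient m h ?l ?ps u * v u \<in> D" if "u < 2 * m" for u
    using that v params_Q by (intro D_closed coefficient_Q) auto
  have "iter l (v 0) (Suc j) = S l (prod_list ?as * (\<Sum>u<2*m. coefficient m h ?l ?ps u * v u))"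
    using Suc[of ?l] by simp
  also have "\<dots> = prod_list (map (act l) ?as) * (\<Sum>u<2*m. S l (coefficient m h ?l ?ps u * v u))"
  proof -
    have "S l (\<Sum>u<2*m. coefficient m h ?l ?ps u * v u) = (\<Sum>u<2*m. S l (coefficient m h ?l ?ps u * v u))"
      using cD by (intro S_sum) auto
    moreover have "(\<Sum>u<2*m. coefficient m h ?l ?ps u * v u) \<in> D" using cD by (intro D_sum) auto
    ultimately show ?thesis
      by (simp only: S_mult[OF prod_list_Q[OF factors_Q]] act_prod_list[OF factors_Q])
  qed
  also have "(\<Sum>u<2*m. S l (coefficient m h ?l ?ps u * v u)) =
      (\<Sum>u<2*m. A l * (C u * v (neighbour m l u)) + A l * (C u * (P l + (if descent m l u then h l else 0)) * v u))"
  proof (rule sum.cong)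
    fix u assume "u \<in> {..<2 * m}"
    then have u: "u < 2 * m" by simp
    have "S l (coefficient m h ?l ?ps u * v u) = C u * S l (v u)"
      unfolding S_mult[OF coefficient_Q[OF params_Q] v[OF u]] act_coefficient[OF params_Q] C_def ..
    then show "S l (coefficient m h ?l ?ps u * v u) =
        A l * (C u * v (neighbour m l u)) + A l * (C u * (P l + (if descent m l u then h l else 0)) * v u)"
    proof -
      have "z * (a * (x + b * y)) = a * (z * x) + a * (z * b * y)" for z a b x y :: 'k
        by (simp add: algebra_simps)
      then show ?thesis using \<open>S l _ = C u * _\<close> unfolding S[OF u] by simp
    qed
  qed simp
  also have "\<dots> = A l * (\<Sum>u<2*m. C u * v (neighbour m l u)) + A l * (\<Sum>u<2*m. C u * (P l + (if descent m l u then h l else 0)) * v u)"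
    by (simp only: sum.distrib sum_distrib_left)
  also have "(\<Sum>u<2*m. C u * v (neighbour m l u)) = (\<Sum>u<2*m. C (neighbour m l u) * v u)"
    by (rule sum.reindex_bij_witness[of _ "neighbour m l" "neighbour m l"])
       (auto simp: neighbour_less neighbour_neighbour m)
  also have "A l * (\<Sum>u<2*m. C (neighbour m l u) * v u) + A l * (\<Sum>u<2*m. C u * (P l + (if descent m l u then h l else 0)) * v u)
      = A l * (\<Sum>u<2*m. coefficient m h l (params l (Suc j)) u * v u)"
    unfolding sum_distrib_left sum.distrib[symmetric] params.simps coefficient.simps C_def[symmetric]
    by (intro sum.cong refl) (simp only: distrib_left distrib_right mult.assoc mult.left_commute mult.commute)
  finally show ?case unfolding factors.simps prod_list.Cons by (simp only: mult.assoc mult.left_commute)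
qed

text \<open>Baxterisation: a braid relation for the \<open>L\<close> on one vector, together with the Yang--Baxter
  equation, gives the braid relation for the \<open>S\<close> on this vector.\<close>

lemma braid_from_yang_baxter:
  assumes m: "m > 0" and e: "e \<in> D" and braid: "chain True e m = chain False e m"
    and params: "params True m = rev (params False m)" and factors: "factors True m = rev (factors False m)"
    and yb: "\<And>u. u < 2 * m \<Longrightarrow> coefficient m h True (params True m) u = coefficient m h False (params False m) u"
  shows "iter True e m = iter False e m"
proof -
  \<comment> \<open>The image of \<open>e\<close> under the basis element of the vertex \<open>u\<close>, reached along one half of the
    cycle or the other; the halves meet at \<open>m\<close> by the braid relation for the \<open>L\<close>.\<close>
  define v where "v u = (if u \<le> m then chain True e u else chain False e (2 * m - u))" for u
  have v_high: "v u = chain False e (2 * m - u)" if "m \<le> u" "u \<le> 2 * m" for u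
  proof (cases "u = m")
    case True
    then show ?thesis using braid by (simp add: v_def)
  next
    case False
    then show ?thesis using that by (simp add: v_def)
  qed
  have v_0: "v 0 = e" "v (2 * m) = e" using m v_high[of "2 * m"] by (simp_all add: v_def)
  have vD: "v u \<in> D" for u using e by (simp add: v_def chain_closed)
  \<comment> \<open>The vertex 0 is also the endpoint \<open>2 m\<close> of the second half.\<close>
  define w where "w u = (if u = 2 * m then 0 else u)" for u
  have v_w: "v (w u) = v u" for u using v_0 by (simp add: w_def)
  have up: "L l (v u) = v (neighbour m l u)" if "u < 2 * m" "\<not> descent m l u" for l u
  proof (cases "even u = l")
    case True
    then have nb: "neighbour m l u = w (Suc u)" using that by (auto simp: neighbour_def w_def)
    have "u < m"
    proof (rule ccontr)
      assume "\<not> u < m"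
      then have "descent m l u" using that(1) m by (auto simp: descent_def nb depth_def w_def)
      then show False using that by simp
    qed
    then have "v (Suc u) = L (letter True u) (v u)" by (simp add: v_def)
    then show ?thesis using True nb v_w by simp
  next
    case False
    show ?thesis
    proof (cases "u = 0")
      case u0: True
      then have l: "l = False" using False by simp
      have "v (2 * m - 1) = chain False e 1" using m by (subst v_high) auto
      then show ?thesis using u0 l v_0 by (simp add: neighbour_def)
    next
      case u0: False
      then have nb: "neighbour m l u = u - 1" using False by (simp add: neighbour_def)
      have "m < u"
      proof (rule ccontr)
        assume "\<not> m < u"
        then have "descent m l u" using u0 by (auto simp: descent_def nb depth_def)
        then show False using that by simp
      qed
      then have "v (u - 1) = chain False e (Suc (2 * m - u))" using that(1) by (subst v_high) (auto simp: Suc_diff_le)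
      also have "\<dots> = L (letter False (2 * m - u)) (v u)"
        using \<open>m < u\<close> that(1) by (simp add: v_high)
      also have "letter False (2 * m - u) = l" using False that(1) by (auto simp: even_diff_nat)
      finally show ?thesis by (simp add: nb)
    qed
  qed
  have "S l (v u) = A l * (v (neighbour m l u) + (P l + (if descent m l u then h l else 0)) * v u)" if u: "u < 2 * m" for l u
  proof (cases "descent m l u")
    case False
    then show ?thesis using up[OF u False] S_eq_L[of l "v u"] by simp
  next
    case True
    let ?u = "neighbour m l u"
    have "?u < 2 * m" using neighbour_less m u by blast
    moreover have "\<not> descent m l ?u" using True neighbour_neighbour[OF m u] by (simp add: descent_def)
    ultimately have "v u = L l (v ?u)" using up neighbour_neighbour[OF m u] by simp
    then show ?thesis using S_L[OF vD, of l ?u] True by simp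
  qed
  from iter_expansion[OF m vD this, of True m] iter_expansion[OF m vD this, of False m]
  have "iter True e m = prod_list (factors True m) * (\<Sum>u<2*m. coefficient m h True (params True m) u * v u)"
    "iter False e m = prod_list (factors False m) * (\<Sum>u<2*m. coefficient m h False (params False m) u * v u)"
    using v_0 by simp_all
  moreover have "prod_list (factors True m) = prod_list (factors False m)"
    unfolding factors by (rule prod_list.rev)
  moreover have "(\<Sum>u<2*m. coefficient m h True (params True m) u * v u) = (\<Sum>u<2*m. coefficient m h False (params False m) u * v u)"
    using yb by (intro sum.cong) auto
  ultimately show ?thesis by simp
qed

definition mon :: "int \<Rightarrow> int \<Rightarrow> 'k" where "mon a b = X True powi a * X False powi b"

lemma mon_Q: "mon a b \<in> Q"
  by (simp add: mon_def Q_closed Q_powi XQ)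

lemma mon_neq_1: "a \<noteq> 0 \<or> b \<noteq> 0 \<Longrightarrow> mon a b \<noteq> 1"
  using X_indep by (auto simp: mon_def)

lemma mon_mult: "mon a b * mon a' b' = mon (a + a') (b + b')"
  using X0 by (simp add: mon_def power_int_add)

lemma act_mon: "act True (mon a b) = mon (n True * b - a) b" "act False (mon a b) = mon a (n False * a - b)"
proof -
  have swap: "(x powi a) powi b = (x powi b) powi a" for x :: 'k and a b
    by (metis mult.commute power_int_mult)
  have *: "act True (X False) = X False * X True powi n True" "act False (X True) = X True * X False powi n False"
    using act_X(2)[of True] act_X(2)[of False] by simp_all
  have "act True (mon a b) = inverse (X True) powi a * (X False * X True powi n True) powi b"
    by (simp add: mon_def act_hom act_powi act_X * Q_powi XQ)
  also have "\<dots> = mon (n True * b - a) b"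
    using X0 swap[of "X True" "n True" b] by (simp add: mon_def power_int_mult_distrib power_int_diff power_int_mult divide_inverse power_int_inverse mult_ac)
  finally show "act True (mon a b) = mon (n True * b - a) b" .
  have "act False (mon a b) = (X True * X False powi n False) powi a * inverse (X False) powi b"
    by (simp add: mon_def act_hom act_powi act_X * Q_powi XQ)
  also have "\<dots> = mon a (n False * a - b)"
    using X0 swap[of "X False" "n False" a] by (simp add: mon_def power_int_mult_distrib power_int_diff power_int_mult divide_inverse power_int_inverse mult_ac)
  finally show "act False (mon a b) = mon a (n False * a - b)" .
qed

text \<open>The spectral parameter without \<open>h\<close>, and the factor \<open>A\<close>, at the monomial of an arbitrary element of
  the lattice of rank two.\<close>

definition U :: "int \<Rightarrow> int \<Rightarrow> 'k" where "U a b = 1 / (mon a b - 1)"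
definition F :: "bool \<Rightarrow> int \<Rightarrow> int \<Rightarrow> 'k" where "F l a b = (mon a b - 1) / (kk l * mon a b - inverse (kk l))"

lemma U_Q: "U a b \<in> Q" by (simp add: U_def Q_divide Q_diff Q_closed mon_Q)

lemma act_hU: "act True (h l * U a b) = h l * U (n True * b - a) b" "act False (h l * U a b) = h l * U a (n False * a - b)"
  by (simp_all add: act_hom act_h hQ U_Q)
     (simp_all add: U_def act_divide act_diff act_hom mon_Q Q_diff Q_closed act_mon)

lemma act_F: "act True (F l a b) = F l (n True * b - a) b" "act False (F l a b) = F l a (n False * a - b)"
  by (simp_all add: F_def act_divide act_diff act_hom mon_Q Q_diff Q_closed act_mon act_k kQ act_inverse)

lemma P_U: "P True = h True * U 1 0" "P False = h False * U 0 1"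
  by (simp_all add: P_def U_def mon_def)

lemma A_F: "A True = F True 1 0" "A False = F False 0 1"
  by (simp_all add: A_def F_def mon_def)

lemma U_mult:
  assumes "a \<noteq> 0 \<or> b \<noteq> 0" "a' \<noteq> 0 \<or> b' \<noteq> 0" "a + a' = a'' \<and> b + b' = b''" "a'' \<noteq> 0 \<or> b'' \<noteq> 0"
  shows "U a b * U a' b' = U a'' b'' * (1 + U a b + U a' b')"
proof -
  let ?x = "mon a b" and ?y = "mon a' b'"
  have "?x \<noteq> 1" "?y \<noteq> 1" "?x * ?y \<noteq> 1" "mon a'' b'' = ?x * ?y" using assms mon_neq_1 by (auto simp: mon_mult)
  then show ?thesis by (simp add: U_def divide_simps) (simp add: algebra_simps)
qed

declare coefficient.simps [simp del]

text \<open>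
  The parameters of the two alternating words of length \<open>m\<close> belong to the positive coroots of the root
  system of rank two, in the two opposite convex orders, as the explicit lists show.  So the
  Yang--Baxter equations apply.
\<close>

lemma braid_on_vector:
  assumes e: "e \<in> D" and chain: "chain True e m = chain False e m"
    and type: "(n True, n False, m) \<in> {(0, 0, 2), (1, 1, 3), (2, 1, 4), (3, 1, 6)}"
    and k: "m = 3 \<Longrightarrow> kk True = kk False"
  shows "iter True e m = iter False e m"
proof -
  note simps = P_U A_F act_hU act_F numeral_eq_Suc
  have h: "m = 3 \<Longrightarrow> h True = h False" using k by (simp add: h_def)
  have neq: "m > 0" using type by auto
  have "params True m = rev (params False m) \<and> factors True m = rev (factors False m) \<and>
    (\<forall>u<2*m. coefficient m h True (params True m) u = coefficient m h False (params False m) u)"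
  proof -
    consider "n True = 0" "n False = 0" "m = 2" | "n True = 1" "n False = 1" "m = 3"
      | "n True = 2" "n False = 1" "m = 4" | "n True = 3" "n False = 1" "m = 6" using type by auto
    then show ?thesis
    proof cases
      case 1
      have p: "params True 2 = [h True * U 1 0, h False * U 0 1]" "params False 2 = [h False * U 0 1, h True * U 1 0]"
        by (simp_all add: 1 simps)
      have f: "factors True 2 = [F True 1 0, F False 0 1]" "factors False 2 = [F False 0 1, F True 1 0]"
        by (simp_all add: 1 simps)
      show ?thesis unfolding 1 p f using yang_baxter_A1_A1 by auto
    next
      case 2
      have k: "kk False = kk True" "h False = h True" using k h 2 by auto
      have FF: "F False = F True" by (intro ext) (simp add: F_def k)
      have p: "params True 3 = [h True * U 1 0, h True * U 1 1, h True * U 0 1]"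
          "params False 3 = [h True * U 0 1, h True * U 1 1, h True * U 1 0]"
        by (simp_all add: 2 simps k)
      have f: "factors True 3 = [F True 1 0, F True 1 1, F True 0 1]" "factors False 3 = [F True 0 1, F True 1 1, F True 1 0]"
        by (simp_all add: 2 simps FF)
      show ?thesis unfolding 2 p f using yang_baxter_A2[of _ h "U 1 0" "U 0 1" "U 1 1"] k U_mult[of 1 0 0 1 1 1] by auto
    next
      case 3
      have p: "params True 4 = [h True * U 1 0, h False * U 2 1, h True * U 1 1, h False * U 0 1]"
          "params False 4 = [h False * U 0 1, h True * U 1 1, h False * U 2 1, h True * U 1 0]"
        by (simp_all add: 3 simps)
      have f: "factors True 4 = [F True 1 0, F False 2 1, F True 1 1, F False 0 1]"
          "factors False 4 = [F False 0 1, F True 1 1, F False 2 1, F True 1 0]"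
        by (simp_all add: 3 simps)
      show ?thesis unfolding 3 p f
        using yang_baxter_B2[of _ "U 1 0" "U 0 1" "U 1 1" "U 2 1" h] U_mult[of 1 0 0 1 1 1] U_mult[of 1 0 1 1 2 1] by auto
    next
      case 4
      have p: "params True 6 = [h True * U 1 0, h False * U 3 1, h True * U 2 1, h False * U 3 2, h True * U 1 1, h False * U 0 1]"
          "params False 6 = [h False * U 0 1, h True * U 1 1, h False * U 3 2, h True * U 2 1, h False * U 3 1, h True * U 1 0]"
        by (simp_all add: 4 simps)
      have f: "factors True 6 = [F True 1 0, F False 3 1, F True 2 1, F False 3 2, F True 1 1, F False 0 1]"
          "factors False 6 = [F False 0 1, F True 1 1, F False 3 2, F True 2 1, F False 3 1, F True 1 0]"
        by (simp_all add: 4 simps)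
      have "coefficient 6 h True (params True 6) u = coefficient 6 h False (params False 6) u" if "u < 12" for u
        unfolding p by (rule yang_baxter_G2[OF that]) (rule U_mult; simp)+
      then show ?thesis unfolding 4 unfolding p f by auto
    qed
  qed
  then show ?thesis using braid_from_yang_baxter[OF neq e chain] by blast
qed

end

section \<open>The action on rational functions\<close>

lemma lattice_algebra_supported: "lattice_algebra \<Phi> = supported (coroot_lattice \<Phi>)"
  by (simp add: lattice_algebra_def supported_def)

lemma rational_functions_fractions:
  "rational_functions \<Phi> = fractions_over (coroot_lattice \<Phi>) (coroot_lattice \<Phi>)"
  by (simp add: rational_functions_def fractions_over_def lattice_algebra_supported)

context quasi_polynomial_data
begin

sublocale exponent_lattice "coroot_lattice \<Phi>"
  by unfold_locales (auto simp: lattice_add)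

text \<open>The image of \<open>x\<^sup>\<mu>\<close> under \<open>w\<close>.\<close>

definition twist :: "('a \<Rightarrow> 'a) \<Rightarrow> 'a \<Rightarrow> ('a, 'f) fun_field" where
  "twist w \<mu> = scalar (inverse (qpow (w 0 \<bullet> linear_part w \<mu>))) * monomial (linear_part w \<mu>)"

lemma at_0_integral: "w \<in> W \<Longrightarrow> \<mu> \<in> L \<Longrightarrow> w 0 \<bullet> linear_part w \<mu> \<in> \<int>"
  using lattice_integral at_0_lattice finite_weyl_lattice linear_part_finite by blast

lemma twist_add:
  assumes "w \<in> W" "\<mu> \<in> L" "\<nu> \<in> L" shows "twist w (\<mu> + \<nu>) = twist w \<mu> * twist w \<nu>"
  using at_0_integral[OF assms(1)] assms affine_linear[OF assms(1)]
  by (simp add: twist_def linear_add inner_add_right qpow_add monomial_add scalar_mult mult_ac)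

lemma twist_0: "w \<in> W \<Longrightarrow> twist w 0 = 1"
  using affine_linear[of w] by (simp add: twist_def linear_0)

lemma lattice_algebra_action_evaluate:
  assumes "w \<in> W" "a \<in> supported L"
  shows "Fract (lattice_algebra_action q w a) 1 = evaluate (twist w) a"
proof -
  have "coeff_map (lattice_algebra_action q w a) = coeff_map (\<Sum>\<mu>\<in>Poly_Mapping.keys (coeff_map a).
      group_monom (linear_part w \<mu>) (Poly_Mapping.lookup (coeff_map a) \<mu> * q powi (- \<lfloor>w 0 \<bullet> linear_part w \<mu>\<rfloor>)))"
    by (simp add: lattice_algebra_action_def coeff_map_sum group_monom_def)
  then have "lattice_algebra_action q w a = (\<Sum>\<mu>\<in>Poly_Mapping.keys (coeff_map a).
      group_monom (linear_part w \<mu>) (Poly_Mapping.lookup (coeff_map a) \<mu> * q powi (- \<lfloor>w 0 \<bullet> linear_part w \<mu>\<rfloor>)))"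
    by (simp only: coeff_map_inject)
  then show ?thesis
    by (simp add: Fract_sum Fract_group_monom evaluate_def twist_def scalar_mult qpow_def power_int_minus mult.assoc)
qed

lemma linear_part_inj:
  assumes "w \<in> W" shows "inj (linear_part w)"
proof -
  obtain u where "u \<circ> linear_part w = id" using finite_weyl_inverse[OF linear_part_finite[OF assms]] by blast
  then show ?thesis by (metis inj_on_id inj_on_imageI2)
qed

lemma lattice_algebra_action_nonzero:
  assumes "w \<in> W" "a \<noteq> 0" shows "lattice_algebra_action q w a \<noteq> 0"
proof -
  obtain \<mu> where \<mu>: "\<mu> \<in> Poly_Mapping.keys (coeff_map a)" using assms(2) keys_zero_iff by blast
  have inj: "linear_part w x = linear_part w y \<longleftrightarrow> x = y" for x y
    using linear_part_inj[OF assms(1)] by (auto dest: injD)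
  have "Poly_Mapping.lookup (coeff_map (lattice_algebra_action q w a)) (linear_part w \<mu>) =
      (\<Sum>x\<in>Poly_Mapping.keys (coeff_map a). if x = \<mu> then Poly_Mapping.lookup (coeff_map a) \<mu> * q powi (- \<lfloor>w 0 \<bullet> linear_part w \<mu>\<rfloor>) else 0)"
    unfolding lattice_algebra_action_def coeff_map_simps lookup_sum
    by (intro sum.cong) (auto simp: lookup_single when_def inj)
  also have "\<dots> = Poly_Mapping.lookup (coeff_map a) \<mu> * q powi (- \<lfloor>w 0 \<bullet> linear_part w \<mu>\<rfloor>)" using \<mu> by simp
  also have "\<dots> \<noteq> 0" using \<mu> q_nonzero by (simp add: in_keys_iff)
  finally show ?thesis by auto
qed

lemma evaluate_twist_nonzero:
  assumes "w \<in> W" "a \<in> supported L" "a \<noteq> 0" shows "evaluate (twist w) a \<noteq> 0"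
  using lattice_algebra_action_nonzero[OF assms(1,3)] lattice_algebra_action_evaluate[OF assms(1,2)]
  by (metis eq_fract(1) mult_zero_left mult.right_neutral one_neq_zero Zero_fract_def)

abbreviation (input) \<Q> :: "('a, 'f) fun_field set" where "\<Q> \<equiv> rational_functions \<Phi>"

lemma rational_action_eq:
  assumes "w \<in> W"
  shows "rational_action q \<Phi> w = semilinear_extension L (twist w) L (twist w)"
proof
  fix f
  have *: "Fract (lattice_algebra_action q w a) (lattice_algebra_action q w b) = evaluate (twist w) a / evaluate (twist w) b"
    if "a \<in> supported L" "b \<in> supported L" "b \<noteq> 0" for a b
    using that lattice_algebra_action_nonzero[OF assms, of b]
    by (simp flip: lattice_algebra_action_evaluate[OF assms])
  show "rational_action q \<Phi> w f = semilinear_extension L (twist w) L (twist w) f"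
    unfolding rational_action_def semilinear_extension_def lattice_algebra_supported
    by (rule arg_cong[where f = The], rule ext) (use * in \<open>metis\<close>)
qed

lemma semilinear_dataI:
  assumes "w \<in> W" "\<And>x y. x \<in> L \<Longrightarrow> y \<in> B \<Longrightarrow> x + y \<in> B" "\<And>x y. x \<in> L \<Longrightarrow> y \<in> B \<Longrightarrow> g (x + y) = twist w x * g y"
  shows "semilinear_data L (twist w) B g"
  by unfold_locales (use assms twist_add twist_0 evaluate_twist_nonzero in auto)

lemma semilinear_data_twist: "w \<in> W \<Longrightarrow> semilinear_data L (twist w) L (twist w)"
  by (rule semilinear_dataI) (auto simp: lattice_add twist_add)

abbreviation act :: "('a \<Rightarrow> 'a) \<Rightarrow> ('a, 'f) fun_field \<Rightarrow> ('a, 'f) fun_field" where "act w \<equiv> rational_action q \<Phi> w"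

lemma act_add: "w \<in> W \<Longrightarrow> f \<in> \<Q> \<Longrightarrow> g \<in> \<Q> \<Longrightarrow> act w (f + g) = act w f + act w g"
  unfolding rational_action_eq rational_functions_fractions
  by (rule semilinear_data.ext_add[OF semilinear_data_twist])

lemma act_mult: "w \<in> W \<Longrightarrow> f \<in> \<Q> \<Longrightarrow> g \<in> \<Q> \<Longrightarrow> act w (f * g) = act w f * act w g"
  unfolding rational_action_eq rational_functions_fractions
  by (rule semilinear_data.ext_mult[OF semilinear_data_twist])

lemma act_scalar: "w \<in> W \<Longrightarrow> act w (scalar z) = scalar z"
  unfolding rational_action_eq by (rule semilinear_data.act_scalar[OF semilinear_data_twist])

lemma act_one: "w \<in> W \<Longrightarrow> act w 1 = 1"
  using act_scalar[of w 1] by simp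

lemma act_zero: "w \<in> W \<Longrightarrow> act w 0 = 0"
  using act_scalar[of w 0] by simp

lemma act_monomial: "w \<in> W \<Longrightarrow> \<mu> \<in> L \<Longrightarrow> act w (monomial \<mu>) = twist w \<mu>"
  unfolding rational_action_eq by (rule semilinear_data.ext_monomial[OF semilinear_data_twist])

lemma Q_scalar: "scalar z \<in> \<Q>" unfolding rational_functions_fractions by (rule fractions_scalar)
lemma Q_one: "1 \<in> \<Q>" using Q_scalar[of 1] by simp
lemma Q_zero: "0 \<in> \<Q>" using Q_scalar[of 0] by simp
lemma Q_mult: "f \<in> \<Q> \<Longrightarrow> g \<in> \<Q> \<Longrightarrow> f * g \<in> \<Q>"
  unfolding rational_functions_fractions using fractions_mult[OF lattice_add] by blast
lemma Q_add: "f \<in> \<Q> \<Longrightarrow> g \<in> \<Q> \<Longrightarrow> f + g \<in> \<Q>"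
  unfolding rational_functions_fractions using fractions_add[OF lattice_add] by blast
lemma Q_minus: "f \<in> \<Q> \<Longrightarrow> - f \<in> \<Q>"
  unfolding rational_functions_fractions using fractions_minus[OF lattice_add] by blast
lemma Q_diff: "f \<in> \<Q> \<Longrightarrow> g \<in> \<Q> \<Longrightarrow> f - g \<in> \<Q>"
  using Q_add[of f "- g"] Q_minus by simp
lemma Q_inverse: "f \<in> \<Q> \<Longrightarrow> inverse f \<in> \<Q>"
  unfolding rational_functions_fractions by (rule fractions_inverse)
lemma Q_divide: "f \<in> \<Q> \<Longrightarrow> g \<in> \<Q> \<Longrightarrow> f / g \<in> \<Q>"
  unfolding divide_inverse by (intro Q_mult Q_inverse)
lemma Q_monomial: "\<mu> \<in> L \<Longrightarrow> monomial \<mu> \<in> \<Q>"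
  unfolding rational_functions_fractions using fractions_monomial[OF lattice_add] by blast
lemma Q_power: "f \<in> \<Q> \<Longrightarrow> f ^ n \<in> \<Q>"
  by (induction n) (auto intro: Q_one Q_mult)
lemma Q_powi: "f \<in> \<Q> \<Longrightarrow> f powi n \<in> \<Q>"
  by (simp add: power_int_def Q_power Q_inverse)

lemma twist_Q: "w \<in> W \<Longrightarrow> \<mu> \<in> L \<Longrightarrow> twist w \<mu> \<in> \<Q>"
  unfolding twist_def using finite_weyl_lattice linear_part_finite by (intro Q_mult Q_scalar Q_monomial) blast

lemma act_Q: "w \<in> W \<Longrightarrow> f \<in> \<Q> \<Longrightarrow> act w f \<in> \<Q>"
  unfolding rational_action_eq rational_functions_fractions
  by (rule semilinear_data.ext_in[OF semilinear_data_twist])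
     (use twist_Q lattice_add in \<open>auto simp: rational_functions_fractions\<close>)

lemma act_inverse: "w \<in> W \<Longrightarrow> f \<in> \<Q> \<Longrightarrow> act w (inverse f) = inverse (act w f)"
proof (cases "f = 0")
  case False
  assume "w \<in> W" "f \<in> \<Q>"
  then have "act w f * act w (inverse f) = 1"
    using act_mult[of w f "inverse f"] Q_inverse act_one False by simp
  then show ?thesis by (metis inverse_unique)
qed (simp add: act_zero)

lemma act_divide: "w \<in> W \<Longrightarrow> f \<in> \<Q> \<Longrightarrow> g \<in> \<Q> \<Longrightarrow> act w (f / g) = act w f / act w g"
  by (simp add: divide_inverse act_mult act_inverse Q_inverse)

lemma act_minus: "w \<in> W \<Longrightarrow> f \<in> \<Q> \<Longrightarrow> act w (- f) = - act w f"
  using act_mult[of w "scalar (- 1)" f] act_scalar[of w "- 1"] Q_scalar[of "- 1"] by (simp add: scalar_minus)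

lemma act_diff: "w \<in> W \<Longrightarrow> f \<in> \<Q> \<Longrightarrow> g \<in> \<Q> \<Longrightarrow> act w (f - g) = act w f - act w g"
  using act_add[of w f "- g"] by (simp add: act_minus Q_minus)

lemma act_power: "w \<in> W \<Longrightarrow> f \<in> \<Q> \<Longrightarrow> act w (f ^ n) = act w f ^ n"
  by (induction n) (auto simp: act_one act_mult Q_power)

lemma act_powi: "w \<in> W \<Longrightarrow> f \<in> \<Q> \<Longrightarrow> act w (f powi n) = act w f powi n"
  by (simp add: power_int_def act_power act_inverse Q_inverse)

lemma act_sum: "w \<in> W \<Longrightarrow> (\<And>i. i \<in> I \<Longrightarrow> f i \<in> \<Q>) \<Longrightarrow> act w (sum f I) = (\<Sum>i\<in>I. act w (f i))"
proof (induction I rule: infinite_finite_induct)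
  case (insert x F)
  have "sum f F \<in> \<Q>" using insert
    unfolding rational_functions_fractions by (intro fractions_sum lattice_add) auto
  then show ?case using insert by (simp add: act_add)
qed (auto simp: act_zero)

lemma act_twist:
  assumes u: "u \<in> W" and w: "w \<in> W" and \<mu>: "\<mu> \<in> L"
  shows "act u (twist w \<mu>) = twist (u \<circ> w) \<mu>"
proof -
  let ?u = "linear_part u" and ?w = "linear_part w"
  have wL: "?w \<mu> \<in> L" using finite_weyl_lattice linear_part_finite w \<mu> by blast
  have "act u (twist w \<mu>) = scalar (inverse (qpow (w 0 \<bullet> ?w \<mu>))) * twist u (?w \<mu>)"
    unfolding twist_def[of w] using u wL by (simp add: act_mult act_scalar act_monomial Q_scalar Q_monomial)
  also have "\<dots> = scalar (inverse (qpow (u 0 \<bullet> ?u (?w \<mu>) + w 0 \<bullet> ?w \<mu>))) * monomial (?u (?w \<mu>))"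
    using at_0_integral[OF u wL] at_0_integral[OF w \<mu>]
    by (simp add: twist_def qpow_add scalar_mult mult_ac)
  also have "u 0 \<bullet> ?u (?w \<mu>) + w 0 \<bullet> ?w \<mu> = (u 0 + ?u (w 0)) \<bullet> ?u (?w \<mu>)"
    using finite_weyl_inner[OF linear_part_finite[OF u]] by (simp add: inner_add_left)
  finally show ?thesis
    unfolding twist_def[of "u \<circ> w"] linear_part_comp[OF u] comp_def[of ?u ?w] .
qed

lemma act_comp:
  assumes u: "u \<in> W" and w: "w \<in> W" and f: "f \<in> \<Q>"
  shows "act (u \<circ> w) f = act u (act w f)"
proof -
  obtain a b where ab: "f = Fract a b" "a \<in> supported L" "b \<in> supported L" "b \<noteq> 0"
    using f by (auto simp: rational_functions_fractions fractions_over_def)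
  have ev: "act u (evaluate (twist w) p) = evaluate (twist (u \<circ> w)) p \<and> evaluate (twist w) p \<in> \<Q>" if "p \<in> supported L" for p
  proof -
    have *: "x \<in> Poly_Mapping.keys (coeff_map p) \<Longrightarrow> x \<in> L" for x using that by (auto simp: supported_def)
    have "evaluate (twist w) p \<in> \<Q>" unfolding evaluate_def rational_functions_fractions
      using * w twist_Q by (intro fractions_sum fractions_mult fractions_scalar lattice_add) (auto simp: rational_functions_fractions)
    moreover have "act u (evaluate (twist w) p) = evaluate (twist (u \<circ> w)) p"
      unfolding evaluate_def using * u w
      by (subst act_sum) (auto intro!: Q_mult Q_scalar twist_Q sum.cong simp: act_mult act_scalar Q_scalar twist_Q act_twist)
    ultimately show ?thesis by blast
  qed
  have *: "act v f = evaluate (twist v) a / evaluate (twist v) b" if "v \<in> W" for v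
    unfolding ab(1) rational_action_eq[OF that]
    by (rule semilinear_data.ext_Fract[OF semilinear_data_twist[OF that] ab(2-4)])
  show ?thesis
    unfolding *[OF w] *[OF affine_weyl_comp[OF u w]]
    using ev[OF ab(2)] ev[OF ab(3)] act_divide[OF u] by simp
qed

lemma act_id: "f \<in> \<Q> \<Longrightarrow> act id f = f"
proof -
  assume f: "f \<in> \<Q>"
  obtain a b where ab: "f = Fract a b" "a \<in> supported L" "b \<in> supported L" "b \<noteq> 0"
    using f by (auto simp: rational_functions_fractions fractions_over_def)
  have t: "twist id = monomial" by (auto simp: twist_def)
  have "act id f = evaluate (twist id) a / evaluate (twist id) b"
    unfolding ab(1) rational_action_eq[OF affine_weyl_id]
    by (rule semilinear_data.ext_Fract[OF semilinear_data_twist[OF affine_weyl_id] ab(2-4)])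
  then show ?thesis using ab by (simp add: t evaluate_monomial)
qed

section \<open>The space of quasi-rational functions\<close>

abbreviation (input) \<D> :: "('a, 'f) fun_field set" where "\<D> \<equiv> quasi_rational \<Phi> c"

lemma quasi_rational_fractions: "quasi_rational \<Phi> c = fractions_over L Orb"
proof
  have tr: "x \<in> L \<Longrightarrow> y \<in> Orb \<Longrightarrow> x + y \<in> Orb" for x y by (rule orbit_translate)
  show "quasi_rational \<Phi> c \<subseteq> fractions_over L Orb"
    unfolding quasi_rational_def rational_functions_fractions
    by (auto intro!: fractions_sum[OF tr] fractions_mult[OF tr] fractions_monomial[OF tr])
  show "fractions_over L Orb \<subseteq> quasi_rational \<Phi> c"
    using fractions_as_sum unfolding quasi_rational_def rational_functions_fractions by blast
qed

lemma D_add: "m \<in> \<D> \<Longrightarrow> n \<in> \<D> \<Longrightarrow> m + n \<in> \<D>"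
  unfolding quasi_rational_fractions using fractions_add[OF orbit_translate] by blast
lemma D_mult: "f \<in> \<Q> \<Longrightarrow> n \<in> \<D> \<Longrightarrow> f * n \<in> \<D>"
  unfolding quasi_rational_fractions rational_functions_fractions using fractions_mult[OF orbit_translate] by blast
lemma D_zero: "0 \<in> \<D>"
  unfolding quasi_rational_fractions by (rule fractions_zero[OF orbit_translate])
lemma D_minus: "m \<in> \<D> \<Longrightarrow> - m \<in> \<D>"
  unfolding quasi_rational_fractions using fractions_minus[OF orbit_translate] by blast
lemma D_monomial: "y \<in> Orb \<Longrightarrow> monomial y \<in> \<D>"
  unfolding quasi_rational_fractions using fractions_monomial[OF orbit_translate] by blast

lemma D_induct [consumes 1, case_names zero add mult]:
  assumes "m \<in> \<D>" "P 0" "\<And>x y. x \<in> \<D> \<Longrightarrow> y \<in> \<D> \<Longrightarrow> P x \<Longrightarrow> P y \<Longrightarrow> P (x + y)"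
    "\<And>f y. f \<in> \<Q> \<Longrightarrow> y \<in> Orb \<Longrightarrow> P (f * monomial y)"
  shows "P m"
proof -
  have "m \<in> \<D> \<and> P m"
    using assms(1)[unfolded quasi_rational_fractions]
    by (induction rule: fractions_induct)
      (auto intro: assms D_zero D_add D_mult D_monomial simp: rational_functions_fractions)
  then show ?thesis ..
qed

end

section \<open>The operators of the simple reflections\<close>

lemma monomial_eqD:
  assumes "scalar z * monomial \<mu> = scalar w * monomial \<nu>" "z \<noteq> 0"
  shows "\<mu> = \<nu>"
proof -
  have "group_monom \<mu> z = group_monom \<nu> w"
    using assms(1) by (simp add: Fract_group_monom[symmetric] eq_fract)
  then have "Poly_Mapping.single \<mu> z = Poly_Mapping.single \<nu> w"
    by (metis coeff_map_simps(1) group_monom_def)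
  then have "Poly_Mapping.lookup (Poly_Mapping.single \<nu> w) \<mu> \<noteq> 0" using assms(2) by (metis lookup_single_eq)
  then show ?thesis by (auto simp: lookup_single when_def split: if_splits)
qed

context quasi_polynomial_data
begin

abbreviation "kp \<equiv> simple_parameter k \<alpha> \<phi>"
abbreviation "X \<equiv> coroot_monomial q \<alpha> \<phi>"
abbreviation "tw \<equiv> twisted_reflection q \<Phi> r \<alpha> \<phi> c t"

text \<open>The scalar factors by which \<open>X j\<close> and \<open>tw j y\<close> differ from monomials.\<close>

definition X_scalar :: "nat \<Rightarrow> 'f" where "X_scalar j = (if j = 0 then q_root q \<phi> else 1)"
definition tw_scalar :: "nat \<Rightarrow> 'a \<Rightarrow> 'f" where "tw_scalar j y = (if j = 0 then tp y (coroot \<phi>) else 1)"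

lemma X_eq: "X j = scalar (X_scalar j) * monomial (coroot (grad j))"
  by (simp add: coroot_monomial_def X_scalar_def gradient_def coroot_minus)

lemma X_scalar_nonzero [simp]: "X_scalar j \<noteq> 0"
  by (simp add: X_scalar_def)

lemma tw_eq: "tw j y = scalar (tw_scalar j y) * monomial (reflection (grad j) y)"
  by (simp add: twisted_reflection_def tw_scalar_def gradient_def reflection_neg_root)

lemma X_Q: "j \<in> {0..r} \<Longrightarrow> X j \<in> \<Q>"
  unfolding X_eq by (intro Q_mult Q_scalar Q_monomial lattice_coroot gradient_root)

lemma X_nonzero [simp]: "X j \<noteq> 0"
  by (simp add: X_eq)

lemma X_powi: "X j powi n = scalar (X_scalar j powi n) * monomial (of_int n *\<^sub>R coroot (grad j))"
  by (simp add: X_eq power_int_mult_distrib scalar_powi monomial_powi)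

lemma kp_nonzero: "j \<in> {0..r} \<Longrightarrow> kp j \<noteq> 0"
  using k_nonzero highest_root simple_roots by (auto simp: simple_parameter_def image_subset_iff)

lemma reflection_gradient_integral:
  "grad j \<bullet> y = of_int n \<Longrightarrow> reflection (grad j) y = y + of_int (- n) *\<^sub>R coroot (grad j)"
  by (simp add: reflection_def)

lemma twist_simple:
  assumes "j \<in> {0..r}" "\<mu> \<in> L" shows "twist (sr j) \<mu> = monomial \<mu> * X j powi (- \<lfloor>grad j \<bullet> \<mu>\<rfloor>)"
proof -
  have int: "grad j \<bullet> \<mu> = of_int \<lfloor>grad j \<bullet> \<mu>\<rfloor>"
    by (rule of_int_floor_Ints[OF root_lattice_integral[OF gradient_root[OF assms(1)] assms(2)], symmetric])
  have "inverse (qpow (sr j 0 \<bullet> reflection (grad j) \<mu>)) = X_scalar j powi (- \<lfloor>grad j \<bullet> \<mu>\<rfloor>)"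
  proof (cases "j = 0")
    case True
    have i: "\<phi> \<bullet> \<mu> \<in> \<int>" "coroot \<phi> \<bullet> \<mu> \<in> \<int>"
      using root_lattice_integral[OF highest_root assms(2)] lattice_integral lattice_coroot[OF highest_root] assms(2) by auto
    have "sr j 0 \<bullet> reflection (grad j) \<mu> = - (coroot \<phi> \<bullet> \<mu>)"
      using True reflection_inner_left[of \<phi> "coroot \<phi>" \<mu>] reflection_coroot[of \<phi> \<phi>]
      by (simp add: simple_reflection_def translation_def gradient_def reflection_neg_root reflection_self coroot_minus)
    then have "inverse (qpow (sr j 0 \<bullet> reflection (grad j) \<mu>)) = qpow (coroot \<phi> \<bullet> \<mu>)" using i by (simp add: qpow_minus)
    then show ?thesis using q_root_powi[OF highest_root assms(2)] True i(1)
      by (simp add: X_scalar_def gradient_def floor_minus_Ints)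
  next
    case False
    then show ?thesis by (simp add: X_scalar_def simple_reflection_def)
  qed
  then show ?thesis
    using reflection_gradient_integral[OF int]
    by (simp add: twist_def linear_part_simple X_powi monomial_add[symmetric] mult.left_commute)
qed

lemma act_X:
  assumes "i \<in> {0..r}" "j \<in> {0..r}"
  shows "act (sr i) (X j) = X j * X i powi (- \<lfloor>grad i \<bullet> coroot (grad j)\<rfloor>)"
proof -
  have l: "coroot (grad j) \<in> L" using assms lattice_coroot gradient_root by blast
  show ?thesis unfolding X_eq[of j]
    using assms l simple_reflection_affine[OF assms(1)]
    by (simp add: act_mult act_scalar Q_scalar Q_monomial act_monomial twist_simple)
qed

lemma act_X_self: "j \<in> {0..r} \<Longrightarrow> act (sr j) (X j) = inverse (X j)"
proof -
  assume j: "j \<in> {0..r}"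
  have "grad j \<bullet> coroot (grad j) = 2" using gradient_root[OF j] by (simp add: inner_coroot_self)
  then have "act (sr j) (X j) = X j * X j powi (- 2)" using act_X[OF j j] by simp
  also have "\<dots> = X j powi (1 + - 2)" unfolding power_int_add[OF disjI1[OF X_nonzero]] by simp
  finally show ?thesis by simp
qed

lemma act_X_powi: "j \<in> {0..r} \<Longrightarrow> act (sr j) (X j powi n) = X j powi (- n)"
  by (simp only: act_powi[OF simple_reflection_affine X_Q] act_X_self power_int_inverse power_int_minus)

definition denominator :: "nat \<Rightarrow> ('a, 'f) fun_field" where
  "denominator j = scalar (kp j) * X j - scalar (inverse (kp j))"

lemma denominator_Q: "j \<in> {0..r} \<Longrightarrow> denominator j \<in> \<Q>"
  unfolding denominator_def by (intro Q_diff Q_mult Q_scalar X_Q)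

lemma coroot_gradient_nonzero: "j \<in> {0..r} \<Longrightarrow> coroot (grad j) \<noteq> 0"
  using gradient_root[of j] by (simp add: coroot_def)

lemma denominator_nonzero: "j \<in> {0..r} \<Longrightarrow> denominator j \<noteq> 0"
proof
  assume j: "j \<in> {0..r}" and "denominator j = 0"
  then have "scalar (kp j * X_scalar j) * monomial (coroot (grad j)) = scalar (inverse (kp j)) * monomial 0"
    by (simp add: denominator_def X_eq scalar_mult mult.assoc)
  then have "coroot (grad j) = 0" by (rule monomial_eqD) (simp add: kp_nonzero[OF j])
  then show False using coroot_gradient_nonzero[OF j] by blast
qed

lemma X_not_1: "j \<in> {0..r} \<Longrightarrow> X j - 1 \<noteq> 0"
proof
  assume j: "j \<in> {0..r}" and "X j - 1 = 0"
  then have "scalar (X_scalar j) * monomial (coroot (grad j)) = scalar 1 * monomial 0"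
    by (simp add: X_eq)
  then have "coroot (grad j) = 0" by (rule monomial_eqD) simp
  then show False using coroot_gradient_nonzero[OF j] by blast
qed

text \<open>The right-hand side of the formula for \<open>s\<^sub>j\<close>.\<close>

definition simple_image :: "nat \<Rightarrow> 'a \<Rightarrow> ('a, 'f) fun_field" where
  "simple_image j y = scalar (kp j ^ of_bool (sval j y \<in> \<int>)) * (X j - 1) / denominator j * tw j y
     + scalar (kp j - inverse (kp j)) / denominator j * shifted_monomial q \<alpha> \<phi> j \<lfloor>grad j \<bullet> y\<rfloor> y"

lemma sval_integral_iff: "sval j y \<in> \<int> \<longleftrightarrow> grad j \<bullet> y \<in> \<int>"
  by (auto simp: affine_root_def)

lemma tw_scalar_nonzero: "y \<in> Orb \<Longrightarrow> tw_scalar j y \<noteq> 0"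
  using torus_nonzero[OF torus_point_torus] lattice_coroot highest_root by (auto simp: tw_scalar_def)

lemma orbit_reflection: "j \<in> {0..r} \<Longrightarrow> y \<in> Orb \<Longrightarrow> reflection (grad j) y \<in> Orb"
  using orbit_linear[OF simple_reflection_affine] by (simp add: linear_part_simple)

lemma tw_scalar_reflection: "j \<in> {0..r} \<Longrightarrow> y \<in> Orb \<Longrightarrow> tw_scalar j (reflection (grad j) y) * tw_scalar j y = 1"
proof (cases "j = 0")
  case True
  assume "y \<in> Orb"
  have "tp (reflection \<phi> y) (reflection \<phi> (- coroot \<phi>)) = tp y (- coroot \<phi>)"
    using \<open>y \<in> Orb\<close> highest_root lattice_coroot lattice_minus
    by (intro torus_point_linear finite_weyl_reflection) auto
  then have "tp (reflection \<phi> y) (coroot \<phi>) = inverse (tp y (coroot \<phi>))"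
    using torus_minus[OF torus_point_torus[OF \<open>y \<in> Orb\<close>] lattice_coroot[OF highest_root]]
    by (simp add: reflection_minus reflection_coroot reflection_self coroot_minus)
  then show ?thesis
    using True torus_nonzero[OF torus_point_torus[OF \<open>y \<in> Orb\<close>] lattice_coroot[OF highest_root]]
    by (simp add: tw_scalar_def gradient_def reflection_neg_root)
qed (simp add: tw_scalar_def)

text \<open>At points where the gradient takes an integral value, some affine root with this gradient vanishes, and
  \<open>t \<in> T\<^sub>J\<close> makes the twisted and the shifted monomial coincide.\<close>

lemma tw_integral:
  assumes "y \<in> Orb" "grad j \<bullet> y = of_int n" shows "tw j y = monomial y * X j powi (- n)"
proof -
  have "tw_scalar j y = X_scalar j powi (- n)"
  proof (cases "j = 0")
    case True
    then have "\<phi> \<bullet> y = of_int (- n)" using assms by (simp add: gradient_def minus_equation_iff)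
    then show ?thesis using torus_point_highest_root[OF assms(1)] True by (simp add: tw_scalar_def X_scalar_def)
  qed (simp add: tw_scalar_def X_scalar_def)
  then show ?thesis
    unfolding tw_eq X_powi reflection_gradient_integral[OF assms(2)] monomial_add by (simp only: mult.left_commute)
qed

lemma tw_add:
  assumes "j \<in> {0..r}" "\<mu> \<in> L" "y \<in> Orb" shows "tw j (\<mu> + y) = twist (sr j) \<mu> * tw j y"
proof -
  have "tw_scalar j (\<mu> + y) = inverse (qpow (sr j 0 \<bullet> reflection (grad j) \<mu>)) * tw_scalar j y"
  proof (cases "j = 0")
    case True
    have i: "coroot \<phi> \<bullet> \<mu> \<in> \<int>"
      using lattice_integral lattice_coroot[OF highest_root] assms(2) by auto
    have "sr j 0 \<bullet> reflection (grad j) \<mu> = - (coroot \<phi> \<bullet> \<mu>)"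
      using True reflection_inner_left[of \<phi> "coroot \<phi>" \<mu>] reflection_coroot[of \<phi> \<phi>]
      by (simp add: simple_reflection_def translation_def gradient_def reflection_neg_root reflection_self coroot_minus)
    then show ?thesis
      using True i torus_point_translate[OF assms(3) lattice_coroot[OF highest_root] assms(2)]
      by (simp add: tw_scalar_def qpow_minus inner_commute)
  qed (simp add: tw_scalar_def simple_reflection_def)
  then show ?thesis
    by (simp add: tw_eq twist_def linear_part_simple reflection_add monomial_add scalar_mult mult_ac)
qed

text \<open>The formula is compatible with \<open>x\<^sup>\<mu>\<^sup>+\<^sup>y = x\<^sup>\<mu> x\<^sup>y\<close>, which allows its semilinear extension.\<close>

lemma simple_image_add:
  assumes "j \<in> {0..r}" "\<mu> \<in> L" "y \<in> Orb" shows "simple_image j (\<mu> + y) = twist (sr j) \<mu> * simple_image j y"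
proof -
  have int: "grad j \<bullet> \<mu> \<in> \<int>" using root_lattice_integral[OF gradient_root[OF assms(1)] assms(2)] .
  have "grad j \<bullet> (\<mu> + y) \<in> \<int> \<longleftrightarrow> grad j \<bullet> y \<in> \<int>"
    using int by (simp add: inner_add_right)
  moreover have "\<lfloor>grad j \<bullet> (\<mu> + y)\<rfloor> = \<lfloor>grad j \<bullet> \<mu>\<rfloor> + \<lfloor>grad j \<bullet> y\<rfloor>"
    using int by (auto simp: inner_add_right elim!: Ints_cases)
  then have "shifted_monomial q \<alpha> \<phi> j \<lfloor>grad j \<bullet> (\<mu> + y)\<rfloor> (\<mu> + y) = twist (sr j) \<mu> * shifted_monomial q \<alpha> \<phi> j \<lfloor>grad j \<bullet> y\<rfloor> y"
    by (simp add: shifted_monomial_def twist_simple[OF assms(1,2)] monomial_add power_int_diff divide_inverse power_int_minus mult_ac)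
  ultimately show ?thesis
    unfolding simple_image_def sval_integral_iff tw_add[OF assms] by (simp add: algebra_simps)
qed

lemma simple_image_data: "j \<in> {0..r} \<Longrightarrow> semilinear_data L (twist (sr j)) Orb (simple_image j)"
  by (rule semilinear_dataI) (auto simp: simple_image_add orbit_translate simple_reflection_affine)

definition S :: "nat \<Rightarrow> ('a, 'f) fun_field \<Rightarrow> ('a, 'f) fun_field" where
  "S j = semilinear_extension L (twist (sr j)) Orb (simple_image j)"

lemma S_monomial: "j \<in> {0..r} \<Longrightarrow> y \<in> Orb \<Longrightarrow> S j (monomial y) = simple_image j y"
  unfolding S_def by (rule semilinear_data.ext_monomial[OF simple_image_data])

lemma S_add: "j \<in> {0..r} \<Longrightarrow> m \<in> \<D> \<Longrightarrow> n \<in> \<D> \<Longrightarrow> S j (m + n) = S j m + S j n"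
  unfolding S_def quasi_rational_fractions by (rule semilinear_data.ext_add[OF simple_image_data])

lemma S_mult: "j \<in> {0..r} \<Longrightarrow> f \<in> \<Q> \<Longrightarrow> m \<in> \<D> \<Longrightarrow> S j (f * m) = act (sr j) f * S j m"
  unfolding S_def quasi_rational_fractions rational_functions_fractions rational_action_eq[OF simple_reflection_affine]
  by (rule semilinear_data.ext_mult[OF simple_image_data])

lemma S_zero: "j \<in> {0..r} \<Longrightarrow> S j 0 = 0"
  unfolding S_def by (rule semilinear_data.ext_zero[OF simple_image_data])

lemma shifted_D: "j \<in> {0..r} \<Longrightarrow> y \<in> Orb \<Longrightarrow> shifted_monomial q \<alpha> \<phi> j n y \<in> \<D>"
  unfolding shifted_monomial_def mult.commute[of "monomial y"]
  by (intro D_mult Q_powi X_Q D_monomial)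

lemma tw_D: "j \<in> {0..r} \<Longrightarrow> y \<in> Orb \<Longrightarrow> tw j y \<in> \<D>"
  unfolding tw_eq by (intro D_mult Q_scalar D_monomial orbit_reflection)

lemma simple_image_D: "j \<in> {0..r} \<Longrightarrow> y \<in> Orb \<Longrightarrow> simple_image j y \<in> \<D>"
  unfolding simple_image_def
  by (intro D_add D_mult tw_D shifted_D Q_divide Q_mult Q_scalar Q_diff X_Q Q_one denominator_Q)

lemma S_closed:
  assumes j: "j \<in> {0..r}" and m: "m \<in> \<D>" shows "S j m \<in> \<D>"
  using m
proof (induction rule: D_induct)
  case zero
  then show ?case using S_zero[OF j] D_zero by simp
next
  case (add x y)
  then show ?case using S_add[OF j] D_add by simp
next
  case (mult f y)
  then show ?case
    using S_mult[OF j mult(1) D_monomial[OF mult(2)]] S_monomial[OF j mult(2)]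
      D_mult[OF act_Q[OF simple_reflection_affine[OF j] mult(1)] simple_image_D[OF j mult(2)]] by simp
qed

lemma simple_image_integral:
  assumes "j \<in> {0..r}" "y \<in> Orb" "grad j \<bullet> y = of_int n"
  shows "simple_image j y = monomial y * X j powi (- n)"
proof -
  let ?k = "kp j"
  have k: "?k \<noteq> 0" using kp_nonzero[OF assms(1)] .
  have "simple_image j y = (scalar ?k * (X j - 1) + scalar (?k - inverse ?k)) / denominator j * (monomial y * X j powi (- n))"
    using tw_integral[OF assms(2,3)] assms(3)
    by (simp add: simple_image_def sval_integral_iff shifted_monomial_def add_divide_distrib distrib_right)
  also have "scalar ?k * (X j - 1) + scalar (?k - inverse ?k) = denominator j"
    by (simp add: denominator_def scalar_diff right_diff_distrib)
  finally show ?thesis using denominator_nonzero[OF assms(1)] by simp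
qed

lemma act_denominator:
  assumes "j \<in> {0..r}"
  shows "act (sr j) (denominator j) = scalar (kp j) * inverse (X j) - scalar (inverse (kp j))"
  using simple_reflection_affine[OF assms]
  by (simp add: denominator_def act_diff act_mult act_scalar Q_scalar Q_mult X_Q[OF assms] act_X_self[OF assms])

lemma act_nonzero: "w \<in> W \<Longrightarrow> f \<in> \<Q> \<Longrightarrow> f \<noteq> 0 \<Longrightarrow> act w f \<noteq> 0"
  using act_mult[of w f "inverse f"] act_one[of w] Q_inverse[of f] by auto

text \<open>If the value of the gradient is not an integer, the floors at \<open>y\<close> and at its reflection add up to \<open>-1\<close>,
  and the coefficients of the two monomials in \<open>S j (S j x\<^sup>y)\<close> are computed.\<close>

lemma S_image:
  assumes j: "j \<in> {0..r}" and y: "y \<in> Orb"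
  shows "S j (simple_image j y) = monomial y"
proof (cases "grad j \<bullet> y \<in> \<int>")
  case True
  then obtain n where n: "grad j \<bullet> y = of_int n" by (elim Ints_cases)
  have "S j (simple_image j y) = act (sr j) (X j powi (- n)) * S j (monomial y)"
    unfolding simple_image_integral[OF assms n] mult.commute[of "monomial y"]
    by (intro S_mult j Q_powi X_Q D_monomial y)
  also have "act (sr j) (X j powi (- n)) = X j powi n"
    using act_X_powi[OF j, of "- n"] by simp
  also have "S j (monomial y) = monomial y * X j powi (- n)"
    using simple_image_integral[OF assms n] S_monomial[OF assms] by simp
  finally show ?thesis by (simp add: power_int_minus)
next
  case False
  let ?n = "\<lfloor>grad j \<bullet> y\<rfloor>" and ?y = "reflection (grad j) y" and ?X = "X j" and ?d = "denominator j"
  let ?h = "scalar (kp j - inverse (kp j)) :: ('a, 'f) fun_field"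
  have W: "sr j \<in> W" using simple_reflection_affine[OF j] .
  have yO: "?y \<in> Orb" using orbit_reflection[OF assms] .
  have v: "grad j \<bullet> ?y = - (grad j \<bullet> y)"
    using reflection_inner_left[of "grad j" "grad j" y] by (simp add: reflection_self)
  have fl: "\<lfloor>- (grad j \<bullet> y)\<rfloor> = - ?n - 1"
  proof -
    have "grad j \<bullet> y \<noteq> of_int ?n" using False by (metis Ints_of_int)
    then show ?thesis by (simp add: floor_minus ceiling_altdef)
  qed
  have im: "simple_image j y = (?X - 1) / ?d * (scalar (tw_scalar j y) * monomial ?y) + ?h / ?d * ?X powi (- ?n) * monomial y"
    using False by (simp add: simple_image_def sval_integral_iff tw_eq shifted_monomial_def)
  have tt: "scalar (tw_scalar j y) * (scalar (tw_scalar j ?y) * z) = z" for z :: "('a, 'f) fun_field"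
    using tw_scalar_reflection[OF assms] by (simp add: scalar_mult[symmetric] mult.assoc[symmetric] mult.commute)
  have im': "simple_image j ?y = (?X - 1) / ?d * (scalar (tw_scalar j ?y) * monomial y) + ?h / ?d * (?X powi ?n * ?X) * monomial ?y"
    using False v fl by (simp add: simple_image_def sval_integral_iff tw_eq shifted_monomial_def power_int_add)
  define d' where "d' = act (sr j) ?d"
  have d': "d' = scalar (kp j) * inverse ?X - scalar (inverse (kp j))" unfolding d'_def by (rule act_denominator[OF j])
  have d0: "?d \<noteq> 0" "d' \<noteq> 0"
    using denominator_nonzero[OF j] act_nonzero[OF W denominator_Q[OF j]] by (auto simp: d'_def)
  have Q1: "(?X - 1) / ?d \<in> \<Q>" and Q2: "?h / ?d * ?X powi (- ?n) \<in> \<Q>"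
    by (intro Q_mult Q_divide Q_scalar Q_diff Q_one Q_powi X_Q denominator_Q j)+
  have D1: "scalar (tw_scalar j y) * monomial ?y \<in> \<D>" by (intro D_mult Q_scalar D_monomial yO)
  have "S j (simple_image j y) = S j ((?X - 1) / ?d * (scalar (tw_scalar j y) * monomial ?y)) + S j (?h / ?d * ?X powi (- ?n) * monomial y)"
    unfolding im by (intro S_add j D_mult Q1 Q2 D1 D_monomial y)
  also have "S j (?h / ?d * ?X powi (- ?n) * monomial y) = act (sr j) (?h / ?d * ?X powi (- ?n)) * simple_image j y"
    unfolding S_mult[OF j Q2 D_monomial[OF y]] S_monomial[OF j y] ..
  also have "S j ((?X - 1) / ?d * (scalar (tw_scalar j y) * monomial ?y)) = act (sr j) ((?X - 1) / ?d) * (scalar (tw_scalar j y) * simple_image j ?y)"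
    unfolding S_mult[OF j Q1 D1] S_mult[OF j Q_scalar D_monomial[OF yO]] S_monomial[OF j yO] act_scalar[OF W] ..
  also have "act (sr j) ((?X - 1) / ?d) = (inverse ?X - 1) / d'"
    using j W by (simp add: act_divide act_diff act_one Q_diff Q_one X_Q denominator_Q act_X_self d'_def)
  also have "act (sr j) (?h / ?d * ?X powi (- ?n)) = ?h / d' * ?X powi ?n"
    using act_X_powi[OF j, of "- ?n"] act_mult[OF W Q_divide[OF Q_scalar denominator_Q[OF j]] Q_powi[OF X_Q[OF j]]]
      act_divide[OF W Q_scalar denominator_Q[OF j]] by (simp only: act_scalar[OF W] d'_def minus_minus)
  also have "(inverse ?X - 1) / d' * (scalar (tw_scalar j y) * simple_image j ?y) + ?h / d' * ?X powi ?n * simple_image j y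
     = ((inverse ?X - 1) * (?X - 1) + ?h * ?h) / (?d * d') * monomial y
     + ?h * ?X powi ?n / (?d * d') * ((inverse ?X - 1) * ?X + (?X - 1)) * (scalar (tw_scalar j y) * monomial ?y)"
  proof -
    have g: "(x' - 1) / d' * (ta * ((x - 1) / d * (tb * m) + h / d * (xn * x) * m')) + h / d' * xn * ((x - 1) / d * (ta * m') + h / d * xm * m)
      = ((x' - 1) * (x - 1) + h * h) / (d * d') * m + h * xn / (d * d') * ((x' - 1) * x + (x - 1)) * (ta * m')"
      if "ta * (tb * m) = m" "xn * xm = 1" "d \<noteq> 0" "d' \<noteq> 0" for x x' d d' ta tb m m' h xn xm :: "('a, 'f) fun_field"
    proof -
      have 1: "(x' - 1) / d' * (ta * ((x - 1) / d * (tb * m))) = (x' - 1) * (x - 1) / (d * d') * (ta * (tb * m))"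
        by (simp add: mult_ac)
      have 2: "h / d' * xn * (h / d * xm * m) = h * h / (d * d') * (xn * xm) * m" by (simp add: mult_ac)
      have "(x' - 1) / d' * (ta * ((x - 1) / d * (tb * m) + h / d * (xn * x) * m')) + h / d' * xn * ((x - 1) / d * (ta * m') + h / d * xm * m)
        = (x' - 1) / d' * (ta * ((x - 1) / d * (tb * m))) + h / d' * xn * (h / d * xm * m)
          + h * xn / (d * d') * ((x' - 1) * x + (x - 1)) * (ta * m')"
        using that(3,4) by (simp add: distrib_left distrib_right) (simp add: field_simps)
      also have "\<dots> = ((x' - 1) * (x - 1) + h * h) / (d * d') * m + h * xn / (d * d') * ((x' - 1) * x + (x - 1)) * (ta * m')"
        unfolding 1 2 that(1,2) by (simp add: add_divide_distrib distrib_right)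
      finally show ?thesis .
    qed
    show ?thesis unfolding im im' by (rule g[OF tt _ d0]) (simp add: power_int_minus)
  qed
  also have "(inverse ?X - 1) * ?X + (?X - 1) = 0" by (simp add: algebra_simps)
  also have "(inverse ?X - 1) * (?X - 1) + ?h * ?h = ?d * d'"
  proof -
    let ?K = "scalar (kp j) :: ('a, 'f) fun_field" and ?K' = "scalar (inverse (kp j)) :: ('a, 'f) fun_field"
    have KK: "?K * ?K' = 1" using kp_nonzero[OF j] by (simp flip: scalar_mult)
    have g: "(x' - 1) * (x - 1) + (K - K') * (K - K') = (K * x - K') * (K * x' - K')"
      if "x * x' = 1" "K * K' = 1" for x x' K K' :: "('a, 'f) fun_field"
    proof -
      have "(x' - 1) * (x - 1) + (K - K') * (K - K') = x * x' - x' - x + 1 + K * K - (K * K' + K * K') + K' * K'"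
        by (simp add: algebra_simps)
      moreover have "(K * x - K') * (K * x' - K') = (K * K) * (x * x') - (K * K') * x - (K * K') * x' + K' * K'"
        by (simp add: algebra_simps)
      ultimately show ?thesis unfolding that by simp
    qed
    show ?thesis unfolding d' denominator_def scalar_diff using KK by (intro g) simp_all
  qed
  finally show ?thesis using d0 by simp
qed

lemma S_involution: "m \<in> \<D> \<Longrightarrow> j \<in> {0..r} \<Longrightarrow> S j (S j m) = m"
proof (induction rule: D_induct)
  case (mult f y)
  have "act (sr j) (act (sr j) f) = act (sr j \<circ> sr j) f"
    using mult act_comp simple_reflection_affine by metis
  also have "sr j \<circ> sr j = id" using mult by auto
  also have "act id f = f" by (rule act_id[OF mult(1)])
  finally have "act (sr j) (act (sr j) f) = f" .
  then show ?case
    using mult by (simp add: S_mult D_monomial S_monomial act_Q simple_reflection_affine simple_image_D S_image)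
qed (simp_all add: S_zero S_add S_closed)

section \<open>Dominant monomials\<close>

definition hecke_operator :: "nat \<Rightarrow> ('a, 'f) fun_field \<Rightarrow> ('a, 'f) fun_field" where
  "hecke_operator j m = S j m / ((X j - 1) / denominator j) - scalar (kp j - inverse (kp j)) / (X j - 1) * m"

text \<open>The constant by which the Hecke operator and the twisted reflection differ.\<close>

definition kappa :: "nat \<Rightarrow> real \<Rightarrow> 'f" where
  "kappa j v = (if v = 0 then kp j else if v = 1 then inverse (kp j) else 1)"

text \<open>In the strip \<open>0 \<le> D\<alpha>\<^sub>j \<le> 1\<close> the floor in the formula is 0 except at the upper end.  Inside the strip the second
  term is thus the one subtracted in the Hecke operator; at both ends the two monomials of the
  formula coincide, and the coefficients combine to a constant.\<close>

lemma hecke_operator_monomial: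
  assumes j: "j \<in> {0..r}" and y: "y \<in> Orb" and v: "0 \<le> grad j \<bullet> y" "grad j \<bullet> y \<le> 1"
  shows "hecke_operator j (monomial y) = scalar (kappa j (grad j \<bullet> y)) * tw j y"
proof -
  let ?X = "X j" and ?d = "denominator j" and ?v = "grad j \<bullet> y"
  let ?h = "scalar (kp j - inverse (kp j)) :: ('a, 'f) fun_field"
  have nz: "?X - 1 \<noteq> 0" "?d \<noteq> 0" using X_not_1[OF j] denominator_nonzero[OF j] .
  have S: "S j (monomial y) = simple_image j y" using S_monomial[OF j y] .
  consider "?v = 0" | "?v = 1" | "0 < ?v" "?v < 1" using v by linarith
  then show ?thesis
  proof cases
    case 1
    then have 0: "simple_image j y = monomial y" "tw j y = monomial y"
      using simple_image_integral[OF j y, of 0] tw_integral[OF y, of j 0] by simp_all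
    have "hecke_operator j (monomial y) = (?d - ?h) / (?X - 1) * monomial y"
    proof -
      have "m / (x / d) - h / x * m = (d - h) / x * m" for m x d h :: "('a, 'f) fun_field"
        unfolding diff_divide_distrib left_diff_distrib by (simp add: mult.commute)
      then show ?thesis unfolding hecke_operator_def S 0 .
    qed
    also have "?d - ?h = scalar (kp j) * (?X - 1)" by (simp add: denominator_def scalar_diff algebra_simps)
    finally show ?thesis using 1 nz by (simp add: kappa_def 0)
  next
    case 2
    then have 1: "simple_image j y = monomial y * inverse ?X" "tw j y = monomial y * inverse ?X"
      using simple_image_integral[OF j y, of 1] tw_integral[OF y, of j 1] by (simp_all add: power_int_minus)
    have g: "m * x' / ((x - 1) / d) - h / (x - 1) * m = (d - h * x) / (x - 1) * (m * x')"
      if "x * x' = 1" "x - 1 \<noteq> 0" "d \<noteq> 0" for m x x' d h :: "('a, 'f) fun_field"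
    proof -
      have "h / (x - 1) * m = h * x / (x - 1) * (m * x')" using that by (simp add: mult.assoc mult.left_commute)
      moreover have "m * x' / ((x - 1) / d) = d / (x - 1) * (m * x')" by simp
      ultimately show ?thesis by (simp add: diff_divide_distrib left_diff_distrib)
    qed
    have "hecke_operator j (monomial y) = (?d - ?h * ?X) / (?X - 1) * (monomial y * inverse ?X)"
      unfolding hecke_operator_def S 1 using nz by (intro g) simp_all
    also have "?d - ?h * ?X = scalar (inverse (kp j)) * (?X - 1)" by (simp add: denominator_def scalar_diff algebra_simps)
    finally show ?thesis using 2 nz by (simp add: kappa_def 1)
  next
    case 3
    then have fl: "\<lfloor>?v\<rfloor> = 0" by linarith
    have "?v \<notin> \<int>" using 3 by (auto elim!: Ints_cases)
    then have "simple_image j y = (?X - 1) / ?d * tw j y + ?h / ?d * monomial y"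
      using fl by (simp add: simple_image_def sval_integral_iff shifted_monomial_def)
    then have "hecke_operator j (monomial y) = tw j y"
    proof -
      have "(x / d * w + h / d * m) / (x / d) - h / x * m = w" if "x \<noteq> 0" "d \<noteq> 0" for m w x d h :: "('a, 'f) fun_field"
        using that by (simp add: field_simps)
      then show ?thesis unfolding hecke_operator_def S \<open>simple_image j y = _\<close> using nz by blast
    qed
    then show ?thesis using 3 by (simp add: kappa_def)
  qed
qed

lemma hecke_operator_scalar:
  assumes "j \<in> {0..r}" "m \<in> \<D>" shows "hecke_operator j (scalar z * m) = scalar z * hecke_operator j m"
  using assms S_mult[OF assms(1) Q_scalar assms(2)] simple_reflection_affine[OF assms(1)]
  by (simp add: hecke_operator_def act_scalar right_diff_distrib mult.left_commute)

text \<open>The term to which a word for \<open>w\<close> in the twisted reflections takes \<open>x\<^sup>y\<close>.  With \<open>w = \<tau>(\<nu>) v\<close> the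
  scalar is the value of \<open>t\<^bsub>v y\<^esub>\<close> at \<open>-\<nu>\<close>; as it depends only on \<open>w\<close>, the twisted
  reflections satisfy the braid relations.\<close>

definition twisted :: "('a \<Rightarrow> 'a) \<Rightarrow> 'a \<Rightarrow> ('a, 'f) fun_field" where
  "twisted w y = scalar (tp (linear_part w y) (- w 0)) * monomial (linear_part w y)"

lemma twisted_id: "y \<in> Orb \<Longrightarrow> twisted id y = monomial y"
  using torus_zero[OF torus_point_torus] by (simp add: twisted_def)

lemma twisted_step:
  assumes j: "j \<in> {0..r}" and w: "w \<in> W" and y: "y \<in> Orb"
  shows "twisted (sr j \<circ> w) y = scalar (tp (linear_part w y) (- w 0)) * tw j (linear_part w y)"
proof -
  let ?z = "linear_part w y" and ?s = "reflection (grad j)"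
  have z: "?z \<in> Orb" using orbit_linear w y by blast
  have s: "?s \<in> finite_weyl \<Phi>" using finite_weyl_reflection gradient_root[OF j] by blast
  have wL: "- w 0 \<in> L" using lattice_minus at_0_lattice w by blast
  have sz: "?s ?z \<in> Orb" using orbit_reflection[OF j z] .
  have lin: "linear_part (sr j \<circ> w) = ?s \<circ> linear_part w" "(sr j \<circ> w) 0 = sr j 0 + ?s (w 0)"
    using linear_part_comp[OF simple_reflection_affine[OF j]] by (simp_all add: linear_part_simple)
  have 1: "tp (?s ?z) (?s (- w 0)) = tp ?z (- w 0)" by (rule torus_point_linear[OF s z wL])
  have "tp (?s ?z) (- (sr j 0 + ?s (w 0))) = tw_scalar j ?z * tp ?z (- w 0)"
  proof (cases "j = 0")
    case True
    have "sr j 0 = coroot \<phi>" using True by (simp add: simple_reflection_def translation_def)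
    then have e: "- (sr j 0 + ?s (w 0)) = ?s (coroot \<phi>) + ?s (- w 0)"
      using True by (simp add: gradient_def reflection_neg_root reflection_coroot reflection_self coroot_minus reflection_minus)
    have "tp (?s ?z) (?s (coroot \<phi>) + ?s (- w 0)) = tp (?s ?z) (?s (coroot \<phi>)) * tp (?s ?z) (?s (- w 0))"
      using torus_add[OF torus_point_torus[OF sz]] finite_weyl_lattice[OF s] wL lattice_coroot[OF highest_root] by blast
    also have "tp (?s ?z) (?s (coroot \<phi>)) = tp ?z (coroot \<phi>)" by (rule torus_point_linear[OF s z lattice_coroot[OF highest_root]])
    finally show ?thesis unfolding e using True 1 by (simp add: tw_scalar_def)
  next
    case False
    then show ?thesis using 1 by (simp add: tw_scalar_def simple_reflection_def reflection_minus)
  qed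
  then show ?thesis
    unfolding twisted_def lin tw_eq by (simp add: scalar_mult mult_ac)
qed

text \<open>The letters of the word together with the values of their gradients at the successive exponents.\<close>

fun walk :: "nat list \<Rightarrow> 'a \<Rightarrow> (nat \<times> real) list" where
  "walk [] y = []"
| "walk (j # js) y = (j, grad j \<bullet> y) # walk js (reflection (grad j) y)"

definition walk_factor :: "nat list \<Rightarrow> 'a \<Rightarrow> 'f" where
  "walk_factor js y = prod_list (map (\<lambda>(j, v). kappa j v) (walk js y))"

lemma fold_hecke_operator:
  assumes "set js \<subseteq> {0..r}" "w \<in> W" "y \<in> Orb" "\<forall>(j, v)\<in>set (walk js (linear_part w y)). 0 \<le> v \<and> v \<le> 1"
  shows "fold hecke_operator js (scalar z * twisted w y) = scalar (z * walk_factor js (linear_part w y)) * twisted (word (rev js) \<circ> w) y"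
  using assms
proof (induction js arbitrary: w z)
  case Nil
  then show ?case by (simp add: walk_factor_def)
next
  case (Cons j js)
  let ?z = "linear_part w y"
  have j: "j \<in> {0..r}" "set js \<subseteq> {0..r}" using Cons.prems by auto
  have zO: "?z \<in> Orb" using orbit_linear Cons.prems by blast
  have v: "0 \<le> grad j \<bullet> ?z" "grad j \<bullet> ?z \<le> 1" using Cons.prems(4) by auto
  have sW: "sr j \<circ> w \<in> W" using affine_weyl_comp simple_reflection_affine j Cons.prems by blast
  have lin: "linear_part (sr j \<circ> w) y = reflection (grad j) ?z"
    using linear_part_comp(1)[OF simple_reflection_affine[OF j(1)], of w] by (simp add: linear_part_simple)
  have "hecke_operator j (scalar z * twisted w y) = scalar (z * kappa j (grad j \<bullet> ?z)) * twisted (sr j \<circ> w) y"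
  proof -
    have "hecke_operator j (scalar z * twisted w y) = scalar z * (scalar (tp ?z (- w 0)) * hecke_operator j (monomial ?z))"
      unfolding twisted_def[of w] using j zO by (simp add: hecke_operator_scalar D_mult Q_scalar D_monomial)
    also have "hecke_operator j (monomial ?z) = scalar (kappa j (grad j \<bullet> ?z)) * tw j ?z" by (rule hecke_operator_monomial[OF j(1) zO v])
    finally show ?thesis unfolding twisted_step[OF j(1) Cons.prems(2,3)] by (simp only: scalar_mult mult_ac)
  qed
  then have "fold hecke_operator (j # js) (scalar z * twisted w y) = fold hecke_operator js (scalar (z * kappa j (grad j \<bullet> ?z)) * twisted (sr j \<circ> w) y)"
    by simp
  also have "\<dots> = scalar (z * kappa j (grad j \<bullet> ?z) * walk_factor js (reflection (grad j) ?z)) * twisted (word (rev js) \<circ> (sr j \<circ> w)) y"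
  proof -
    have "\<forall>(j, v)\<in>set (walk js (reflection (grad j) ?z)). 0 \<le> v \<and> v \<le> 1" using Cons.prems(4) by simp
    then show ?thesis by (rule Cons.IH[OF j(2) sW Cons.prems(3), unfolded lin])
  qed
  also have "word (rev js) \<circ> (sr j \<circ> w) = word (rev (j # js)) \<circ> w" by (auto simp: word_append)
  finally show ?case by (simp add: walk_factor_def mult.assoc del: word_simps)
qed

end

section \<open>The braid relations\<close>

lemma alternating_snoc: "alternating i j (Suc n) = alternating i j n @ [if even n then i else j]"
  by (induction n arbitrary: i j) auto

context quasi_polynomial_data
begin

text \<open>The values are those of roots at points of \<open>W\<^sub>0 c\<close>, hence of roots at \<open>c\<close>.\<close>

lemma walk_bounded:
  assumes "set js \<subseteq> {0..r}" "v \<in> finite_weyl \<Phi>" "(j, x) \<in> set (walk js (v c))"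
  shows "\<bar>x\<bar> \<le> 1"
  using assms
proof (induction js arbitrary: v)
  case (Cons i js)
  have i: "grad i \<in> \<Phi>" using gradient_root Cons.prems by auto
  obtain u where u: "u \<in> finite_weyl \<Phi>" "v \<circ> u = id" using finite_weyl_inverse Cons.prems by blast
  have "grad i \<bullet> v c = u (grad i) \<bullet> c"
    using finite_weyl_inner[OF Cons.prems(2), of "u (grad i)" c] u by (metis comp_apply id_apply)
  then have "\<bar>grad i \<bullet> v c\<bar> \<le> 1" using root_at_c[OF finite_weyl_root[OF u(1) i]] by simp
  moreover have "\<bar>x\<bar> \<le> 1" if "(j, x) \<in> set (walk js (reflection (grad i) (v c)))"
  proof (rule Cons.IH[OF _ finite_weyl.intros(2)[OF i Cons.prems(2)]])
    show "set js \<subseteq> {0..r}" using Cons.prems(1) by simp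
    show "(j, x) \<in> set (walk js ((reflection (grad i) \<circ> v) c))" using that by simp
  qed
  ultimately show ?case using Cons.prems(3) by auto
qed simp

text \<open>Simple affine roots with bond 3 have gradients of the same length.\<close>

lemma kappa_eq:
  assumes b: "bond i j m" and m: "m = 3"
  shows "kappa i = kappa j"
proof -
  obtain N M where NM: "grad j \<bullet> coroot (grad i) = - N" "grad i \<bullet> coroot (grad j) = - M"
    "(N, M, m) \<in> {(0, 0, 2), (1, 1, 3), (1, 2, 4), (2, 1, 4), (1, 3, 6), (3, 1, 6)}"
    using bond_cases[OF b] by blast
  have ij: "i \<in> {0..r}" "j \<in> {0..r}" using b by (auto simp: bond_def)
  have N: "N = 1" "M = 1" using NM(3) m by auto
  have "2 * (grad i \<bullet> grad j) / (norm (grad i))\<^sup>2 = -1" "2 * (grad i \<bullet> grad j) / (norm (grad j))\<^sup>2 = -1"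
    using NM(1,2) N by (simp_all add: coroot_def inner_commute)
  moreover have "(norm (grad i))\<^sup>2 \<noteq> 0" "(norm (grad j))\<^sup>2 \<noteq> 0" using ij gradient_root by auto
  ultimately have "(norm (grad i))\<^sup>2 = (norm (grad j))\<^sup>2" by (simp add: field_simps)
  then have n: "norm (grad i) = norm (grad j)" by simp
  define root where "root l = (if l = 0 then \<phi> else \<alpha> l)" for l
  have "root l \<in> \<Phi> \<and> norm (root l) = norm (grad l) \<and> kp l = k (root l)" if "l \<in> {0..r}" for l
    using that simple_roots highest_root by (auto simp: root_def gradient_def simple_parameter_def)
  then have "kp i = kp j" using k_norm[of "root i" "root j"] n ij by simp
  then show ?thesis by (simp add: kappa_def fun_eq_iff)
qed

text \<open>Along both words the values are those of the positive roots of rank two at \<open>z\<close>, in opposite orders.  They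
  are nonnegative.  For even \<open>m\<close> a root comes with the same letter in both words, and for \<open>m = 3\<close> both
  letters have the same constants, so the products of the constants agree.\<close>

lemma walk_alternating:
  assumes b: "bond i j m" and z: "0 \<le> grad i \<bullet> z" "0 \<le> grad j \<bullet> z"
  shows "\<forall>(l, x)\<in>set (walk (alternating i j m) z). 0 \<le> x"
    and "walk_factor (alternating i j m) z = walk_factor (alternating j i m) z"
proof -
  obtain N M where NM: "grad j \<bullet> coroot (grad i) = - N" "grad i \<bullet> coroot (grad j) = - M"
    "(N, M, m) \<in> {(0, 0, 2), (1, 1, 3), (1, 2, 4), (2, 1, 4), (1, 3, 6), (3, 1, 6)}"
    using bond_cases[OF b] by blast
  have ij: "i \<in> {0..r}" "j \<in> {0..r}" using b by (auto simp: bond_def)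
  have gi: "grad i \<bullet> coroot (grad i) = 2" "grad j \<bullet> coroot (grad j) = 2"
    using ij gradient_root by (auto simp: inner_coroot_self)
  have *: "grad i \<bullet> reflection (grad i) y = - (grad i \<bullet> y)" "grad j \<bullet> reflection (grad j) y = - (grad j \<bullet> y)"
    "grad j \<bullet> reflection (grad i) y = grad j \<bullet> y + (grad i \<bullet> y) * N"
    "grad i \<bullet> reflection (grad j) y = grad i \<bullet> y + (grad j \<bullet> y) * M" for y
    using gi NM by (simp_all add: reflection_def inner_diff_right)
  show "\<forall>(l, x)\<in>set (walk (alternating i j m) z). 0 \<le> x"
    using NM(3) z by (auto simp: *)
  have k: "kappa i = kappa j" if "m = 3" using kappa_eq[OF b that] .
  show "walk_factor (alternating i j m) z = walk_factor (alternating j i m) z"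
    using NM(3) k by (auto simp: walk_factor_def * algebra_simps)
qed

lemma coroots_independent:
  assumes "bond i j m" "of_int a *\<^sub>R coroot (grad i) + of_int b *\<^sub>R coroot (grad j) = 0"
  shows "a = 0 \<and> b = 0"
proof -
  obtain N M where NM: "grad j \<bullet> coroot (grad i) = - N" "grad i \<bullet> coroot (grad j) = - M"
    "(N, M, m) \<in> {(0, 0, 2), (1, 1, 3), (1, 2, 4), (2, 1, 4), (1, 3, 6), (3, 1, 6)}"
    using bond_cases[OF assms(1)] by blast
  have ij: "i \<in> {0..r}" "j \<in> {0..r}" using assms by (auto simp: bond_def)
  have gi: "grad i \<bullet> coroot (grad i) = 2" "grad j \<bullet> coroot (grad j) = 2"
    using ij gradient_root by (auto simp: inner_coroot_self)
  have "of_int a * 2 - of_int b * M = 0" "of_int b * 2 - of_int a * N = 0"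
    using arg_cong[OF assms(2), of "\<lambda>x. grad i \<bullet> x"] arg_cong[OF assms(2), of "\<lambda>x. grad j \<bullet> x"] gi NM(1,2)
    by (simp_all add: inner_add_right)
  then have "of_int a = (0::real) \<and> of_int b = (0::real)" using NM(3) by auto
  then show ?thesis by simp
qed

text \<open>The braid relation on a monomial whose exponent is dominant for both reflections.  There the
  products of the Hecke operators in the two orders both give the twisted monomial of the longest
  element, with the same constant.\<close>

lemma braid_dominant:
  assumes b: "bond i j m" and v: "v \<in> finite_weyl \<Phi>"
    and z: "0 \<le> grad i \<bullet> v c" "0 \<le> grad j \<bullet> v c"
  shows "foldr S (alternating i j m) (monomial (v c)) = foldr S (alternating j i m) (monomial (v c))"
proof -
  have *: "foldr S (alternating i j m) (monomial (v c)) = foldr S (alternating j i m) (monomial (v c))"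
    if b: "bond i j m" and z: "0 \<le> grad i \<bullet> v c" "0 \<le> grad j \<bullet> v c"
      and NM: "grad j \<bullet> coroot (grad i) = - of_int N" "grad i \<bullet> coroot (grad j) = - of_int M"
        "(M, N, m) \<in> {(0, 0, 2), (1, 1, 3), (2, 1, 4), (3, 1, 6)}" for i j and N M :: int
  proof -
    have ij: "i \<in> {0..r}" "j \<in> {0..r}" using b by (auto simp: bond_def)
    define s where "s l = (if l then i else j)" for l
    have s: "s l \<in> {0..r}" "sr (s l) \<in> W" for l using ij simple_reflection_affine by (auto simp: s_def)
    have fl: "\<lfloor>grad i \<bullet> coroot (grad j)\<rfloor> = - M" "\<lfloor>grad j \<bullet> coroot (grad i)\<rfloor> = - N"
      unfolding NM(1,2) by (simp_all flip: of_int_minus)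
    \<comment> \<open>The label \<open>True\<close> is the letter whose \<open>n\<close> may exceed 1.\<close>
    interpret R: rank_two_operators "\<lambda>l. S (s l)" "\<lambda>l. act (sr (s l))" "\<Q>" "\<D>" "\<lambda>l. X (s l)"
      "\<lambda>l. scalar (kp (s l))" "\<lambda>l. if l then M else N"
    proof
      show "act (sr (s l)) (X (s (\<not> l))) = X (s (\<not> l)) * X (s l) powi (if l then M else N)" for l
        using act_X[OF s(1) s(1), of l "\<not> l"] fl by (cases l) (simp_all add: s_def)
      show "X (s True) powi a * X (s False) powi b = 1 \<Longrightarrow> a = 0 \<and> b = 0" for a b
      proof -
        assume "X (s True) powi a * X (s False) powi b = 1"
        then have "scalar (X_scalar i powi a * X_scalar j powi b) * monomial (of_int a *\<^sub>R coroot (grad i) + of_int b *\<^sub>R coroot (grad j)) = scalar 1 * monomial 0"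
          by (simp add: s_def X_powi scalar_mult monomial_add mult_ac)
        then have "of_int a *\<^sub>R coroot (grad i) + of_int b *\<^sub>R coroot (grad j) = 0"
          by (rule monomial_eqD) simp
        then show "a = 0 \<and> b = 0" by (rule coroots_independent[OF \<open>bond i j m\<close>])
      qed
      show "scalar (kp (s l)) * X (s l) - inverse (scalar (kp (s l))) \<noteq> 0" for l
        using denominator_nonzero[OF s(1)] by (simp add: denominator_def scalar_inverse)
    qed (auto simp: act_add[OF s(2)] act_mult[OF s(2)] act_one[OF s(2)] act_scalar[OF s(2)] S_add[OF s(1)] S_mult[OF s(1)]
          S_involution[OF _ s(1)] kp_nonzero[OF s(1)] act_X_self[OF s(1)]
        intro: Q_add Q_minus Q_mult Q_inverse Q_zero Q_one Q_scalar D_zero D_add D_mult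
          X_Q[OF s(1)] act_Q[OF s(2)] S_closed[OF s(1)])
    have L: "R.L l x = hecke_operator (s l) x" for l x
      by (simp add: R.L_def R.A_def R.P_def R.h_def hecke_operator_def denominator_def scalar_inverse scalar_diff)
    have chain: "R.chain l e n = fold hecke_operator (alternating (s l) (s (\<not> l)) n) e" for l e n
    proof (induction n)
      case (Suc n)
      have "R.chain l e (Suc n) = hecke_operator (s (letter l n)) (R.chain l e n)" by (simp add: L)
      also have "\<dots> = fold hecke_operator (alternating (s l) (s (\<not> l)) n @ [s (letter l n)]) e" using Suc by simp
      also have "s (letter l n) = (if even n then s l else s (\<not> l))" by (cases l) auto
      finally show ?case by (simp only: alternating_snoc)
    qed simp
    have s_values: "s True = i" "s False = j" by (simp_all add: s_def)
    note chain' = chain[of True, unfolded not_True_eq_False s_values] chain[of False, unfolded not_False_eq_True s_values]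
    have iter: "R.iter l e n = foldr S (alternating (s l) (s (\<not> l)) n) e" for l e n
      by (induction n arbitrary: l) auto
    have O: "v c \<in> Orb" using finite_in_affine[OF v] by (auto simp: weyl_orbit_def)
    have set: "set (alternating i j m) \<subseteq> {0..r}" "set (alternating j i m) \<subseteq> {0..r}"
      using set_alternating[of i j m] set_alternating[of j i m] ij by blast+
    have e: "monomial (v c) = scalar 1 * twisted id (v c)" by (simp add: twisted_id O)
    have strip: "\<forall>(l, x)\<in>set (walk (alternating i j m) (linear_part id (v c))). 0 \<le> x \<and> x \<le> 1"
      "\<forall>(l, x)\<in>set (walk (alternating j i m) (linear_part id (v c))). 0 \<le> x \<and> x \<le> 1"
      using walk_alternating(1)[OF b z] walk_alternating(1)[OF bond_sym[OF b] z(2,1)]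
        walk_bounded[OF set(1) v] walk_bounded[OF set(2) v] by fastforce+
    have "R.chain True (monomial (v c)) m = R.chain False (monomial (v c)) m"
      unfolding chain' e
      using fold_hecke_operator[OF set(1) affine_weyl_id O strip(1), of 1] fold_hecke_operator[OF set(2) affine_weyl_id O strip(2), of 1]
        walk_alternating(2)[OF b z] word_rev_braid[OF b] by simp
    moreover have "scalar (kp i) = (scalar (kp j) :: ('a, 'f) fun_field)" if "m = 3"
    proof -
      have "kappa i 0 = kappa j 0" using kappa_eq[OF b that] by simp
      then show ?thesis by (simp add: kappa_def)
    qed
    ultimately have "R.iter True (monomial (v c)) m = R.iter False (monomial (v c)) m"
      using NM(3) O by (intro R.braid_on_vector) (auto simp: D_monomial s_def)
    then show ?thesis unfolding iter[of True, unfolded not_True_eq_False s_values] iter[of False, unfolded not_False_eq_True s_values] .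
  qed
  obtain N M where NM: "grad j \<bullet> coroot (grad i) = - N" "grad i \<bullet> coroot (grad j) = - M"
    "(N, M, m) \<in> {(0, 0, 2), (1, 1, 3), (1, 2, 4), (2, 1, 4), (1, 3, 6), (3, 1, 6)}"
    using bond_cases[OF b] by blast
  then consider N' M' :: int where "N = of_int N'" "M = of_int M'" "(M', N', m) \<in> {(0, 0, 2), (1, 1, 3), (2, 1, 4), (3, 1, 6)}"
    | N' M' :: int where "N = of_int N'" "M = of_int M'" "(N', M', m) \<in> {(0, 0, 2), (1, 1, 3), (2, 1, 4), (3, 1, 6)}"
  proof -
    assume 1: "\<And>N' M' :: int. N = of_int N' \<Longrightarrow> M = of_int M' \<Longrightarrow> (M', N', m) \<in> {(0, 0, 2), (1, 1, 3), (2, 1, 4), (3, 1, 6)} \<Longrightarrow> thesis"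
      and 2: "\<And>N' M' :: int. N = of_int N' \<Longrightarrow> M = of_int M' \<Longrightarrow> (N', M', m) \<in> {(0, 0, 2), (1, 1, 3), (2, 1, 4), (3, 1, 6)} \<Longrightarrow> thesis"
    show thesis
      using NM(3) 1[of 0 0] 1[of 1 1] 1[of 1 2] 1[of 1 3] 2[of 2 1] 2[of 3 1] by auto
  qed
  then show ?thesis
  proof cases
    case 1
    then show ?thesis using *[OF b z] NM(1,2) by simp
  next
    case 2
    then show ?thesis using *[OF bond_sym[OF b] z(2,1), of M' N'] NM(1,2) by simp
  qed
qed

lemma foldr_S_closed: "set js \<subseteq> {0..r} \<Longrightarrow> m \<in> \<D> \<Longrightarrow> foldr S js m \<in> \<D>"
  by (induction js) (auto simp: S_closed)

lemma foldr_S_add: "set js \<subseteq> {0..r} \<Longrightarrow> m \<in> \<D> \<Longrightarrow> n \<in> \<D> \<Longrightarrow> foldr S js (m + n) = foldr S js m + foldr S js n"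
  by (induction js) (auto simp: S_add foldr_S_closed)

lemma foldr_S_mult:
  assumes "set js \<subseteq> {0..r}" "f \<in> \<Q>" "m \<in> \<D>"
  shows "foldr S js (f * m) = act (word js) f * foldr S js m"
  using assms(1)
proof (induction js)
  case Nil
  then show ?case using act_id[OF assms(2)] by (simp add: id_def)
next
  case (Cons j js)
  then have j: "j \<in> {0..r}" "set js \<subseteq> {0..r}" by auto
  have "act (word (j # js)) f = act (sr j) (act (word js) f)"
    unfolding word_simps by (rule act_comp[OF simple_reflection_affine[OF j(1)] word_affine[OF j(2)] assms(2)])
  then show ?case
    using Cons j act_Q[OF word_affine[OF j(2)] assms(2)] assms(3) by (simp add: S_mult foldr_S_closed del: word_simps)
qed

lemma foldr_S_zero: "set js \<subseteq> {0..r} \<Longrightarrow> foldr S js 0 = 0"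
  by (induction js) (auto simp: S_zero)

text \<open>Two words alternating in the same involutions that agree on a vector agree on its images, since
  \<open>\<dots> i j\<close> applied after \<open>i\<close> or \<open>j\<close> is a word of the same kind with one letter more or less.\<close>

lemma braid_image:
  assumes ij: "i \<in> {0..r}" "j \<in> {0..r}" and x: "x \<in> \<D>"
    and eq: "foldr S (alternating i j m) x = foldr S (alternating j i m) x" and m: "m > 0"
  shows "foldr S (alternating i j m) (S i x) = foldr S (alternating j i m) (S i x)"
proof -
  obtain n where n: "m = Suc n" using m by (cases m) auto
  have invol: "S l (S l y) = y" if "y \<in> \<D>" "l \<in> {i, j}" for y l using S_involution that ij by blast
  have closed: "foldr S js x \<in> \<D>" if "set js \<subseteq> {i, j}" for js using foldr_S_closed[of js x] that ij x by (meson insert_subsetI empty_subsetI subset_trans)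
  have snoc: "foldr S (alternating a b (Suc l)) y = foldr S (alternating a b l) (S (if even l then a else b) y)" for a b l y
    by (simp add: alternating_snoc del: alternating.simps(2))
  have c: "foldr S (alternating i j n) x \<in> \<D>" "foldr S (alternating j i n) x \<in> \<D>"
    "foldr S (alternating j i m) x \<in> \<D>" "foldr S (alternating i j m) x \<in> \<D>"
    using closed set_alternating[of i j] set_alternating[of j i] by blast+
  show ?thesis
  proof (cases "even n")
    case True
    have "foldr S (alternating i j m) (S i x) = foldr S (alternating i j n) x"
      unfolding n snoc using True invol[OF x] by simp
    also have "\<dots> = S j (foldr S (alternating j i m) x)" unfolding n using invol c by simp
    also have "\<dots> = S j (foldr S (alternating i j m) x)" by (simp add: eq)
    also have "\<dots> = foldr S (alternating j i (Suc m)) x" by simp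
    also have "\<dots> = foldr S (alternating j i m) (S i x)" unfolding snoc using True n by simp
    finally show ?thesis .
  next
    case False
    have "foldr S (alternating j i m) (S i x) = foldr S (alternating j i n) x"
      unfolding n snoc using False invol[OF x] by simp
    also have "\<dots> = S i (foldr S (alternating i j m) x)" unfolding n using invol c by simp
    also have "\<dots> = S i (foldr S (alternating j i m) x)" by (simp add: eq)
    also have "\<dots> = foldr S (alternating i j (Suc m)) x" by simp
    also have "\<dots> = foldr S (alternating i j m) (S i x)" unfolding snoc using False n by simp
    finally show ?thesis ..
  qed
qed

text \<open>
  The braid relation holds on a \<open>\<Q>\<close>-subspace stable under both operators, which contains the monomials with
  dominant exponent.  An exponent \<open>v c\<close> with \<open>D\<alpha>\<^sub>l(v c) < 0\<close> is the reflection of one where a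
  functional positive on both gradients has a larger value; by induction the monomial \<open>x\<^sup>y\<close> of the
  latter is in the subspace, so is its image under \<open>S l\<close>, and this is a combination of \<open>x\<^sup>y\<close> and the
  monomial of \<open>v c\<close>, the latter with a nonzero coefficient.
\<close>

lemma braid_finite_orbit:
  assumes b: "bond i j m" and v: "v \<in> finite_weyl \<Phi>"
  shows "foldr S (alternating i j m) (monomial (v c)) = foldr S (alternating j i m) (monomial (v c))"
proof -
  have ij: "i \<in> {0..r}" "j \<in> {0..r}" and m: "m > 0" using b by (auto simp: bond_def)
  let ?a = "grad i" and ?b = "grad j"
  have ab: "?a \<in> \<Phi>" "?b \<in> \<Phi>" using gradient_root ij by auto
  \<comment> \<open>Chosen such that the inner products with \<open>?a\<close> and \<open>?b\<close> are both the Gram determinant.\<close>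
  define \<delta> where "\<delta> = (?b \<bullet> ?b - ?a \<bullet> ?b) *\<^sub>R ?a + (?a \<bullet> ?a - ?a \<bullet> ?b) *\<^sub>R ?b"
  have gram: "(?a \<bullet> ?b) * (?a \<bullet> ?b) < (?a \<bullet> ?a) * (?b \<bullet> ?b)"
  proof (rule ccontr)
    assume neg: "\<not> ?thesis"
    obtain N M where NM: "?b \<bullet> coroot ?a = - N" "?a \<bullet> coroot ?b = - M"
      "(N, M, m) \<in> {(0, 0, 2), (1, 1, 3), (1, 2, 4), (2, 1, 4), (1, 3, 6), (3, 1, 6)}"
      using bond_cases[OF b] by blast
    have pos: "?a \<bullet> ?a > 0" "?b \<bullet> ?b > 0" using ab by auto
    have "2 * (?a \<bullet> ?b) = - N * (?a \<bullet> ?a)" "2 * (?a \<bullet> ?b) = - M * (?b \<bullet> ?b)"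
      using NM(1,2) pos by (simp_all add: coroot_def power2_norm_eq_inner inner_commute field_simps)
    then have "2 * (?a \<bullet> ?b) * (2 * (?a \<bullet> ?b)) = - N * (?a \<bullet> ?a) * (- M * (?b \<bullet> ?b))" by (rule arg_cong2)
    then have "4 * ((?a \<bullet> ?b) * (?a \<bullet> ?b)) = (N * M) * ((?a \<bullet> ?a) * (?b \<bullet> ?b))" by (simp add: mult_ac)
    moreover have "N * M \<le> 3" using NM(3) by auto
    ultimately have "4 * ((?a \<bullet> ?b) * (?a \<bullet> ?b)) \<le> 3 * ((?a \<bullet> ?a) * (?b \<bullet> ?b))"
      using pos by (simp add: mult_right_mono)
    moreover have "(?a \<bullet> ?a) * (?b \<bullet> ?b) > 0" using pos by simp
    ultimately show False using neg by linarith
  qed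
  have \<delta>: "?a \<bullet> \<delta> > 0" "?b \<bullet> \<delta> > 0"
    using gram by (simp_all add: \<delta>_def inner_add_right inner_commute[of ?b ?a] algebra_simps)
  \<comment> \<open>The finite set of values of the functional on \<open>W\<^sub>0 c\<close> makes the induction well-founded.\<close>
  define V where "V = (\<lambda>(x, y). (?b \<bullet> ?b - ?a \<bullet> ?b) * (x \<bullet> c) + (?a \<bullet> ?a - ?a \<bullet> ?b) * (y \<bullet> c)) ` (\<Phi> \<times> \<Phi>)"
  have finV: "finite V" unfolding V_def using finite_roots by simp
  have inV: "\<delta> \<bullet> u c \<in> V" if u: "u \<in> finite_weyl \<Phi>" for u
  proof -
    obtain u' where u': "u' \<in> finite_weyl \<Phi>" "u \<circ> u' = id" using finite_weyl_inverse u by blast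
    have "a \<bullet> u c = u' a \<bullet> c" for a
      using finite_weyl_inner[OF u, of "u' a" c] u' by (metis comp_apply id_apply)
    from this[of ?a] this[of ?b]
    have "\<delta> \<bullet> u c = (?b \<bullet> ?b - ?a \<bullet> ?b) * (u' ?a \<bullet> c) + (?a \<bullet> ?a - ?a \<bullet> ?b) * (u' ?b \<bullet> c)"
      by (simp add: \<delta>_def inner_add_left)
    moreover have "(u' ?a, u' ?b) \<in> \<Phi> \<times> \<Phi>" using finite_weyl_root u' ab by auto
    ultimately show ?thesis unfolding V_def by (intro image_eqI[of _ _ "(u' ?a, u' ?b)"]) simp_all
  qed
  show ?thesis using v
  proof (induction "card {x\<in>V. x > \<delta> \<bullet> v c}" arbitrary: v rule: less_induct)
    case (less v)
    have O: "v c \<in> Orb" using finite_in_affine[OF less.prems] by (auto simp: weyl_orbit_def)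
    have step: ?case if l: "l \<in> {i, j}" "grad l \<bullet> v c < 0" for l
    proof -
      have lr: "l \<in> {0..r}" using l ij by auto
      let ?u = "reflection (grad l) \<circ> v" and ?y = "reflection (grad l) (v c)"
      have gl: "grad l \<in> \<Phi>" using gradient_root[OF lr] .
      have u: "?u \<in> finite_weyl \<Phi>" using finite_weyl.intros(2)[OF gl less.prems] .
      have yO: "?y \<in> Orb" using orbit_reflection[OF lr O] .
      have gt: "\<delta> \<bullet> ?y > \<delta> \<bullet> v c"
      proof -
        have "\<delta> \<bullet> ?y = \<delta> \<bullet> v c - (grad l \<bullet> v c) * (2 / (grad l \<bullet> grad l)) * (grad l \<bullet> \<delta>)"
          by (simp add: reflection_def coroot_def power2_norm_eq_inner inner_diff_right inner_commute)
        moreover have "grad l \<bullet> \<delta> > 0" using \<delta> l by auto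
        moreover have "2 / (grad l \<bullet> grad l) > 0" using gl by simp
        ultimately show ?thesis using mult_neg_pos[OF mult_neg_pos[OF l(2)]] by fastforce
      qed
      have "{x\<in>V. x > \<delta> \<bullet> ?y} \<subset> {x\<in>V. x > \<delta> \<bullet> v c}" using gt inV[OF u] by auto
      then have "card {x\<in>V. x > \<delta> \<bullet> ?u c} < card {x\<in>V. x > \<delta> \<bullet> v c}" using finV by (simp add: psubset_card_mono)
      then have IH: "foldr S (alternating i j m) (monomial ?y) = foldr S (alternating j i m) (monomial ?y)"
        using less.hyps[OF _ u] by simp
      define E where "E = {x \<in> \<D>. foldr S (alternating i j m) x = foldr S (alternating j i m) x}"
      have set: "set (alternating i j m) \<subseteq> {0..r}" "set (alternating j i m) \<subseteq> {0..r}"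
        using set_alternating[of i j m] set_alternating[of j i m] ij by blast+
      have E_add: "x + y \<in> E" if "x \<in> E" "y \<in> E" for x y
        using that set by (auto simp: E_def D_add foldr_S_add)
      \<comment> \<open>Both sides are semilinear for the same element of \<open>W\<close>.\<close>
      have E_mult: "f * x \<in> E" if "f \<in> \<Q>" "x \<in> E" for f x
        using that set word_braid[OF b] by (auto simp: E_def D_mult foldr_S_mult)
      have yE: "monomial ?y \<in> E" using IH yO by (simp add: E_def D_monomial)
      have "S l (monomial ?y) \<in> E"
      proof -
        have "S i (monomial ?y) \<in> E"
          using braid_image[OF ij D_monomial[OF yO] IH m] D_monomial[OF yO] ij by (simp add: E_def S_closed)
        moreover have "S j (monomial ?y) \<in> E"
          using braid_image[OF ij(2,1) D_monomial[OF yO] IH[symmetric] m] D_monomial[OF yO] ij by (simp add: E_def S_closed)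
        ultimately show ?thesis using l(1) by auto
      qed
      then have "simple_image l ?y \<in> E" using S_monomial[OF lr yO] by simp
      moreover define C where "C = scalar (kp l ^ of_bool (sval l ?y \<in> \<int>)) * (X l - 1) / denominator l * scalar (tw_scalar l ?y)"
      define C' where "C' = scalar (kp l - inverse (kp l)) / denominator l * X l powi (- \<lfloor>grad l \<bullet> ?y\<rfloor>)"
      have "simple_image l ?y = C * monomial (v c) + C' * monomial ?y"
        by (simp add: simple_image_def tw_eq shifted_monomial_def C_def C'_def mult_ac)
      moreover have C'Q: "C' \<in> \<Q>" and CQ: "C \<in> \<Q>" unfolding C_def C'_def
        by (intro Q_mult Q_divide Q_scalar Q_powi Q_diff Q_one X_Q denominator_Q lr)+
      ultimately have "C * monomial (v c) \<in> E"
        using E_add[of "simple_image l ?y" "(- C') * monomial ?y"] E_mult[OF Q_minus[OF C'Q] yE] by simp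
      then have "inverse C * (C * monomial (v c)) \<in> E" using E_mult Q_inverse CQ by blast
      moreover have "C \<noteq> 0" unfolding C_def
        using kp_nonzero[OF lr] X_not_1[OF lr] denominator_nonzero[OF lr] tw_scalar_nonzero[OF yO] by simp
      ultimately have "monomial (v c) \<in> E" by (simp add: mult.assoc[symmetric])
      then show ?case by (simp add: E_def)
    qed
    show ?case
    proof (cases "grad i \<bullet> v c < 0 \<or> grad j \<bullet> v c < 0")
      case True
      then show ?thesis using step[of i] step[of j] by blast
    next
      case False
      then show ?thesis using braid_dominant[OF b less.prems] by simp
    qed
  qed
qed

text \<open>As \<open>\<Q>\<close> contains the monomials of the coroot lattice, the exponents in \<open>W\<^sub>0 c\<close> suffice.\<close>

lemma S_braid:
  assumes b: "bond i j m" and x: "x \<in> \<D>"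
  shows "foldr S (alternating i j m) x = foldr S (alternating j i m) x"
proof -
  have ij: "i \<in> {0..r}" "j \<in> {0..r}" using b by (auto simp: bond_def)
  have set: "set (alternating i j m) \<subseteq> {0..r}" "set (alternating j i m) \<subseteq> {0..r}"
    using set_alternating[of i j m] set_alternating[of j i m] ij by blast+
  show ?thesis using x
  proof (induction rule: D_induct)
    case (mult f y)
    obtain w where w: "w \<in> W" "y = w c" using orbitE[OF mult(2)] by blast
    obtain \<nu> v where \<nu>: "w = translation \<nu> \<circ> v" "\<nu> \<in> L" "v \<in> finite_weyl \<Phi>"
      using w(1) by (auto simp: affine_weyl_def)
    have O: "v c \<in> Orb" using finite_in_affine[OF \<nu>(3)] by (auto simp: weyl_orbit_def)
    have y: "f * monomial y = (f * monomial \<nu>) * monomial (v c)"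
      using w(2) \<nu>(1) by (simp add: translation_def monomial_add mult_ac)
    have fQ: "f * monomial \<nu> \<in> \<Q>" using Q_mult[OF mult(1) Q_monomial[OF \<nu>(2)]] .
    show ?case
      unfolding y foldr_S_mult[OF set(1) fQ D_monomial[OF O]] foldr_S_mult[OF set(2) fQ D_monomial[OF O]]
      using word_braid[OF b] braid_finite_orbit[OF b \<nu>(3)] by simp
  qed (use set in \<open>simp_all add: foldr_S_zero foldr_S_add\<close>)
qed

section \<open>The action of the affine Weyl group\<close>

definition weyl_action :: "('a \<Rightarrow> 'a) \<Rightarrow> ('a, 'f) fun_field \<Rightarrow> ('a, 'f) fun_field" where
  "weyl_action = weyl_operator S"

lemma weyl_action_word: "set js \<subseteq> {0..r} \<Longrightarrow> m \<in> \<D> \<Longrightarrow> weyl_action (word js) m = foldr S js m"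
  unfolding weyl_action_def by (rule weyl_operator_word[where D = "\<D>"]) (auto simp: S_closed S_involution intro: S_braid)

lemma weyl_action_comp:
  "u \<in> W \<Longrightarrow> w \<in> W \<Longrightarrow> m \<in> \<D> \<Longrightarrow> weyl_action (u \<circ> w) m = weyl_action u (weyl_action w m)"
  unfolding weyl_action_def by (rule weyl_operator_comp[where D = "\<D>"]) (auto simp: S_closed S_involution intro: S_braid)

lemma weyl_action_closed: "w \<in> W \<Longrightarrow> m \<in> \<D> \<Longrightarrow> weyl_action w m \<in> \<D>"
  using affine_weyl_word weyl_action_word foldr_S_closed by metis

lemma weyl_action_id: "m \<in> \<D> \<Longrightarrow> weyl_action id m = m"
  using weyl_action_word[of "[]" m] by (simp add: id_def)

lemma weyl_action_simple: "j \<in> {0..r} \<Longrightarrow> m \<in> \<D> \<Longrightarrow> weyl_action (sr j) m = S j m"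
  using weyl_action_word[of "[j]" m] by simp

lemma weyl_action_add: "w \<in> W \<Longrightarrow> m \<in> \<D> \<Longrightarrow> n \<in> \<D> \<Longrightarrow> weyl_action w (m + n) = weyl_action w m + weyl_action w n"
  using affine_weyl_word[of w] weyl_action_word foldr_S_add D_add by metis

lemma weyl_action_mult: "w \<in> W \<Longrightarrow> f \<in> \<Q> \<Longrightarrow> m \<in> \<D> \<Longrightarrow> weyl_action w (f * m) = act w f * weyl_action w m"
  using affine_weyl_word[of w] weyl_action_word foldr_S_mult D_mult by metis

end

section \<open>The smashed product\<close>

context quasi_polynomial_data
begin

abbreviation (input) C :: "(('a \<Rightarrow> 'a) \<Rightarrow>\<^sub>0 ('a, 'f) fun_field) set" where
  "C \<equiv> carrier (smash_product q \<Phi>)"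

abbreviation sm :: "(('a \<Rightarrow> 'a) \<Rightarrow>\<^sub>0 ('a, 'f) fun_field) \<Rightarrow> (('a \<Rightarrow> 'a) \<Rightarrow>\<^sub>0 ('a, 'f) fun_field)
    \<Rightarrow> (('a \<Rightarrow> 'a) \<Rightarrow>\<^sub>0 ('a, 'f) fun_field)" where "sm \<equiv> smash_mult q \<Phi>"

lemma C_iff: "A \<in> C \<longleftrightarrow> Poly_Mapping.keys A \<subseteq> W \<and> (\<forall>w. Poly_Mapping.lookup A w \<in> \<Q>)"
  by (simp add: smash_product_def)

lemma C_single: "w \<in> W \<Longrightarrow> f \<in> \<Q> \<Longrightarrow> Poly_Mapping.single w f \<in> C"
  by (auto simp: C_iff lookup_single when_def Q_zero)

lemma C_zero: "0 \<in> C" by (simp add: C_iff Q_zero)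

lemma C_add: "A \<in> C \<Longrightarrow> B \<in> C \<Longrightarrow> A + B \<in> C"
  using keys_add[of A B] by (auto simp: C_iff lookup_add Q_add)

lemma C_minus: "A \<in> C \<Longrightarrow> - A \<in> C"
  by (auto simp: C_iff Q_minus)

lemma C_sum: "(\<And>i. i \<in> I \<Longrightarrow> F i \<in> C) \<Longrightarrow> sum F I \<in> C"
  by (induction I rule: infinite_finite_induct) (auto intro: C_zero C_add)

lemma single_decomposition: "A = (\<Sum>w\<in>Poly_Mapping.keys A. Poly_Mapping.single w (Poly_Mapping.lookup A w))"
  by (rule poly_mapping_eqI) (auto simp: lookup_sum lookup_single when_def in_keys_iff)

lemma C_induct [consumes 1, case_names zero single add]:
  assumes A: "A \<in> C" and "P 0" "\<And>w f. w \<in> W \<Longrightarrow> f \<in> \<Q> \<Longrightarrow> P (Poly_Mapping.single w f)"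
    "\<And>A B. A \<in> C \<Longrightarrow> B \<in> C \<Longrightarrow> P A \<Longrightarrow> P B \<Longrightarrow> P (A + B)"
  shows "P A"
proof -
  have "sum (\<lambda>w. Poly_Mapping.single w (Poly_Mapping.lookup A w)) K \<in> C \<and> P (\<Sum>w\<in>K. Poly_Mapping.single w (Poly_Mapping.lookup A w))"
    if "finite K" "K \<subseteq> W" for K
    using that
  proof (induction K rule: finite_induct)
    case (insert w K)
    have "w \<in> W" "Poly_Mapping.lookup A w \<in> \<Q>" using insert.prems A C_iff by auto
    then show ?case using insert assms C_single C_add by simp
  qed (simp add: assms C_zero)
  from this[of "Poly_Mapping.keys A"] show ?thesis using A by (simp add: C_iff flip: single_decomposition)
qed

text \<open>Sums over fixed finite sets containing the supports make the multiplication visibly biadditive.\<close>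

lemma smash_mult_superset:
  assumes A: "A \<in> C" "finite U" "Poly_Mapping.keys A \<subseteq> U" and V: "finite V" "Poly_Mapping.keys B \<subseteq> V"
  shows "sm A B = (\<Sum>u\<in>U. \<Sum>v\<in>V. Poly_Mapping.single (u \<circ> v) (Poly_Mapping.lookup A u * act u (Poly_Mapping.lookup B v)))"
proof -
  have "sm A B = (\<Sum>u\<in>Poly_Mapping.keys A. \<Sum>v\<in>V. Poly_Mapping.single (u \<circ> v) (Poly_Mapping.lookup A u * act u (Poly_Mapping.lookup B v)))"
    unfolding smash_mult_def
  proof (rule sum.cong[OF refl])
    fix u assume "u \<in> Poly_Mapping.keys A"
    then have "u \<in> W" using A(1) C_iff by blast
    then show "(\<Sum>v\<in>Poly_Mapping.keys B. Poly_Mapping.single (u \<circ> v) (Poly_Mapping.lookup A u * act u (Poly_Mapping.lookup B v))) =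
      (\<Sum>v\<in>V. Poly_Mapping.single (u \<circ> v) (Poly_Mapping.lookup A u * act u (Poly_Mapping.lookup B v)))"
      using V by (intro sum.mono_neutral_left) (auto simp: in_keys_iff act_zero)
  qed
  also have "\<dots> = (\<Sum>u\<in>U. \<Sum>v\<in>V. Poly_Mapping.single (u \<circ> v) (Poly_Mapping.lookup A u * act u (Poly_Mapping.lookup B v)))"
    using A by (intro sum.mono_neutral_left) (auto simp: in_keys_iff)
  finally show ?thesis .
qed

lemma smash_mult_single:
  assumes "u \<in> W" "f \<in> \<Q>"
  shows "sm (Poly_Mapping.single u f) (Poly_Mapping.single v g) = Poly_Mapping.single (u \<circ> v) (f * act u g)"
  using smash_mult_superset[OF C_single[OF assms], of "{u}" "{v}" "Poly_Mapping.single v g"] by simp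

lemma smash_mult_add_left:
  assumes "A \<in> C" "A' \<in> C" "B \<in> C" shows "sm (A + A') B = sm A B + sm A' B"
proof -
  let ?U = "Poly_Mapping.keys A \<union> Poly_Mapping.keys A'" and ?V = "Poly_Mapping.keys B"
  have "sm A'' B = (\<Sum>u\<in>?U. \<Sum>v\<in>?V. Poly_Mapping.single (u \<circ> v) (Poly_Mapping.lookup A'' u * act u (Poly_Mapping.lookup B v)))"
    if "A'' \<in> {A, A', A + A'}" for A''
    using that assms C_add[of A A'] keys_add[of A A'] by (intro smash_mult_superset) auto
  then show ?thesis
    by (simp add: lookup_add distrib_right single_add sum.distrib)
qed

lemma smash_mult_add_right:
  assumes "A \<in> C" "B \<in> C" "B' \<in> C" shows "sm A (B + B') = sm A B + sm A B'"
proof -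
  let ?U = "Poly_Mapping.keys A" and ?V = "Poly_Mapping.keys B \<union> Poly_Mapping.keys B'"
  have *: "sm A B'' = (\<Sum>u\<in>?U. \<Sum>v\<in>?V. Poly_Mapping.single (u \<circ> v) (Poly_Mapping.lookup A u * act u (Poly_Mapping.lookup B'' v)))"
    if "B'' \<in> {B, B', B + B'}" for B''
    using that assms keys_add[of B B'] by (intro smash_mult_superset) auto
  have "sm A (B + B') = (\<Sum>u\<in>?U. \<Sum>v\<in>?V. Poly_Mapping.single (u \<circ> v) (Poly_Mapping.lookup A u * act u (Poly_Mapping.lookup B v))
      + Poly_Mapping.single (u \<circ> v) (Poly_Mapping.lookup A u * act u (Poly_Mapping.lookup B' v)))"
    unfolding *[of "B + B'", simplified]
  proof (intro sum.cong refl)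
    fix u v assume "u \<in> ?U"
    then have "u \<in> W" using assms(1) C_iff by blast
    moreover have "Poly_Mapping.lookup B v \<in> \<Q>" "Poly_Mapping.lookup B' v \<in> \<Q>" using assms C_iff by blast+
    ultimately show "Poly_Mapping.single (u \<circ> v) (Poly_Mapping.lookup A u * act u (Poly_Mapping.lookup (B + B') v)) =
        Poly_Mapping.single (u \<circ> v) (Poly_Mapping.lookup A u * act u (Poly_Mapping.lookup B v))
      + Poly_Mapping.single (u \<circ> v) (Poly_Mapping.lookup A u * act u (Poly_Mapping.lookup B' v))"
      by (simp add: lookup_add act_add distrib_left single_add)
  qed
  then show ?thesis using *[of B] *[of B'] by (simp add: sum.distrib)
qed

lemma smash_mult_zero: "sm 0 B = 0" "sm A 0 = 0"
  by (simp_all add: smash_mult_def)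

lemma smash_mult_closed: "A \<in> C \<Longrightarrow> B \<in> C \<Longrightarrow> sm A B \<in> C"
  unfolding smash_mult_def
  by (intro C_sum C_single affine_weyl_comp Q_mult act_Q) (auto simp: C_iff)

lemma smash_mult_assoc:
  assumes "A \<in> C" "B \<in> C" "E \<in> C" shows "sm (sm A B) E = sm A (sm B E)"
  using assms(1)
proof (induction rule: C_induct)
  case (single u f)
  note u = single
  show ?case using assms(2)
  proof (induction rule: C_induct)
    case (single v g)
    note v = single
    have uv: "u \<circ> v \<in> W" "f * act u g \<in> \<Q>" using u v by (auto simp: affine_weyl_comp Q_mult act_Q)
    show ?case using assms(3)
    proof (induction rule: C_induct)
      case (single w h)
      have "sm (sm (Poly_Mapping.single u f) (Poly_Mapping.single v g)) (Poly_Mapping.single w h)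
          = Poly_Mapping.single ((u \<circ> v) \<circ> w) (f * act u g * act (u \<circ> v) h)"
        by (simp only: smash_mult_single[OF u] smash_mult_single[OF uv])
      also have "\<dots> = Poly_Mapping.single (u \<circ> (v \<circ> w)) (f * act u (g * act v h))"
        using u v single by (simp only: act_comp act_mult act_Q comp_assoc mult.assoc)
      also have "\<dots> = sm (Poly_Mapping.single u f) (sm (Poly_Mapping.single v g) (Poly_Mapping.single w h))"
        by (simp only: smash_mult_single[OF u] smash_mult_single[OF v])
      finally show ?case .
    next
      case (add A B)
      then show ?case using u v by (simp add: smash_mult_add_right smash_mult_closed C_single)
    qed (simp add: smash_mult_zero)
  next
    case (add A B)
    then show ?case using u assms(3) by (simp add: smash_mult_add_left smash_mult_add_right smash_mult_closed C_single)
  qed (simp add: smash_mult_zero)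
next
  case (add A B)
  then show ?case using assms(2,3) by (simp add: smash_mult_add_left smash_mult_closed)
qed (simp add: smash_mult_zero)

lemma smash_mult_one: "A \<in> C \<Longrightarrow> sm (Poly_Mapping.single id 1) A = A" "A \<in> C \<Longrightarrow> sm A (Poly_Mapping.single id 1) = A"
proof -
  have one: "Poly_Mapping.single id 1 \<in> C" using C_single affine_weyl_id Q_one by blast
  show "A \<in> C \<Longrightarrow> sm (Poly_Mapping.single id 1) A = A"
  proof (induction rule: C_induct)
    case (single w f)
    show ?case
      unfolding smash_mult_single[OF affine_weyl_id Q_one] act_id[OF single(2)] id_comp mult_1_left ..
  next
    case (add A B)
    show ?case unfolding smash_mult_add_right[OF one add(1,2)] add(3,4) ..
  qed (rule smash_mult_zero)
  show "A \<in> C \<Longrightarrow> sm A (Poly_Mapping.single id 1) = A"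
  proof (induction rule: C_induct)
    case (single w f)
    show ?case
      unfolding smash_mult_single[OF single] act_one[OF single(1)] comp_id mult_1_right ..
  next
    case (add A B)
    show ?case unfolding smash_mult_add_left[OF add(1,2) one] add(3,4) ..
  qed (rule smash_mult_zero)
qed

lemma smash_product_ring: "ring (smash_product q \<Phi> :: (('a \<Rightarrow> 'a) \<Rightarrow>\<^sub>0 ('a, 'f) fun_field) ring)"
proof (rule ringI)
  have [simp]: "mult (smash_product q \<Phi>) = sm" "one (smash_product q \<Phi>) = Poly_Mapping.single id (1 :: ('a, 'f) fun_field)"
    "zero (smash_product q \<Phi>) = (0 :: ('a \<Rightarrow> 'a) \<Rightarrow>\<^sub>0 ('a, 'f) fun_field)"
    "add (smash_product q \<Phi>) = ((+) :: (('a \<Rightarrow> 'a) \<Rightarrow>\<^sub>0 ('a, 'f) fun_field) \<Rightarrow> _)"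
    by (simp_all add: smash_product_def)
  show "abelian_group (smash_product q \<Phi> :: (('a \<Rightarrow> 'a) \<Rightarrow>\<^sub>0 ('a, 'f) fun_field) ring)"
  proof (rule abelian_groupI)
    fix A :: "('a \<Rightarrow> 'a) \<Rightarrow>\<^sub>0 ('a, 'f) fun_field" assume "A \<in> C"
    then show "\<exists>B\<in>C. B \<oplus>\<^bsub>smash_product q \<Phi>\<^esub> A = \<zero>\<^bsub>smash_product q \<Phi>\<^esub>"
      by (intro bexI[of _ "- A"]) (simp_all add: C_minus)
  qed (simp_all add: C_add C_zero add_ac)
  show "Group.monoid (smash_product q \<Phi> :: (('a \<Rightarrow> 'a) \<Rightarrow>\<^sub>0 ('a, 'f) fun_field) ring)"
    by (rule Group.monoidI) (simp_all add: smash_mult_closed smash_mult_assoc smash_mult_one C_single affine_weyl_id Q_one)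
qed (simp_all add: smash_product_def[THEN arg_cong[where f = mult]] smash_product_def[THEN arg_cong[where f = add]]
      smash_mult_add_left smash_mult_add_right)

section \<open>The module structure\<close>

definition sigma :: "(('a \<Rightarrow> 'a) \<Rightarrow>\<^sub>0 ('a, 'f) fun_field) \<Rightarrow> ('a, 'f) fun_field \<Rightarrow> ('a, 'f) fun_field" where
  "sigma A m = (\<Sum>w\<in>Poly_Mapping.keys A. Poly_Mapping.lookup A w * weyl_action w m)"

lemma sigma_single [simp]: "sigma (Poly_Mapping.single w f) m = f * weyl_action w m"
  by (cases "f = 0") (simp_all add: sigma_def)

lemma sigma_zero [simp]: "sigma 0 m = 0"
  by (simp add: sigma_def)

lemma sigma_add_left: "sigma (A + B) m = sigma A m + sigma B m"
proof -
  let ?U = "Poly_Mapping.keys A \<union> Poly_Mapping.keys B"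
  have *: "sigma E m = (\<Sum>w\<in>?U. Poly_Mapping.lookup E w * weyl_action w m)" if "Poly_Mapping.keys E \<subseteq> ?U" for E
    unfolding sigma_def using that by (intro sum.mono_neutral_left) (auto simp: in_keys_iff)
  show ?thesis using *[of A] *[of B] *[of "A + B"] keys_add[of A B]
    by (simp add: lookup_add distrib_right sum.distrib)
qed

lemma sigma_add_right: "A \<in> C \<Longrightarrow> m \<in> \<D> \<Longrightarrow> n \<in> \<D> \<Longrightarrow> sigma A (m + n) = sigma A m + sigma A n"
  by (induction rule: C_induct) (simp_all add: weyl_action_add sigma_add_left distrib_left)

lemma sigma_closed: "A \<in> C \<Longrightarrow> m \<in> \<D> \<Longrightarrow> sigma A m \<in> \<D>"
  by (induction rule: C_induct) (simp_all add: D_zero D_mult weyl_action_closed sigma_add_left D_add)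

lemma sigma_assoc:
  assumes "A \<in> C" "B \<in> C" "m \<in> \<D>" shows "sigma (sm A B) m = sigma A (sigma B m)"
  using assms(1)
proof (induction rule: C_induct)
  case (single u f)
  note u = single
  show ?case using assms(2)
  proof (induction rule: C_induct)
    case zero
    have "weyl_action u 0 = 0"
      using weyl_action_add[OF u(1) D_zero D_zero] unfolding add_0_left by (metis add_cancel_right_right)
    then show ?case by (simp add: smash_mult_zero)
  next
    case (single v g)
    then show ?case using u assms(3)
      by (simp only: smash_mult_single sigma_single weyl_action_mult weyl_action_comp weyl_action_closed mult.assoc)
  next
    case (add A B)
    then show ?case using u assms(3)
      by (simp only: smash_mult_add_right C_single sigma_add_left sigma_add_right sigma_closed)
  qed
next
  case (add A B)
  then show ?case using assms(2,3) by (simp only: smash_mult_add_left sigma_add_left)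
qed (simp add: smash_mult_zero)

lemma quasi_rational_abelian_group:
  fixes s :: "(('a \<Rightarrow> 'a) \<Rightarrow>\<^sub>0 ('a, 'f) fun_field) \<Rightarrow> ('a, 'f) fun_field \<Rightarrow> ('a, 'f) fun_field"
  shows "abelian_group (quasi_rational_module \<Phi> c s)"
proof (rule abelian_groupI)
  fix m assume "m \<in> carrier (quasi_rational_module \<Phi> c s)"
  then show "\<exists>n\<in>carrier (quasi_rational_module \<Phi> c s). n \<oplus>\<^bsub>quasi_rational_module \<Phi> c s\<^esub> m = \<zero>\<^bsub>quasi_rational_module \<Phi> c s\<^esub>"
    by (intro bexI[of _ "- m"]) (simp_all add: quasi_rational_module_def D_minus)
qed (simp_all add: quasi_rational_module_def D_add D_zero add_ac)

lemma sigma_module: "left_module (smash_product q \<Phi>) (quasi_rational_module \<Phi> c sigma)"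
proof -
  have c: "carrier (quasi_rational_module \<Phi> c sigma) = \<D>" "smult (quasi_rational_module \<Phi> c sigma) = sigma"
    "add (quasi_rational_module \<Phi> c sigma) = (+)"
    by (simp_all add: quasi_rational_module_def)
  have s: "mult (smash_product q \<Phi>) = sm" "one (smash_product q \<Phi>) = Poly_Mapping.single id (1 :: ('a, 'f) fun_field)"
    "add (smash_product q \<Phi>) = ((+) :: (('a \<Rightarrow> 'a) \<Rightarrow>\<^sub>0 ('a, 'f) fun_field) \<Rightarrow> _)"
    by (simp_all add: smash_product_def)
  show ?thesis
    by (intro left_module.intro left_module_axioms.intro smash_product_ring quasi_rational_abelian_group)
       (simp_all only: c s sigma_closed sigma_add_left sigma_add_right sigma_assoc sigma_single weyl_action_id mult_1_left)
qed

lemma sigma_formulas_hold: "sigma_formulas q k \<Phi> r \<alpha> \<phi> c t sigma"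
proof -
  have "sigma (smash_weyl (sr j)) (monomial y) = simple_image j y" if "j \<in> {0..r}" "y \<in> Orb" for j y
    using that by (simp add: smash_weyl_def weyl_action_simple S_monomial D_monomial)
  moreover have "sigma (smash_fun f) (monomial y) = f * monomial y" if "y \<in> Orb" for f y
    using that by (simp add: smash_fun_def weyl_action_id D_monomial)
  ultimately show ?thesis
    unfolding sigma_formulas_def Let_def simple_image_def denominator_def by blast
qed

text \<open>The formulas determine the action: \<open>\<Q>\<close> acts by multiplication, so the simple reflections act by
  semilinear extension, and they generate.\<close>

lemma sigma_unique:
  assumes mod: "left_module (smash_product q \<Phi>) (quasi_rational_module \<Phi> c s)"
    and formulas: "sigma_formulas q k \<Phi> r \<alpha> \<phi> c t s"
    and A: "A \<in> C" and m: "m \<in> \<D>"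
  shows "s A m = sigma A m"
proof -
  have cM: "carrier (quasi_rational_module \<Phi> c s) = \<D>" "smult (quasi_rational_module \<Phi> c s) = s"
    "add (quasi_rational_module \<Phi> c s) = (+)"
    by (simp_all add: quasi_rational_module_def)
  have cR: "mult (smash_product q \<Phi>) = sm"
    "add (smash_product q \<Phi>) = ((+) :: (('a \<Rightarrow> 'a) \<Rightarrow>\<^sub>0 ('a, 'f) fun_field) \<Rightarrow> _)"
    by (simp_all add: smash_product_def)
  note M = left_module.smult_l_distr[OF mod, unfolded cM cR] left_module.smult_r_distr[OF mod, unfolded cM cR]
    left_module.smult_assoc1[OF mod, unfolded cM cR] left_module.smult_closed[OF mod, unfolded cM cR]
  have zero_l: "s 0 m = 0" if "m \<in> \<D>" for m
    using M(1)[OF C_zero C_zero that] unfolding add_0_left by (metis add_cancel_right_right)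
  have zero_r: "s A 0 = 0" if "A \<in> C" for A
    using M(2)[OF that D_zero D_zero] unfolding add_0_left by (metis add_cancel_right_right)
  have simple: "s (smash_weyl (sr j)) (monomial y) = simple_image j y" if "j \<in> {0..r}" "y \<in> Orb" for j y
    using formulas that unfolding sigma_formulas_def Let_def simple_image_def denominator_def by blast
  have mono: "s (Poly_Mapping.single id f) (monomial y) = f * monomial y" if "f \<in> \<Q>" "y \<in> Orb" for f y
    using formulas that unfolding sigma_formulas_def smash_fun_def by blast
  have fun_C: "Poly_Mapping.single id f \<in> C" if "f \<in> \<Q>" for f using C_single[OF affine_weyl_id that] .
  have Q_acts: "s (Poly_Mapping.single id f) m = f * m" if f: "f \<in> \<Q>" and m: "m \<in> \<D>" for f m
    using m
  proof (induction rule: D_induct)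
    case zero
    then show ?case unfolding zero_r[OF fun_C[OF f]] by simp
  next
    case (add x y)
    then show ?case unfolding M(2)[OF fun_C[OF f] add(1,2)] by (simp only: distrib_left)
  next
    case (mult g y)
    have "s (Poly_Mapping.single id f) (g * monomial y) = s (Poly_Mapping.single id f) (s (Poly_Mapping.single id g) (monomial y))"
      using mono mult by simp
    also have "\<dots> = s (sm (Poly_Mapping.single id f) (Poly_Mapping.single id g)) (monomial y)"
      using M(3)[OF fun_C[OF f] fun_C[OF mult(1)] D_monomial[OF mult(2)]] by simp
    also have "sm (Poly_Mapping.single id f) (Poly_Mapping.single id g) = Poly_Mapping.single id (f * g)"
      using smash_mult_single[OF affine_weyl_id f, of id g] act_id[OF mult(1)] by simp
    also have "s \<dots> (monomial y) = f * (g * monomial y)" using mono[OF Q_mult[OF f mult(1)] mult(2)] by simp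
    finally show ?case .
  qed
  have weyl_C: "Poly_Mapping.single w 1 \<in> C" if "w \<in> W" for w using C_single[OF that Q_one] .
  have simple_acts: "s (Poly_Mapping.single (sr j) 1) m = S j m" if j: "j \<in> {0..r}" and m: "m \<in> \<D>" for j m
    using m
  proof (induction rule: D_induct)
    case zero
    then show ?case using zero_r[OF weyl_C[OF simple_reflection_affine[OF j]]] S_zero[OF j] by simp
  next
    case (add x y)
    then show ?case using M(2)[OF weyl_C[OF simple_reflection_affine[OF j]]] S_add[OF j] by simp
  next
    case (mult f y)
    let ?W = "Poly_Mapping.single (sr j) (1 :: ('a, 'f) fun_field)"
    have sW: "sr j \<in> W" using simple_reflection_affine[OF j] .
    have af: "act (sr j) f \<in> \<Q>" using act_Q[OF sW mult(1)] .
    have "s ?W (f * monomial y) = s (sm ?W (Poly_Mapping.single id f)) (monomial y)"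
      using M(3)[OF weyl_C[OF sW] fun_C[OF mult(1)] D_monomial[OF mult(2)]] mono mult by simp
    also have "sm ?W (Poly_Mapping.single id f) = sm (Poly_Mapping.single id (act (sr j) f)) ?W"
      unfolding smash_mult_single[OF sW Q_one] smash_mult_single[OF affine_weyl_id af] act_one[OF affine_weyl_id]
      by simp
    also have "s \<dots> (monomial y) = act (sr j) f * s ?W (monomial y)"
      using M(3)[OF fun_C[OF af] weyl_C[OF sW] D_monomial[OF mult(2)]] Q_acts[OF af] M(4)[OF weyl_C[OF sW] D_monomial[OF mult(2)]] by simp
    also have "s ?W (monomial y) = simple_image j y" using simple[OF j mult(2)] by (simp add: smash_weyl_def)
    finally show ?case using S_mult[OF j mult(1) D_monomial[OF mult(2)]] S_monomial[OF j mult(2)] by simp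
  qed
  have word_acts: "s (Poly_Mapping.single (word js) 1) m = foldr S js m" if "set js \<subseteq> {0..r}" "m \<in> \<D>" for js m
    using that
  proof (induction js)
    case Nil
    then show ?case unfolding word_simps Q_acts[OF Q_one Nil(2)] by simp
  next
    case (Cons j js)
    then have j: "j \<in> {0..r}" "set js \<subseteq> {0..r}" by auto
    have "Poly_Mapping.single (word (j # js)) 1 = sm (Poly_Mapping.single (sr j) 1) (Poly_Mapping.single (word js) (1 :: ('a, 'f) fun_field))"
      unfolding word_simps smash_mult_single[OF simple_reflection_affine[OF j(1)] Q_one] act_one[OF simple_reflection_affine[OF j(1)]] by simp
    then have "s (Poly_Mapping.single (word (j # js)) 1) m = s (Poly_Mapping.single (sr j) 1) (s (Poly_Mapping.single (word js) 1) m)"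
      using M(3)[OF weyl_C[OF simple_reflection_affine[OF j(1)]] weyl_C[OF word_affine[OF j(2)]] Cons.prems(2)] by simp
    also have "\<dots> = foldr S (j # js) m"
      unfolding Cons.IH[OF j(2) Cons.prems(2)] simple_acts[OF j(1) foldr_S_closed[OF j(2) Cons.prems(2)]]
      by simp
    finally show ?case .
  qed
  show ?thesis using A
  proof (induction rule: C_induct)
    case zero
    then show ?case using zero_l m by simp
  next
    case (single w f)
    obtain js where js: "set js \<subseteq> {0..r}" "w = word js" using affine_weyl_word[OF single(1)] by blast
    have "Poly_Mapping.single w f = sm (Poly_Mapping.single id f) (Poly_Mapping.single w 1)"
      unfolding smash_mult_single[OF affine_weyl_id single(2)] act_one[OF affine_weyl_id] by simp
    then have "s (Poly_Mapping.single w f) m = f * s (Poly_Mapping.single w 1) m"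
      using M(3)[OF fun_C[OF single(2)] weyl_C[OF single(1)] m] Q_acts[OF single(2) M(4)[OF weyl_C[OF single(1)] m]] by simp
    then show ?case using word_acts[OF js(1) m] weyl_action_word[OF js(1) m] js(2) by simp
  next
    case (add A B)
    then show ?case using M(1)[OF add(1,2) m] by (simp add: sigma_add_left)
  qed
qed

end

theorem theorem4p9:
  fixes \<Phi> :: "'a::euclidean_space set" and r :: nat and \<alpha> :: "nat \<Rightarrow> 'a" and \<phi> :: 'a
    and q :: "'f::field_char_0" and k :: "'a \<Rightarrow> 'f"
    and J :: "nat set" and c :: 'a and t :: "'a \<Rightarrow> 'f"
  assumes "root_data \<Phi> r \<alpha> \<phi>"
    and "q \<noteq> 0" and "\<And>n::nat. n > 0 \<Longrightarrow> q ^ n \<noteq> 1"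
    and "\<And>a. a \<in> \<Phi> \<Longrightarrow> k a \<noteq> 0"
    and "\<And>a b. a \<in> \<Phi> \<Longrightarrow> b \<in> \<Phi> \<Longrightarrow> norm a = norm b \<Longrightarrow> k a = k b"
    and "J \<subset> {0..r}"
    and "c \<in> alcove_face \<Phi> r \<alpha> \<phi> J"
    and "t \<in> torus_face q \<Phi> \<alpha> \<phi> J"
  shows "\<exists>\<sigma>. left_module (smash_product q \<Phi>) (quasi_rational_module \<Phi> c \<sigma>) \<and>
      sigma_formulas q k \<Phi> r \<alpha> \<phi> c t \<sigma> \<and>
      (\<forall>\<sigma>'. left_module (smash_product q \<Phi>) (quasi_rational_module \<Phi> c \<sigma>') \<and>
          sigma_formulas q k \<Phi> r \<alpha> \<phi> c t \<sigma>' \<longrightarrow>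
        (\<forall>A\<in>carrier (smash_product q \<Phi>). \<forall>m\<in>quasi_rational \<Phi> c. \<sigma>' A m = \<sigma> A m))"
proof -
  interpret quasi_polynomial_data \<Phi> r \<alpha> \<phi> q k J c t
  proof (rule quasi_polynomial_data.intro[OF assms(1) quasi_polynomial_data_axioms.intro])
    show "q \<noteq> 0" by (rule assms(2))
    show "J \<subseteq> {0..r}" using assms(6) by (rule psubset_imp_subset)
    show "c \<in> alcove_face \<Phi> r \<alpha> \<phi> J" by (rule assms(7))
    show "t \<in> torus_face q \<Phi> \<alpha> \<phi> J" by (rule assms(8))
  qed (fact assms(4), fact assms(5))
  show ?thesis
    by (rule exI[of _ sigma], intro conjI allI impI ballI)
      (use sigma_module sigma_formulas_hold sigma_unique in blast)+
qed

end
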